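(* Let $k$ be a field, $D$ an associative unital $k$-algebra with multiplication $\mu_D$ and unit $1_D$, $W$ a vector space with a distinguished element $1_W\in W$, and $V$ a vector space with a distinguished element $1_V\in V$. Let $W\overline{\otimes}_{P,\nu}D$ be a mirror crossed product and $D\otimes_{R,\sigma}V$ a crossed product (as defined in the context), with structure maps $P:D\otimes W\to W\otimes D$, $\nu:W\otimes W\to W\otimes D$, $R:V\otimes D\to D\otimes V$, $\sigma:V\otimes V\to D\otimes V$. Assume that we have a linear map $Q:V\otimes W\to W\otimes D\otimes V$ such that $Q(1_V\otimes w)=w\otimes 1_D\otimes 1_V$ and $Q(v\otimes 1_W)=1_W\otimes 1_D\otimes v$ for all $v\in V$, $w\in W$, and such that the following three conditions are satisfied: (a) $$(id_W\otimes\mu_D\otimes id_V)\circ(id_W\otimes id_D\otimes R)\circ(Q\otimes id_D)\circ(id_V\otimes P)=(id_W\otimes\mu_D\otimes id_V)\circ(P\otimes id_D\otimes id_V)\circ(id_D\otimes Q)\circ(R\otimes id_W);$$ (b) $$(id_W\otimes\mu_D\otimes id_V)\circ(id_W\otimes id_D\otimes R)\circ(Q\otimes id_D)\circ(id_V\otimes\nu)$$ $$=(id_W\otimes\mu_D\otimes id_V)\circ(\nu\otimes\mu_D\otimes id_V)\circ(id_W\otimes P\otimes id_D\otimes id_V)\circ(id_W\otimes id_D\otimes Q)\circ(Q\otimes id_W);$$ (c) $$(id_W\otimes\mu_D\otimes id_V)\circ(P\otimes id_D\otimes id_V)\circ(id_D\otimes Q)\circ(\sigma\otimes id_W)$$ $$=(id_W\otimes\mu_D\otimes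 id_V)\circ(id_W\otimes\mu_D\otimes\sigma)\circ(id_W\otimes id_D\otimes R\otimes id_V)\circ(Q\otimes id_D\otimes id_V)\circ(id_V\otimes Q).$$ Then: (i) Define linear maps $\overline{\sigma}:V\otimes V\to(W\overline{\otimes}_{P,\nu}D)\otimes V$ by $\overline{\sigma}(v\otimes v')=1_W\otimes\sigma(v\otimes v')$ for all $v,v'\in V$, i.e. $\overline{\sigma}(v\otimes v')=(1_W\otimes\sigma_1(v,v'))\otimes\sigma_2(v,v')$ if $\sigma(v\otimes v')=\sigma_1(v,v')\otimes\sigma_2(v,v')$ (implicit summation), and $\overline{R}:V\otimes(W\overline{\otimes}_{P,\nu}D)\to(W\overline{\otimes}_{P,\nu}D)\otimes V$ by $$\overline{R}=(id_W\otimes\mu_D\otimes id_V)\circ(id_W\otimes id_D\otimes R)\circ(Q\otimes id_D).$$ Then we have a crossed product $(W\overline{\otimes}_{P,\nu}D)\otimes_{\overline{R},\overline{\sigma}}V$. (ii) Define linear maps $\overline{\nu}:W\otimes W\to W\otimes(D\otimes_{R,\sigma}V)$ by $\overline{\nu}(w\otimes w')=\nu(w\otimes w')\otimes 1_V$ for all $w,w'\in W$, i.e. $\overline{\nu}(w\otimes w')=\nu_1(w,w')\otimes(\nu_2(w,w')\otimes 1_V)$ if $\nu(w\otimes w')=\nu_1(w,w')\otimes\nu_2(w,w')$ (implicit summation), and $\overline{P}:(D\otimes_{R,\sigma}V)\otimes W\to W\otimes(D\otimes_{R,\sigma}V)$ by $$\overline{P}=(id_W\otimes\mu_D\otimes id_V)\circ(P\otimes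 id_D\otimes id_V)\circ(id_D\otimes Q).$$ Then we have a mirror crossed product $W\overline{\otimes}_{\overline{P},\overline{\nu}}(D\otimes_{R,\sigma}V)$. (iii) There is an algebra isomorphism $$(W\overline{\otimes}_{P,\nu}D)\otimes_{\overline{R},\overline{\sigma}}V\cong W\overline{\otimes}_{\overline{P},\overline{\nu}}(D\otimes_{R,\sigma}V)$$ given by the trivial identification $(w\otimes d)\otimes v\mapsto w\otimes(d\otimes v)$.
   Context: All vector spaces, algebras, linear maps and tensor products are over a fixed field $k$; "algebra" means associative unital algebra. Associativity of the tensor product of vector spaces is treated as an identity. Crossed product (Brzeziński). Let $(A,\mu,1_A)$ be an algebra, $V$ a vector space with a distinguished element $1_V\in V$, and $\sigma:V\otimes V\to A\otimes V$, $R:V\otimes A\to A\otimes V$ linear maps. One says that "we have a crossed product $A\otimes_{R,\sigma}V$" if for all $a\in A$, $v\in V$: - $R(1_V\otimes a)=a\otimes 1_V$ and $R(v\otimes 1_A)=1_A\otimes v$; - $\sigma(1_V\otimes v)=\sigma(v\otimes 1_V)=1_A\otimes v$; - $R\circ(id_V\otimes\mu)=(\mu\otimes id_V)\circ(id_A\otimes R)\circ(R\otimes id_A)$; - $(\mu\otimes id_V)\circ(id_A\otimes\sigma)\circ(R\otimes id_V)\circ(id_V\otimes\sigma)=(\mu\otimes id_V)\circ(id_A\otimes\sigma)\circ(\sigma\otimes id_V)$; - $(\mu\otimes id_V)\circ(id_A\otimes\sigma)\circ(R\otimes id_V)\circ(id_V\otimes R)=(\mu\otimes id_V)\circ(id_A\otimes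 R)\circ(\sigma\otimes id_A)$. In this case $A\otimes V$ is an associative algebra with unit $1_A\otimes 1_V$ and multiplication $(\mu_2\otimes id_V)\circ(id_A\otimes id_A\otimes\sigma)\circ(id_A\otimes R\otimes id_V)$, where $\mu_2=\mu\circ(id_A\otimes\mu)$; this algebra is denoted $A\otimes_{R,\sigma}V$. Mirror crossed product. Let $(B,\mu,1_B)$ be an algebra, $W$ a vector space with a distinguished element $1_W\in W$, and $\nu:W\otimes W\to W\otimes B$, $P:B\otimes W\to W\otimes B$ linear maps. One says that "we have a (mirror) crossed product $W\overline{\otimes}_{P,\nu}B$" if for all $b\in B$, $w\in W$: - $P(b\otimes 1_W)=1_W\otimes b$ and $P(1_B\otimes w)=w\otimes 1_B$; - $\nu(w\otimes 1_W)=\nu(1_W\otimes w)=w\otimes 1_B$; - $P\circ(\mu\otimes id_W)=(id_W\otimes\mu)\circ(P\otimes id_B)\circ(id_B\otimes P)$; - $(id_W\otimes\mu)\circ(\nu\otimes id_B)\circ(id_W\otimes P)\circ(\nu\otimes id_W)=(id_W\otimes\mu)\circ(\nu\otimes id_B)\circ(id_W\otimes\nu)$; - $(id_W\otimes\mu)\circ(\nu\otimes id_B)\circ(id_W\otimes P)\circ(P\otimes id_W)=(id_W\otimes\mu)\circ(P\otimes id_B)\circ(id_B\otimes\nu)$. In this case $W\otimes B$ is an associative algebra with unit $1_W\otimes 1_B$ and multiplication $(id_W\otimes\mu_2)\circ(\nu\otimes id_B\otimes id_B)\circ(id_W\otimes P\otimes id_B)$, where $\mu_2=\mu\circ(id_B\otimes\mu)$;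 this algebra is denoted $W\overline{\otimes}_{P,\nu}B$. In (i) the crossed product is formed with the algebra $A=W\overline{\otimes}_{P,\nu}D$ and the pointed vector space $(V,1_V)$; in (ii) the mirror crossed product is formed with the algebra $B=D\otimes_{R,\sigma}V$ and the pointed vector space $(W,1_W)$. *)

theory Defs
  imports "HOL-Algebra.QuotRing" "Jordan_Normal_Form.Missing_VectorSpace"
begin

section \<open>Tensor products of vector spaces\<close>

text \<open>
  A vector space over \<open>K\<close> is a \<open>module\<close> record satisfying \<^locale>\<open>vectorspace\<close>; an algebra uses
  in addition the fields \<open>mult\<close> and \<open>one\<close> of that record, which are left unspecified
  for a mere vector space.
\<close>

definition free_space :: "('k, 'm) ring_scheme \<Rightarrow> 's set \<Rightarrow> ('k, 's \<Rightarrow> 'k) module" where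
  "free_space K S =
    \<lparr>carrier = {f. range f \<subseteq> carrier K \<and> finite {s. f s \<noteq> \<zero>\<^bsub>K\<^esub>} \<and> {s. f s \<noteq> \<zero>\<^bsub>K\<^esub>} \<subseteq> S},
     mult = undefined, one = undefined,
     zero = (\<lambda>s. \<zero>\<^bsub>K\<^esub>),
     add = (\<lambda>f g s. f s \<oplus>\<^bsub>K\<^esub> g s),
     smult = (\<lambda>a f s. a \<otimes>\<^bsub>K\<^esub> f s)\<rparr>"

definition free_gen :: "('k, 'm) ring_scheme \<Rightarrow> 's \<Rightarrow> 's \<Rightarrow> 'k" where
  "free_gen K s = (\<lambda>t. if t = s then \<one>\<^bsub>K\<^esub> else \<zero>\<^bsub>K\<^esub>)"

definition quotient_space :: "('k, 'a, 'm) module_scheme \<Rightarrow> 'a set \<Rightarrow> ('k, 'a set) module" where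
  "quotient_space F N =
    \<lparr>carrier = a_rcosets\<^bsub>F\<^esub> N,
     mult = undefined, one = undefined,
     zero = N,
     add = set_add F,
     smult = (\<lambda>a X. \<Union>x\<in>X. N +>\<^bsub>F\<^esub> (a \<odot>\<^bsub>F\<^esub> x))\<rparr>"

definition tensor_rels ::
  "('k, 'm) ring_scheme \<Rightarrow> ('k, 'v, 'm1) module_scheme \<Rightarrow> ('k, 'w, 'm2) module_scheme \<Rightarrow>
    ('v \<times> 'w \<Rightarrow> 'k) set" where
  "tensor_rels K V W =
    (let F = free_space K (carrier V \<times> carrier W); \<delta> = (\<lambda>v w. free_gen K (v, w)) in
       {\<delta> (v \<oplus>\<^bsub>V\<^esub> v') w \<ominus>\<^bsub>F\<^esub> (\<delta> v w \<oplus>\<^bsub>F\<^esub> \<delta> v' w) | v v' w.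
          v \<in> carrier V \<and> v' \<in> carrier V \<and> w \<in> carrier W} \<union>
       {\<delta> v (w \<oplus>\<^bsub>W\<^esub> w') \<ominus>\<^bsub>F\<^esub> (\<delta> v w \<oplus>\<^bsub>F\<^esub> \<delta> v w') | v w w'.
          v \<in> carrier V \<and> w \<in> carrier W \<and> w' \<in> carrier W} \<union>
       {\<delta> (a \<odot>\<^bsub>V\<^esub> v) w \<ominus>\<^bsub>F\<^esub> (a \<odot>\<^bsub>F\<^esub> \<delta> v w) | a v w.
          a \<in> carrier K \<and> v \<in> carrier V \<and> w \<in> carrier W} \<union>
       {\<delta> v (a \<odot>\<^bsub>W\<^esub> w) \<ominus>\<^bsub>F\<^esub> (a \<odot>\<^bsub>F\<^esub> \<delta> v w) | a v w.
          a \<in> carrier K \<and> v \<in> carrier V \<and> w \<in> carrier W})"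

definition tensor_null ::
  "('k, 'm) ring_scheme \<Rightarrow> ('k, 'v, 'm1) module_scheme \<Rightarrow> ('k, 'w, 'm2) module_scheme \<Rightarrow>
    ('v \<times> 'w \<Rightarrow> 'k) set" where
  "tensor_null K V W = module.span K (free_space K (carrier V \<times> carrier W)) (tensor_rels K V W)"

definition tensor ::
  "('k, 'm) ring_scheme \<Rightarrow> ('k, 'v, 'm1) module_scheme \<Rightarrow> ('k, 'w, 'm2) module_scheme \<Rightarrow>
    ('k, ('v \<times> 'w \<Rightarrow> 'k) set) module"  (\<open>(_ \<Otimes>\<index> _)\<close> [76, 75] 75) where
  "V \<Otimes>\<^bsub>K\<^esub> W = quotient_space (free_space K (carrier V \<times> carrier W)) (tensor_null K V W)"

definition ptensor ::
  "('k, 'm) ring_scheme \<Rightarrow> ('k, 'v, 'm1) module_scheme \<Rightarrow> ('k, 'w, 'm2) module_scheme \<Rightarrow>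
    'v \<Rightarrow> 'w \<Rightarrow> ('v \<times> 'w \<Rightarrow> 'k) set" where
  "ptensor K V W v w =
    tensor_null K V W +>\<^bsub>free_space K (carrier V \<times> carrier W)\<^esub> free_gen K (v, w)"

text \<open>
  \<open>ptensor K V W v w\<close> is the pure tensor of \<open>v\<close> and \<open>w\<close>. \<open>tensor_lift K U b\<close> is the linear map \<open>V \<Otimes>\<^bsub>K\<^esub> W \<rightarrow> U\<close>
  induced by a bilinear map \<open>b\<close>: a class represented by the formal sum
  \<open>f\<close> is sent to the sum of the \<open>f (v, w) \<odot> b v w\<close>. For bilinear \<open>b\<close> this does not depend on
  the representative.
\<close>

definition tensor_lift ::
  "('k, 'm) ring_scheme \<Rightarrow> ('k, 'u, 'm1) module_scheme \<Rightarrow> ('v \<Rightarrow> 'w \<Rightarrow> 'u) \<Rightarrow>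
    ('v \<times> 'w \<Rightarrow> 'k) set \<Rightarrow> 'u" where
  "tensor_lift K U b X =
    the_elem ((\<lambda>f. \<Oplus>\<^bsub>U\<^esub>p\<in>{p. f p \<noteq> \<zero>\<^bsub>K\<^esub>}. f p \<odot>\<^bsub>U\<^esub> b (fst p) (snd p)) ` X)"

text \<open>
  \<open>tmap K V' W' f g\<close> is the tensor product of \<open>f : V \<rightarrow> V'\<close> and \<open>g : W \<rightarrow> W'\<close>; only the
  codomains need to be given. Likewise \<open>assoc K U V W : (U \<Otimes> V) \<Otimes> W \<rightarrow> U \<Otimes> (V \<Otimes> W)\<close>, with inverse
  \<open>assoc_inv K U V W\<close>, and \<open>mult_map K A : A \<Otimes> A \<rightarrow> A\<close>.
\<close>

definition tmap ::
  "('k, 'm) ring_scheme \<Rightarrow> ('k, 'v1, 'm1) module_scheme \<Rightarrow> ('k, 'w1, 'm2) module_scheme \<Rightarrow>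
    ('v \<Rightarrow> 'v1) \<Rightarrow> ('w \<Rightarrow> 'w1) \<Rightarrow> ('v \<times> 'w \<Rightarrow> 'k) set \<Rightarrow> ('v1 \<times> 'w1 \<Rightarrow> 'k) set" where
  "tmap K V' W' f g = tensor_lift K (V' \<Otimes>\<^bsub>K\<^esub> W') (\<lambda>v w. ptensor K V' W' (f v) (g w))"

definition assoc ::
  "('k, 'm) ring_scheme \<Rightarrow> ('k, 'u, 'm1) module_scheme \<Rightarrow> ('k, 'v, 'm2) module_scheme \<Rightarrow>
    ('k, 'w, 'm3) module_scheme \<Rightarrow>
    (('u \<times> 'v \<Rightarrow> 'k) set \<times> 'w \<Rightarrow> 'k) set \<Rightarrow> ('u \<times> ('v \<times> 'w \<Rightarrow> 'k) set \<Rightarrow> 'k) set" where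
  "assoc K U V W =
    tensor_lift K (U \<Otimes>\<^bsub>K\<^esub> (V \<Otimes>\<^bsub>K\<^esub> W)) (\<lambda>x w.
      tensor_lift K (U \<Otimes>\<^bsub>K\<^esub> (V \<Otimes>\<^bsub>K\<^esub> W)) (\<lambda>u v.
        ptensor K U (V \<Otimes>\<^bsub>K\<^esub> W) u (ptensor K V W v w)) x)"

definition assoc_inv ::
  "('k, 'm) ring_scheme \<Rightarrow> ('k, 'u, 'm1) module_scheme \<Rightarrow> ('k, 'v, 'm2) module_scheme \<Rightarrow>
    ('k, 'w, 'm3) module_scheme \<Rightarrow>
    ('u \<times> ('v \<times> 'w \<Rightarrow> 'k) set \<Rightarrow> 'k) set \<Rightarrow> (('u \<times> 'v \<Rightarrow> 'k) set \<times> 'w \<Rightarrow> 'k) set" where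
  "assoc_inv K U V W =
    tensor_lift K ((U \<Otimes>\<^bsub>K\<^esub> V) \<Otimes>\<^bsub>K\<^esub> W) (\<lambda>u y.
      tensor_lift K ((U \<Otimes>\<^bsub>K\<^esub> V) \<Otimes>\<^bsub>K\<^esub> W) (\<lambda>v w.
        ptensor K (U \<Otimes>\<^bsub>K\<^esub> V) W (ptensor K U V u v) w) y)"

definition mult_map ::
  "('k, 'm) ring_scheme \<Rightarrow> ('k, 'a, 'm1) module_scheme \<Rightarrow> ('a \<times> 'a \<Rightarrow> 'k) set \<Rightarrow> 'a" where
  "mult_map K A = tensor_lift K A (\<lambda>a b. a \<otimes>\<^bsub>A\<^esub> b)"


section \<open>Algebras\<close>

text \<open>The locale \<^locale>\<open>algebra\<close> of the library is confined to commutative algebras.\<close>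

locale unital_algebra = vectorspace K A + A: ring A
  for K :: "('k, 'm) ring_scheme" and A :: "('k, 'a, 'm1) module_scheme" (structure) +
  assumes smult_mult_left:
      "\<lbrakk>c \<in> carrier K; x \<in> carrier A; y \<in> carrier A\<rbrakk> \<Longrightarrow>
        (c \<odot>\<^bsub>A\<^esub> x) \<otimes>\<^bsub>A\<^esub> y = c \<odot>\<^bsub>A\<^esub> (x \<otimes>\<^bsub>A\<^esub> y)"
    and smult_mult_right:
      "\<lbrakk>c \<in> carrier K; x \<in> carrier A; y \<in> carrier A\<rbrakk> \<Longrightarrow>
        x \<otimes>\<^bsub>A\<^esub> (c \<odot>\<^bsub>A\<^esub> y) = c \<odot>\<^bsub>A\<^esub> (x \<otimes>\<^bsub>A\<^esub> y)"

definition algebra_iso ::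
  "('k, 'm) ring_scheme \<Rightarrow> ('k, 'a, 'm1) module_scheme \<Rightarrow> ('k, 'b, 'm2) module_scheme \<Rightarrow>
    ('a \<Rightarrow> 'b) \<Rightarrow> bool" where
  "algebra_iso K A B h \<longleftrightarrow>
    unital_algebra K A \<and> unital_algebra K B \<and> linear_map K A B h \<and> h \<in> ring_iso A B"


section \<open>Crossed products\<close>

text \<open>
  Associativity of the tensor product is made explicit by \<^const>\<open>assoc\<close> and \<^const>\<open>assoc_inv\<close>;
  these factors apart, the composites are those of the usual identities. The elements \<open>e\<close> are
  the distinguished ones. Linear maps are only determined on carriers, so identities
  between them are stated there.
\<close>

locale crossed_product = A: unital_algebra K A + V: vectorspace K V
  for K :: "('k, 'm) ring_scheme" (structure)
    and A :: "('k, 'a, 'm1) module_scheme"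
    and V :: "('k, 'v, 'm2) module_scheme" +
  fixes e :: 'v
    and R :: "('v \<times> 'a \<Rightarrow> 'k) set \<Rightarrow> ('a \<times> 'v \<Rightarrow> 'k) set"
    and \<sigma> :: "('v \<times> 'v \<Rightarrow> 'k) set \<Rightarrow> ('a \<times> 'v \<Rightarrow> 'k) set"
  assumes e_closed: "e \<in> carrier V"
    and R_linear: "linear_map K (V \<Otimes> A) (A \<Otimes> V) R"
    and \<sigma>_linear: "linear_map K (V \<Otimes> V) (A \<Otimes> V) \<sigma>"
    and R_e: "\<And>a. a \<in> carrier A \<Longrightarrow> R (ptensor K V A e a) = ptensor K A V a e"
    and R_one: "\<And>v. v \<in> carrier V \<Longrightarrow> R (ptensor K V A v \<one>\<^bsub>A\<^esub>) = ptensor K A V \<one>\<^bsub>A\<^esub> v"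
    and \<sigma>_e_left: "\<And>v. v \<in> carrier V \<Longrightarrow> \<sigma> (ptensor K V V e v) = ptensor K A V \<one>\<^bsub>A\<^esub> v"
    and \<sigma>_e_right: "\<And>v. v \<in> carrier V \<Longrightarrow> \<sigma> (ptensor K V V v e) = ptensor K A V \<one>\<^bsub>A\<^esub> v"
    and R_mult: "\<And>x. x \<in> carrier (V \<Otimes> (A \<Otimes> A)) \<Longrightarrow>
      (R \<circ> tmap K V A id (mult_map K A)) x =
      (tmap K A V (mult_map K A) id \<circ> assoc_inv K A A V
        \<circ> tmap K A (A \<Otimes> V) id R \<circ> assoc K A V A
        \<circ> tmap K (A \<Otimes> V) A R id \<circ> assoc_inv K V A A) x"
    and cocycle: "\<And>x. x \<in> carrier (V \<Otimes> (V \<Otimes> V)) \<Longrightarrow>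
      (tmap K A V (mult_map K A) id \<circ> assoc_inv K A A V
        \<circ> tmap K A (A \<Otimes> V) id \<sigma> \<circ> assoc K A V V
        \<circ> tmap K (A \<Otimes> V) V R id \<circ> assoc_inv K V A V
        \<circ> tmap K V (A \<Otimes> V) id \<sigma>) x =
      (tmap K A V (mult_map K A) id \<circ> assoc_inv K A A V
        \<circ> tmap K A (A \<Otimes> V) id \<sigma> \<circ> assoc K A V V
        \<circ> tmap K (A \<Otimes> V) V \<sigma> id \<circ> assoc_inv K V V V) x"
    and twisted_module: "\<And>x. x \<in> carrier (V \<Otimes> (V \<Otimes> A)) \<Longrightarrow>
      (tmap K A V (mult_map K A) id \<circ> assoc_inv K A A V
        \<circ> tmap K A (A \<Otimes> V) id \<sigma> \<circ> assoc K A V V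
        \<circ> tmap K (A \<Otimes> V) V R id \<circ> assoc_inv K V A V
        \<circ> tmap K V (A \<Otimes> V) id R) x =
      (tmap K A V (mult_map K A) id \<circ> assoc_inv K A A V
        \<circ> tmap K A (A \<Otimes> V) id R \<circ> assoc K A V A
        \<circ> tmap K (A \<Otimes> V) A \<sigma> id \<circ> assoc_inv K V V A) x"

definition crossed_mult_map ::
  "('k, 'm) ring_scheme \<Rightarrow> ('k, 'a, 'm1) module_scheme \<Rightarrow> ('k, 'v, 'm2) module_scheme \<Rightarrow>
    (('v \<times> 'a \<Rightarrow> 'k) set \<Rightarrow> ('a \<times> 'v \<Rightarrow> 'k) set) \<Rightarrow>
    (('v \<times> 'v \<Rightarrow> 'k) set \<Rightarrow> ('a \<times> 'v \<Rightarrow> 'k) set) \<Rightarrow>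
    (('a \<times> 'v \<Rightarrow> 'k) set \<times> ('a \<times> 'v \<Rightarrow> 'k) set \<Rightarrow> 'k) set \<Rightarrow> ('a \<times> 'v \<Rightarrow> 'k) set" where
  "crossed_mult_map K A V R \<sigma> =
    (let \<mu> = mult_map K A; \<mu>\<^sub>2 = \<mu> \<circ> tmap K A A id \<mu> in
      tmap K A V \<mu>\<^sub>2 id
      \<circ> assoc_inv K A (A \<Otimes>\<^bsub>K\<^esub> A) V
      \<circ> tmap K A ((A \<Otimes>\<^bsub>K\<^esub> A) \<Otimes>\<^bsub>K\<^esub> V) id (assoc_inv K A A V)
      \<circ> tmap K A (A \<Otimes>\<^bsub>K\<^esub> (A \<Otimes>\<^bsub>K\<^esub> V)) id (tmap K A (A \<Otimes>\<^bsub>K\<^esub> V) id \<sigma>)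
      \<circ> tmap K A (A \<Otimes>\<^bsub>K\<^esub> (V \<Otimes>\<^bsub>K\<^esub> V)) id (assoc K A V V)
      \<circ> tmap K A ((A \<Otimes>\<^bsub>K\<^esub> V) \<Otimes>\<^bsub>K\<^esub> V) id (tmap K (A \<Otimes>\<^bsub>K\<^esub> V) V R id)
      \<circ> tmap K A ((V \<Otimes>\<^bsub>K\<^esub> A) \<Otimes>\<^bsub>K\<^esub> V) id (assoc_inv K V A V)
      \<circ> assoc K A V (A \<Otimes>\<^bsub>K\<^esub> V))"

definition crossed_alg ::
  "('k, 'm) ring_scheme \<Rightarrow> ('k, 'a, 'm1) module_scheme \<Rightarrow> ('k, 'v, 'm2) module_scheme \<Rightarrow> 'v \<Rightarrow>
    (('v \<times> 'a \<Rightarrow> 'k) set \<Rightarrow> ('a \<times> 'v \<Rightarrow> 'k) set) \<Rightarrow>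
    (('v \<times> 'v \<Rightarrow> 'k) set \<Rightarrow> ('a \<times> 'v \<Rightarrow> 'k) set) \<Rightarrow> ('k, ('a \<times> 'v \<Rightarrow> 'k) set) module" where
  "crossed_alg K A V e R \<sigma> = (A \<Otimes>\<^bsub>K\<^esub> V)
    \<lparr>mult := \<lambda>x y. crossed_mult_map K A V R \<sigma> (ptensor K (A \<Otimes>\<^bsub>K\<^esub> V) (A \<Otimes>\<^bsub>K\<^esub> V) x y),
     one := ptensor K A V \<one>\<^bsub>A\<^esub> e\<rparr>"

locale mirror_crossed_product = W: vectorspace K W + B: unital_algebra K B
  for K :: "('k, 'm) ring_scheme" (structure)
    and W :: "('k, 'w, 'm1) module_scheme"
    and B :: "('k, 'b, 'm2) module_scheme" +
  fixes e :: 'w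
    and P :: "('b \<times> 'w \<Rightarrow> 'k) set \<Rightarrow> ('w \<times> 'b \<Rightarrow> 'k) set"
    and \<nu> :: "('w \<times> 'w \<Rightarrow> 'k) set \<Rightarrow> ('w \<times> 'b \<Rightarrow> 'k) set"
  assumes e_closed: "e \<in> carrier W"
    and P_linear: "linear_map K (B \<Otimes> W) (W \<Otimes> B) P"
    and \<nu>_linear: "linear_map K (W \<Otimes> W) (W \<Otimes> B) \<nu>"
    and P_e: "\<And>b. b \<in> carrier B \<Longrightarrow> P (ptensor K B W b e) = ptensor K W B e b"
    and P_one: "\<And>w. w \<in> carrier W \<Longrightarrow> P (ptensor K B W \<one>\<^bsub>B\<^esub> w) = ptensor K W B w \<one>\<^bsub>B\<^esub>"
    and \<nu>_e_right: "\<And>w. w \<in> carrier W \<Longrightarrow> \<nu> (ptensor K W W w e) = ptensor K W B w \<one>\<^bsub>B\<^esub>"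
    and \<nu>_e_left: "\<And>w. w \<in> carrier W \<Longrightarrow> \<nu> (ptensor K W W e w) = ptensor K W B w \<one>\<^bsub>B\<^esub>"
    and P_mult: "\<And>x. x \<in> carrier ((B \<Otimes> B) \<Otimes> W) \<Longrightarrow>
      (P \<circ> tmap K B W (mult_map K B) id) x =
      (tmap K W B id (mult_map K B) \<circ> assoc K W B B
        \<circ> tmap K (W \<Otimes> B) B P id \<circ> assoc_inv K B W B
        \<circ> tmap K B (W \<Otimes> B) id P \<circ> assoc K B B W) x"
    and cocycle: "\<And>x. x \<in> carrier ((W \<Otimes> W) \<Otimes> W) \<Longrightarrow>
      (tmap K W B id (mult_map K B) \<circ> assoc K W B B
        \<circ> tmap K (W \<Otimes> B) B \<nu> id \<circ> assoc_inv K W W B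
        \<circ> tmap K W (W \<Otimes> B) id P \<circ> assoc K W B W
        \<circ> tmap K (W \<Otimes> B) W \<nu> id) x =
      (tmap K W B id (mult_map K B) \<circ> assoc K W B B
        \<circ> tmap K (W \<Otimes> B) B \<nu> id \<circ> assoc_inv K W W B
        \<circ> tmap K W (W \<Otimes> B) id \<nu> \<circ> assoc K W W W) x"
    and twisted_module: "\<And>x. x \<in> carrier ((B \<Otimes> W) \<Otimes> W) \<Longrightarrow>
      (tmap K W B id (mult_map K B) \<circ> assoc K W B B
        \<circ> tmap K (W \<Otimes> B) B \<nu> id \<circ> assoc_inv K W W B
        \<circ> tmap K W (W \<Otimes> B) id P \<circ> assoc K W B W
        \<circ> tmap K (W \<Otimes> B) W P id) x =
      (tmap K W B id (mult_map K B) \<circ> assoc K W B B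
        \<circ> tmap K (W \<Otimes> B) B P id \<circ> assoc_inv K B W B
        \<circ> tmap K B (W \<Otimes> B) id \<nu> \<circ> assoc K B W W) x"

definition mirror_crossed_mult_map ::
  "('k, 'm) ring_scheme \<Rightarrow> ('k, 'w, 'm1) module_scheme \<Rightarrow> ('k, 'b, 'm2) module_scheme \<Rightarrow>
    (('b \<times> 'w \<Rightarrow> 'k) set \<Rightarrow> ('w \<times> 'b \<Rightarrow> 'k) set) \<Rightarrow>
    (('w \<times> 'w \<Rightarrow> 'k) set \<Rightarrow> ('w \<times> 'b \<Rightarrow> 'k) set) \<Rightarrow>
    (('w \<times> 'b \<Rightarrow> 'k) set \<times> ('w \<times> 'b \<Rightarrow> 'k) set \<Rightarrow> 'k) set \<Rightarrow> ('w \<times> 'b \<Rightarrow> 'k) set" where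
  "mirror_crossed_mult_map K W B P \<nu> =
    (let \<mu> = mult_map K B; \<mu>\<^sub>2 = \<mu> \<circ> tmap K B B id \<mu> in
      tmap K W B id \<mu>\<^sub>2
      \<circ> assoc K W B (B \<Otimes>\<^bsub>K\<^esub> B)
      \<circ> tmap K (W \<Otimes>\<^bsub>K\<^esub> B) (B \<Otimes>\<^bsub>K\<^esub> B) \<nu> id
      \<circ> assoc_inv K W W (B \<Otimes>\<^bsub>K\<^esub> B)
      \<circ> tmap K W (W \<Otimes>\<^bsub>K\<^esub> (B \<Otimes>\<^bsub>K\<^esub> B)) id (assoc K W B B)
      \<circ> tmap K W ((W \<Otimes>\<^bsub>K\<^esub> B) \<Otimes>\<^bsub>K\<^esub> B) id (tmap K (W \<Otimes>\<^bsub>K\<^esub> B) B P id)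
      \<circ> tmap K W ((B \<Otimes>\<^bsub>K\<^esub> W) \<Otimes>\<^bsub>K\<^esub> B) id (assoc_inv K B W B)
      \<circ> assoc K W B (W \<Otimes>\<^bsub>K\<^esub> B))"

definition mirror_crossed_alg ::
  "('k, 'm) ring_scheme \<Rightarrow> ('k, 'w, 'm1) module_scheme \<Rightarrow> ('k, 'b, 'm2) module_scheme \<Rightarrow> 'w \<Rightarrow>
    (('b \<times> 'w \<Rightarrow> 'k) set \<Rightarrow> ('w \<times> 'b \<Rightarrow> 'k) set) \<Rightarrow>
    (('w \<times> 'w \<Rightarrow> 'k) set \<Rightarrow> ('w \<times> 'b \<Rightarrow> 'k) set) \<Rightarrow> ('k, ('w \<times> 'b \<Rightarrow> 'k) set) module" where
  "mirror_crossed_alg K W B e P \<nu> = (W \<Otimes>\<^bsub>K\<^esub> B)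
    \<lparr>mult := \<lambda>x y. mirror_crossed_mult_map K W B P \<nu> (ptensor K (W \<Otimes>\<^bsub>K\<^esub> B) (W \<Otimes>\<^bsub>K\<^esub> B) x y),
     one := ptensor K W B e \<one>\<^bsub>B\<^esub>\<rparr>"


section \<open>The structure maps of the iterated products\<close>

text \<open>
  With \<open>Q : V \<Otimes> W \<rightarrow> W \<Otimes> (D \<Otimes> V)\<close>, these are
  \<open>\<sigma>_bar : V \<Otimes> V \<rightarrow> (W \<Otimes> D) \<Otimes> V\<close>, \<open>R_bar : V \<Otimes> (W \<Otimes> D) \<rightarrow> (W \<Otimes> D) \<Otimes> V\<close>,
  \<open>\<nu>_bar : W \<Otimes> W \<rightarrow> W \<Otimes> (D \<Otimes> V)\<close> and \<open>P_bar : (D \<Otimes> V) \<Otimes> W \<rightarrow> W \<Otimes> (D \<Otimes> V)\<close>.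
\<close>

definition \<sigma>_bar ::
  "('k, 'm) ring_scheme \<Rightarrow> ('k, 'w, 'm1) module_scheme \<Rightarrow> ('k, 'd, 'm2) module_scheme \<Rightarrow>
    ('k, 'v, 'm3) module_scheme \<Rightarrow> 'w \<Rightarrow>
    (('v \<times> 'v \<Rightarrow> 'k) set \<Rightarrow> ('d \<times> 'v \<Rightarrow> 'k) set) \<Rightarrow>
    ('v \<times> 'v \<Rightarrow> 'k) set \<Rightarrow> (('w \<times> 'd \<Rightarrow> 'k) set \<times> 'v \<Rightarrow> 'k) set" where
  "\<sigma>_bar K W D V e \<sigma> = (\<lambda>x. assoc_inv K W D V (ptensor K W (D \<Otimes>\<^bsub>K\<^esub> V) e (\<sigma> x)))"

definition R_bar ::
  "('k, 'm) ring_scheme \<Rightarrow> ('k, 'w, 'm1) module_scheme \<Rightarrow> ('k, 'd, 'm2) module_scheme \<Rightarrow>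
    ('k, 'v, 'm3) module_scheme \<Rightarrow>
    (('v \<times> 'd \<Rightarrow> 'k) set \<Rightarrow> ('d \<times> 'v \<Rightarrow> 'k) set) \<Rightarrow>
    (('v \<times> 'w \<Rightarrow> 'k) set \<Rightarrow> ('w \<times> ('d \<times> 'v \<Rightarrow> 'k) set \<Rightarrow> 'k) set) \<Rightarrow>
    ('v \<times> ('w \<times> 'd \<Rightarrow> 'k) set \<Rightarrow> 'k) set \<Rightarrow> (('w \<times> 'd \<Rightarrow> 'k) set \<times> 'v \<Rightarrow> 'k) set" where
  "R_bar K W D V R Q =
    assoc_inv K W D V
    \<circ> tmap K W (D \<Otimes>\<^bsub>K\<^esub> V) id (tmap K D V (mult_map K D) id)
    \<circ> tmap K W ((D \<Otimes>\<^bsub>K\<^esub> D) \<Otimes>\<^bsub>K\<^esub> V) id (assoc_inv K D D V)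
    \<circ> tmap K W (D \<Otimes>\<^bsub>K\<^esub> (D \<Otimes>\<^bsub>K\<^esub> V)) id (tmap K D (D \<Otimes>\<^bsub>K\<^esub> V) id R)
    \<circ> tmap K W (D \<Otimes>\<^bsub>K\<^esub> (V \<Otimes>\<^bsub>K\<^esub> D)) id (assoc K D V D)
    \<circ> assoc K W (D \<Otimes>\<^bsub>K\<^esub> V) D
    \<circ> tmap K (W \<Otimes>\<^bsub>K\<^esub> (D \<Otimes>\<^bsub>K\<^esub> V)) D Q id
    \<circ> assoc_inv K V W D"

definition \<nu>_bar ::
  "('k, 'm) ring_scheme \<Rightarrow> ('k, 'w, 'm1) module_scheme \<Rightarrow> ('k, 'd, 'm2) module_scheme \<Rightarrow>
    ('k, 'v, 'm3) module_scheme \<Rightarrow> 'v \<Rightarrow>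
    (('w \<times> 'w \<Rightarrow> 'k) set \<Rightarrow> ('w \<times> 'd \<Rightarrow> 'k) set) \<Rightarrow>
    ('w \<times> 'w \<Rightarrow> 'k) set \<Rightarrow> ('w \<times> ('d \<times> 'v \<Rightarrow> 'k) set \<Rightarrow> 'k) set" where
  "\<nu>_bar K W D V e \<nu> = (\<lambda>x. assoc K W D V (ptensor K (W \<Otimes>\<^bsub>K\<^esub> D) V (\<nu> x) e))"

definition P_bar ::
  "('k, 'm) ring_scheme \<Rightarrow> ('k, 'w, 'm1) module_scheme \<Rightarrow> ('k, 'd, 'm2) module_scheme \<Rightarrow>
    ('k, 'v, 'm3) module_scheme \<Rightarrow>
    (('d \<times> 'w \<Rightarrow> 'k) set \<Rightarrow> ('w \<times> 'd \<Rightarrow> 'k) set) \<Rightarrow>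
    (('v \<times> 'w \<Rightarrow> 'k) set \<Rightarrow> ('w \<times> ('d \<times> 'v \<Rightarrow> 'k) set \<Rightarrow> 'k) set) \<Rightarrow>
    (('d \<times> 'v \<Rightarrow> 'k) set \<times> 'w \<Rightarrow> 'k) set \<Rightarrow> ('w \<times> ('d \<times> 'v \<Rightarrow> 'k) set \<Rightarrow> 'k) set" where
  "P_bar K W D V P Q =
    tmap K W (D \<Otimes>\<^bsub>K\<^esub> V) id (tmap K D V (mult_map K D) id)
    \<circ> tmap K W ((D \<Otimes>\<^bsub>K\<^esub> D) \<Otimes>\<^bsub>K\<^esub> V) id (assoc_inv K D D V)
    \<circ> assoc K W D (D \<Otimes>\<^bsub>K\<^esub> V)
    \<circ> tmap K (W \<Otimes>\<^bsub>K\<^esub> D) (D \<Otimes>\<^bsub>K\<^esub> V) P id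
    \<circ> assoc_inv K D W (D \<Otimes>\<^bsub>K\<^esub> V)
    \<circ> tmap K D (W \<Otimes>\<^bsub>K\<^esub> (D \<Otimes>\<^bsub>K\<^esub> V)) id Q
    \<circ> assoc K D V W"

end

theory Submission
  imports Defs
begin

text \<open>
  Associativity of a crossed product \<open>A \<otimes> V\<close> need only be checked on the generators \<open>a \<otimes> e\<close> and
  \<open>1 \<otimes> v\<close>, where it amounts to the three axioms on \<open>R\<close> and \<open>\<sigma>\<close>; conversely these axioms can be read
  off any associative multiplication of this shape. Everything therefore takes place inside one
  algebra \<open>X = W \<otimes> (D \<otimes> V)\<close>. With the mirror multiplication given by \<open>P_bar\<close> and \<open>\<nu>_bar\<close>, the left
  multiplications \<open>\<rho> b\<close> by the elements \<open>1 \<otimes> b\<close>, \<open>b \<in> D \<otimes> V\<close>, commute with the right action of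
  \<open>D \<otimes> V\<close>, so relations between them may be tested on \<open>W\<close>. There (a) and (c) say that \<open>\<rho>\<close> is
  multiplicative on the products \<open>v d\<close> and \<open>v v'\<close>, and (b) that \<open>v (w w') = (v w) w'\<close>. Hence (ii), and
  \<open>X\<close> is associative. The rebracketing \<open>(W \<otimes> D) \<otimes> V \<rightarrow> X\<close> carries the multiplication given by \<open>R_bar\<close>
  and \<open>\<sigma>_bar\<close> to that of \<open>X\<close>, which yields (i) and (iii).
\<close>

section \<open>The universal property of the tensor product\<close>

text \<open>Tensors are cosets of formal sums, so an identity cannot be computed on a general
  element. Equations are therefore put between maps that are linear in one variable at a time,
  reduced to pure tensors and evaluated there by rewriting; linearity of the composites involved is
  the recurring side condition. The multiplication of \<open>X\<close> exists before it is known to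
  be associative: a \<open>mirror_data\<close> asks only for linear maps with the right values at
  the units, and its product is right \<open>B\<close>-linear by the shape of the formula. This
  one-sided linearity settles products \<open>x (y c)\<close>, but not
  \<open>(x c) w = x (c w)\<close>, where \<open>c\<close> stands in the middle. The latter is
  available only once \<open>\<rho>\<close> is known to be multiplicative. Hence (a) and (c) are
  exploited before (b), and (b), a statement about \<open>v\<close> alone, is extended to all of
  \<open>D \<otimes> V\<close> last. On the crossed side no axiom is computed: each structure map
  becomes a product in the associative algebra \<open>X\<close>, and associativity is pulled
  back.\<close>

lemma vectorspaceI:
  assumes "field K" "abelian_group V"
    and "\<And>a x. \<lbrakk>a \<in> carrier K; x \<in> carrier V\<rbrakk> \<Longrightarrow> a \<odot>\<^bsub>V\<^esub> x \<in> carrier V"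
    and "\<And>a b x. \<lbrakk>a \<in> carrier K; b \<in> carrier K; x \<in> carrier V\<rbrakk> \<Longrightarrow>
      (a \<oplus>\<^bsub>K\<^esub> b) \<odot>\<^bsub>V\<^esub> x = a \<odot>\<^bsub>V\<^esub> x \<oplus>\<^bsub>V\<^esub> b \<odot>\<^bsub>V\<^esub> x"
    and "\<And>a x y. \<lbrakk>a \<in> carrier K; x \<in> carrier V; y \<in> carrier V\<rbrakk> \<Longrightarrow>
      a \<odot>\<^bsub>V\<^esub> (x \<oplus>\<^bsub>V\<^esub> y) = a \<odot>\<^bsub>V\<^esub> x \<oplus>\<^bsub>V\<^esub> a \<odot>\<^bsub>V\<^esub> y"
    and "\<And>a b x. \<lbrakk>a \<in> carrier K; b \<in> carrier K; x \<in> carrier V\<rbrakk> \<Longrightarrow>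
      (a \<otimes>\<^bsub>K\<^esub> b) \<odot>\<^bsub>V\<^esub> x = a \<odot>\<^bsub>V\<^esub> (b \<odot>\<^bsub>V\<^esub> x)"
    and "\<And>x. x \<in> carrier V \<Longrightarrow> \<one>\<^bsub>K\<^esub> \<odot>\<^bsub>V\<^esub> x = x"
  shows "vectorspace K V"
  unfolding vectorspace_def using assms
  by (intro conjI module.intro module_axioms.intro) (auto intro: field.axioms domain.axioms)

lemma linear_mapI:
  assumes "vectorspace K V" "vectorspace K W"
    and "\<And>x. x \<in> carrier V \<Longrightarrow> f x \<in> carrier W"
    and "\<And>x y. \<lbrakk>x \<in> carrier V; y \<in> carrier V\<rbrakk> \<Longrightarrow> f (x \<oplus>\<^bsub>V\<^esub> y) = f x \<oplus>\<^bsub>W\<^esub> f y"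
    and "\<And>a x. \<lbrakk>a \<in> carrier K; x \<in> carrier V\<rbrakk> \<Longrightarrow> f (a \<odot>\<^bsub>V\<^esub> x) = a \<odot>\<^bsub>W\<^esub> f x"
  shows "linear_map K V W f"
  using assms
  by (simp add: linear_map_def mod_hom_def mod_hom_axioms_def module_hom_def vectorspace_def)

lemma linear_map_source: "linear_map K V W f \<Longrightarrow> vectorspace K V"
  and linear_map_target: "linear_map K V W f \<Longrightarrow> vectorspace K W"
  and linear_map_closed: "linear_map K V W f \<Longrightarrow> x \<in> carrier V \<Longrightarrow> f x \<in> carrier W"
  and linear_map_add: "linear_map K V W f \<Longrightarrow> x \<in> carrier V \<Longrightarrow> y \<in> carrier V \<Longrightarrow>
    f (x \<oplus>\<^bsub>V\<^esub> y) = f x \<oplus>\<^bsub>W\<^esub> f y"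
  and linear_map_smult: "linear_map K V W f \<Longrightarrow> a \<in> carrier K \<Longrightarrow> x \<in> carrier V \<Longrightarrow>
    f (a \<odot>\<^bsub>V\<^esub> x) = a \<odot>\<^bsub>W\<^esub> f x"
  by (auto simp: linear_map_def mod_hom_def mod_hom_axioms_def module_hom_def)

lemma linear_map_comp:
  "linear_map K U V f \<Longrightarrow> linear_map K V W g \<Longrightarrow> linear_map K U W (\<lambda>x. g (f x))"
  by (rule linear_mapI)
     (auto simp: linear_map_closed linear_map_add linear_map_smult
       intro: linear_map_source linear_map_target)

lemma linear_map_cong:
  assumes "linear_map K V W f" "\<And>x. x \<in> carrier V \<Longrightarrow> f x = g x"
  shows "linear_map K V W g"
proof -
  interpret linear_map K V W f by fact
  show ?thesis
    by (rule linear_mapI)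
       (auto simp: V.vectorspace_axioms W.vectorspace_axioms T_im simp flip: assms(2))
qed

section \<open>Free vector spaces: finitely supported coefficient functions\<close>

lemma free_space_simps [simp]:
  "\<zero>\<^bsub>free_space K S\<^esub> = (\<lambda>s. \<zero>\<^bsub>K\<^esub>)"
  "f \<oplus>\<^bsub>free_space K S\<^esub> g = (\<lambda>s. f s \<oplus>\<^bsub>K\<^esub> g s)"
  "a \<odot>\<^bsub>free_space K S\<^esub> f = (\<lambda>s. a \<otimes>\<^bsub>K\<^esub> f s)"
  by (simp_all add: free_space_def)

lemma free_space_carrier_iff:
  "f \<in> carrier (free_space K S) \<longleftrightarrow>
    (\<forall>s. f s \<in> carrier K) \<and> finite {s. f s \<noteq> \<zero>\<^bsub>K\<^esub>} \<and> (\<forall>s. f s \<noteq> \<zero>\<^bsub>K\<^esub> \<longrightarrow> s \<in> S)"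
  by (auto simp: free_space_def)

lemma free_space_coeff: "f \<in> carrier (free_space K S) \<Longrightarrow> f s \<in> carrier K"
  and free_space_support: "f \<in> carrier (free_space K S) \<Longrightarrow> f s \<noteq> \<zero>\<^bsub>K\<^esub> \<Longrightarrow> s \<in> S"
  by (simp_all add: free_space_carrier_iff)

lemma free_space_vectorspace:
  assumes "field K"
  shows "vectorspace K (free_space K S)"
proof -
  interpret K: field K by fact
  let ?F = "free_space K S"
  have add_closed: "(\<lambda>s. f s \<oplus>\<^bsub>K\<^esub> g s) \<in> carrier ?F" if "f \<in> carrier ?F" "g \<in> carrier ?F" for f g
  proof -
    have "{s. f s \<oplus>\<^bsub>K\<^esub> g s \<noteq> \<zero>\<^bsub>K\<^esub>} \<subseteq> {s. f s \<noteq> \<zero>\<^bsub>K\<^esub>} \<union> {s. g s \<noteq> \<zero>\<^bsub>K\<^esub>}"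
      by auto
    then show ?thesis
      using that by (auto simp: free_space_carrier_iff intro: finite_subset)
  qed
  have smult_closed: "(\<lambda>s. a \<otimes>\<^bsub>K\<^esub> f s) \<in> carrier ?F" if "a \<in> carrier K" "f \<in> carrier ?F" for a f
  proof -
    have "{s. a \<otimes>\<^bsub>K\<^esub> f s \<noteq> \<zero>\<^bsub>K\<^esub>} \<subseteq> {s. f s \<noteq> \<zero>\<^bsub>K\<^esub>}"
      using that by auto
    then show ?thesis
      using that by (auto simp: free_space_carrier_iff intro: finite_subset)
  qed
  have "abelian_group ?F"
  proof (rule abelian_groupI)
    fix f assume f: "f \<in> carrier ?F"
    show "\<exists>g\<in>carrier ?F. g \<oplus>\<^bsub>?F\<^esub> f = \<zero>\<^bsub>?F\<^esub>"
      using f smult_closed[of "\<ominus>\<^bsub>K\<^esub> \<one>\<^bsub>K\<^esub>" f]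
      by (intro bexI[of _ "\<lambda>s. (\<ominus>\<^bsub>K\<^esub> \<one>\<^bsub>K\<^esub>) \<otimes>\<^bsub>K\<^esub> f s"])
         (auto simp: free_space_carrier_iff K.l_minus K.l_neg)
  qed (auto simp: add_closed, auto simp: free_space_carrier_iff K.a_ac)
  then show ?thesis
    by (rule vectorspaceI[OF assms])
       (auto simp: smult_closed, auto simp: free_space_carrier_iff K.l_distr K.r_distr K.m_assoc)
qed

lemma free_gen_closed:
  assumes "field K" "s \<in> S"
  shows "free_gen K s \<in> carrier (free_space K S)"
proof -
  interpret field K by fact
  have "{t. (if t = s then \<one>\<^bsub>K\<^esub> else \<zero>\<^bsub>K\<^esub>) \<noteq> \<zero>\<^bsub>K\<^esub>} = {s}" by auto
  then show ?thesis
    using assms(2) by (auto simp: free_gen_def free_space_carrier_iff split: if_splits)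
qed

section \<open>Quotients of a vector space by a submodule\<close>

lemma submodule_abelian_subgroup:
  assumes "vectorspace K F" "submodule K N F"
  shows "abelian_subgroup N F"
proof -
  interpret vectorspace K F by fact
  interpret N: LinearCombinations.submodule K N F by fact
  have "\<ominus>\<^bsub>F\<^esub> x \<in> N" if "x \<in> N" for x
    using that N.smult_closed[of "\<ominus>\<^bsub>K\<^esub> \<one>\<^bsub>K\<^esub>" x] N.subset by (auto simp: smult_minus_1 subsetD)
  then have "subgroup N (add_monoid F)"
    using N.subset by unfold_locales (auto simp: a_inv_def)
  then show ?thesis
    by (intro abelian_subgroupI3 additive_subgroup.intro M.abelian_group_axioms)
qed

text \<open>The scalar multiple of a class is defined as a union over all its representatives. Since
  \<open>N\<close> is closed under scalars, the cosets united all coincide, and the union collapses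
  to one of them.\<close>

lemma quotient_smult:
  assumes "vectorspace K F" "submodule K N F" "a \<in> carrier K" "x \<in> carrier F"
  shows "a \<odot>\<^bsub>quotient_space F N\<^esub> (N +>\<^bsub>F\<^esub> x) = N +>\<^bsub>F\<^esub> (a \<odot>\<^bsub>F\<^esub> x)"
proof -
  interpret vectorspace K F by fact
  interpret N: LinearCombinations.submodule K N F by fact
  interpret S: abelian_subgroup N F using assms submodule_abelian_subgroup by blast
  have "N +>\<^bsub>F\<^esub> (a \<odot>\<^bsub>F\<^esub> y) = N +>\<^bsub>F\<^esub> (a \<odot>\<^bsub>F\<^esub> x)" if y: "y \<in> N +>\<^bsub>F\<^esub> x" for y
  proof -
    obtain n where n: "n \<in> N" "y = n \<oplus>\<^bsub>F\<^esub> x"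
      using y by (auto simp: a_r_coset_def')
    then have "a \<odot>\<^bsub>F\<^esub> y = a \<odot>\<^bsub>F\<^esub> n \<oplus>\<^bsub>F\<^esub> a \<odot>\<^bsub>F\<^esub> x"
      using assms N.subset by (auto simp: smult_r_distr)
    then have "a \<odot>\<^bsub>F\<^esub> y \<in> N +>\<^bsub>F\<^esub> (a \<odot>\<^bsub>F\<^esub> x)"
      using n assms by (auto simp: a_r_coset_def')
    then show ?thesis
      using assms by (metis S.a_repr_independence' smult_closed)
  qed
  then have "(\<Union>y\<in>N +>\<^bsub>F\<^esub> x. N +>\<^bsub>F\<^esub> (a \<odot>\<^bsub>F\<^esub> y)) = (\<Union>y\<in>N +>\<^bsub>F\<^esub> x. N +>\<^bsub>F\<^esub> (a \<odot>\<^bsub>F\<^esub> x))"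
    by (rule SUP_cong[OF refl])
  moreover have "N +>\<^bsub>F\<^esub> x \<noteq> {}" using assms S.a_rcos_self by blast
  ultimately show ?thesis
    by (simp add: quotient_space_def)
qed

lemma quotient_add:
  assumes "vectorspace K F" "submodule K N F" "x \<in> carrier F" "y \<in> carrier F"
  shows "(N +>\<^bsub>F\<^esub> x) \<oplus>\<^bsub>quotient_space F N\<^esub> (N +>\<^bsub>F\<^esub> y) = N +>\<^bsub>F\<^esub> (x \<oplus>\<^bsub>F\<^esub> y)"
proof -
  interpret S: abelian_subgroup N F using assms submodule_abelian_subgroup by blast
  show ?thesis using assms by (simp add: quotient_space_def S.a_rcos_sum)
qed

lemma quotient_carrier:
  "X \<in> carrier (quotient_space F N) \<longleftrightarrow> (\<exists>x\<in>carrier F. X = N +>\<^bsub>F\<^esub> x)"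
  by (auto simp: quotient_space_def A_RCOSETS_def')

lemma quotient_vectorspace:
  assumes "vectorspace K F" "submodule K N F"
  shows "vectorspace K (quotient_space F N)"
proof -
  interpret vectorspace K F by fact
  interpret N: LinearCombinations.submodule K N F by fact
  interpret S: abelian_subgroup N F using assms submodule_abelian_subgroup by blast
  let ?Q = "quotient_space F N"
  \<comment> \<open>\<open>F A_Mod N\<close> is a group record with the same carrier, operation and
    neutral element as the additive part of \<open>?Q\<close>, so being a commutative group means
    the same for both.\<close>
  have "comm_group (add_monoid ?Q) \<longleftrightarrow> comm_group (F A_Mod N)"
    unfolding A_FactGroup_def' comm_group_def comm_monoid_def comm_monoid_axioms_def
      group_def group_axioms_def monoid_def Units_def quotient_space_def
    by simp
  then have "comm_group (add_monoid ?Q)"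
    using S.a_factorgroup_is_comm_group by blast
  then have "abelian_group ?Q"
    by (simp add: abelian_group_def abelian_group_axioms_def abelian_monoid_def comm_group_def)
  then show ?thesis
    by (rule vectorspaceI[OF field_axioms])
       (auto simp: quotient_carrier quotient_add[OF assms] quotient_smult[OF assms]
         smult_l_distr smult_r_distr smult_assoc1)
qed

section \<open>Pure tensors, bilinearity and induction on tensors\<close>

definition bilinear where
  "bilinear K V W U b \<longleftrightarrow>
    (\<forall>v\<in>carrier V. linear_map K W U (b v)) \<and> (\<forall>w\<in>carrier W. linear_map K V U (\<lambda>v. b v w))"

text \<open>The function whose image over a class is formed in \<open>tensor_lift\<close>; isolating
  it lets well-definedness be stated as constancy on cosets.\<close>

definition formal_eval where
  "formal_eval K U b f = (\<Oplus>\<^bsub>U\<^esub>p\<in>{p. f p \<noteq> \<zero>\<^bsub>K\<^esub>}. f p \<odot>\<^bsub>U\<^esub> b (fst p) (snd p))"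

context
  fixes K :: "('k, 'm) ring_scheme"
    and V :: "('k, 'v, 'm1) module_scheme" and W :: "('k, 'w, 'm2) module_scheme"
  assumes V: "vectorspace K V" and W: "vectorspace K W"
begin

interpretation K: field K using V by (simp add: vectorspace_def)
interpretation V: vectorspace K V by fact
interpretation W: vectorspace K W by fact

abbreviation (input) "FF \<equiv> free_space K (carrier V \<times> carrier W)"
interpretation F: vectorspace K FF by (rule free_space_vectorspace) (rule K.field_axioms)

lemma gen_closed: "v \<in> carrier V \<Longrightarrow> w \<in> carrier W \<Longrightarrow> free_gen K (v, w) \<in> carrier FF"
  by (rule free_gen_closed) (auto simp: K.field_axioms)

lemma tensor_rels_subset: "tensor_rels K V W \<subseteq> carrier FF"
  unfolding tensor_rels_def Let_def
  by (intro Un_least subsetI; clarify)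
     (intro F.M.minus_closed F.M.add.m_closed F.smult_closed gen_closed; simp)+

lemma tensor_relsI:
  assumes "v \<in> carrier V" "w \<in> carrier W"
  shows "v' \<in> carrier V \<Longrightarrow>
      free_gen K (v \<oplus>\<^bsub>V\<^esub> v', w) \<ominus>\<^bsub>FF\<^esub> (free_gen K (v, w) \<oplus>\<^bsub>FF\<^esub> free_gen K (v', w)) \<in> tensor_rels K V W"
    and "w' \<in> carrier W \<Longrightarrow>
      free_gen K (v, w \<oplus>\<^bsub>W\<^esub> w') \<ominus>\<^bsub>FF\<^esub> (free_gen K (v, w) \<oplus>\<^bsub>FF\<^esub> free_gen K (v, w')) \<in> tensor_rels K V W"
    and "a \<in> carrier K \<Longrightarrow>
      free_gen K (a \<odot>\<^bsub>V\<^esub> v, w) \<ominus>\<^bsub>FF\<^esub> a \<odot>\<^bsub>FF\<^esub> free_gen K (v, w) \<in> tensor_rels K V W"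
    and "a \<in> carrier K \<Longrightarrow>
      free_gen K (v, a \<odot>\<^bsub>W\<^esub> w) \<ominus>\<^bsub>FF\<^esub> a \<odot>\<^bsub>FF\<^esub> free_gen K (v, w) \<in> tensor_rels K V W"
  unfolding tensor_rels_def Let_def using assms by blast+

lemma tensor_null_submodule: "submodule K (tensor_null K V W) FF"
  unfolding tensor_null_def by (rule F.span_is_submodule) (rule tensor_rels_subset)

lemma tensor_vectorspace: "vectorspace K (V \<Otimes>\<^bsub>K\<^esub> W)"
  unfolding tensor_def
  by (rule quotient_vectorspace) (rule F.vectorspace_axioms tensor_null_submodule)+

interpretation N: abelian_subgroup "tensor_null K V W" FF
  by (rule submodule_abelian_subgroup) (rule F.vectorspace_axioms tensor_null_submodule)+

lemma coset_eqI:
  assumes "f \<in> carrier FF" "g \<in> carrier FF" "f \<ominus>\<^bsub>FF\<^esub> g \<in> tensor_rels K V W"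
  shows "tensor_null K V W +>\<^bsub>FF\<^esub> f = tensor_null K V W +>\<^bsub>FF\<^esub> g"
proof -
  have "f \<ominus>\<^bsub>FF\<^esub> g \<in> tensor_null K V W"
    using assms(3) F.in_own_span[OF tensor_rels_subset] by (auto simp: tensor_null_def)
  then have "f \<in> tensor_null K V W +>\<^bsub>FF\<^esub> g"
    using assms N.a_rcos_module[of g f] by (simp add: a_minus_def)
  then show ?thesis using assms N.a_repr_independence' by blast
qed

lemma ptensor_closed: "v \<in> carrier V \<Longrightarrow> w \<in> carrier W \<Longrightarrow> ptensor K V W v w \<in> carrier (V \<Otimes>\<^bsub>K\<^esub> W)"
  by (auto simp: tensor_def ptensor_def quotient_carrier gen_closed)

lemmas quot_simps =
  quotient_add[OF F.vectorspace_axioms tensor_null_submodule]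
  quotient_smult[OF F.vectorspace_axioms tensor_null_submodule]

text \<open>Each of the four identities belongs to one family in \<open>tensor_rels\<close>: the
  difference of the two representatives is itself a relation, so their cosets agree.\<close>

lemma bilinear_ptensor: "bilinear K V W (V \<Otimes>\<^bsub>K\<^esub> W) (ptensor K V W)"
  unfolding bilinear_def
proof (intro conjI ballI linear_mapI V W tensor_vectorspace ptensor_closed; (assumption)?)
  fix v w w' assume *: "v \<in> carrier V" "w \<in> carrier W" "w' \<in> carrier W"
  show "ptensor K V W v (w \<oplus>\<^bsub>W\<^esub> w') = ptensor K V W v w \<oplus>\<^bsub>V \<Otimes>\<^bsub>K\<^esub> W\<^esub> ptensor K V W v w'"
    unfolding ptensor_def tensor_def
    by (subst quot_simps, (intro gen_closed *)+, rule coset_eqI)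
       (intro tensor_relsI gen_closed F.M.add.m_closed V.M.add.m_closed W.M.add.m_closed V.smult_closed W.smult_closed *)+
next
  fix v a w assume *: "v \<in> carrier V" "w \<in> carrier W" "a \<in> carrier K"
  show "ptensor K V W v (a \<odot>\<^bsub>W\<^esub> w) = a \<odot>\<^bsub>V \<Otimes>\<^bsub>K\<^esub> W\<^esub> ptensor K V W v w"
    unfolding ptensor_def tensor_def
    by (subst quot_simps, (intro gen_closed *)+, rule coset_eqI)
       (intro tensor_relsI gen_closed F.smult_closed V.M.add.m_closed W.M.add.m_closed V.smult_closed W.smult_closed *)+
next
  fix w v v' assume *: "w \<in> carrier W" "v \<in> carrier V" "v' \<in> carrier V"
  show "ptensor K V W (v \<oplus>\<^bsub>V\<^esub> v') w = ptensor K V W v w \<oplus>\<^bsub>V \<Otimes>\<^bsub>K\<^esub> W\<^esub> ptensor K V W v' w"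
    unfolding ptensor_def tensor_def
    by (subst quot_simps, (intro gen_closed *)+, rule coset_eqI)
       (intro tensor_relsI gen_closed F.M.add.m_closed V.M.add.m_closed W.M.add.m_closed V.smult_closed W.smult_closed *)+
next
  fix w a v assume *: "w \<in> carrier W" "a \<in> carrier K" "v \<in> carrier V"
  show "ptensor K V W (a \<odot>\<^bsub>V\<^esub> v) w = a \<odot>\<^bsub>V \<Otimes>\<^bsub>K\<^esub> W\<^esub> ptensor K V W v w"
    unfolding ptensor_def tensor_def
    by (subst quot_simps, (intro gen_closed *)+, rule coset_eqI)
       (intro tensor_relsI gen_closed F.smult_closed V.M.add.m_closed W.M.add.m_closed V.smult_closed W.smult_closed *)+
qed

text \<open>Induction on the finite support: setting one coefficient to zero splits off one scaled
  generator.\<close>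

lemma free_space_induct [consumes 1, case_names zero add]:
  assumes "f \<in> carrier FF" "P (\<lambda>s. \<zero>\<^bsub>K\<^esub>)"
    and "\<And>f a v w. \<lbrakk>f \<in> carrier FF; a \<in> carrier K; v \<in> carrier V; w \<in> carrier W; P f\<rbrakk> \<Longrightarrow>
      P (a \<odot>\<^bsub>FF\<^esub> free_gen K (v, w) \<oplus>\<^bsub>FF\<^esub> f)"
  shows "P f"
proof -
  have "finite {s. f s \<noteq> \<zero>\<^bsub>K\<^esub>}" using assms(1) by (simp add: free_space_carrier_iff)
  then show ?thesis
    using assms(1)
  proof (induction "{s. f s \<noteq> \<zero>\<^bsub>K\<^esub>}" arbitrary: f rule: finite_induct)
    case empty
    then have "f = (\<lambda>s. \<zero>\<^bsub>K\<^esub>)" by auto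
    then show ?case using assms(2) by simp
  next
    case (insert s A)
    obtain v w where s: "s = (v, w)" by (cases s)
    let ?g = "f(s := \<zero>\<^bsub>K\<^esub>)"
    have A: "A = {t. ?g t \<noteq> \<zero>\<^bsub>K\<^esub>}" using insert.hyps(2,4) by auto
    have "f (v, w) \<noteq> \<zero>\<^bsub>K\<^esub>" using insert.hyps(4) s by blast
    then have vw: "v \<in> carrier V" "w \<in> carrier W" and fs: "f s \<in> carrier K"
      using insert.prems free_space_support[of f K _ "(v, w)"] free_space_coeff by auto
    have "?g \<in> carrier FF"
      using insert.prems insert.hyps(1) A by (auto simp: free_space_carrier_iff)
    then have "P (f s \<odot>\<^bsub>FF\<^esub> free_gen K (v, w) \<oplus>\<^bsub>FF\<^esub> ?g)"
      using assms(3)[OF _ fs vw] insert.hyps(3)[OF A] by blast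
    also have "f s \<odot>\<^bsub>FF\<^esub> free_gen K (v, w) \<oplus>\<^bsub>FF\<^esub> ?g = f"
      using insert.prems by (auto simp: s free_gen_def free_space_carrier_iff)
    finally show ?case .
  qed
qed

text \<open>Every tensor is a sum of pure ones, since a scalar in front of a generator can be
  absorbed into its first entry. The empty sum is covered too: the zero class is the pure tensor of
  the two zero vectors.\<close>

lemma tensor_induct:
  assumes "x \<in> carrier (V \<Otimes>\<^bsub>K\<^esub> W)"
    and "\<And>v w. \<lbrakk>v \<in> carrier V; w \<in> carrier W\<rbrakk> \<Longrightarrow> P (ptensor K V W v w)"
    and "\<And>x y. \<lbrakk>x \<in> carrier (V \<Otimes>\<^bsub>K\<^esub> W); y \<in> carrier (V \<Otimes>\<^bsub>K\<^esub> W); P x; P y\<rbrakk> \<Longrightarrow> P (x \<oplus>\<^bsub>V \<Otimes>\<^bsub>K\<^esub> W\<^esub> y)"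
  shows "P x"
proof -
  interpret T: vectorspace K "V \<Otimes>\<^bsub>K\<^esub> W" by (rule tensor_vectorspace)
  let ?c = "\<lambda>f. tensor_null K V W +>\<^bsub>FF\<^esub> f"
  have gen: "?c (a \<odot>\<^bsub>FF\<^esub> free_gen K (v, w)) = ptensor K V W (a \<odot>\<^bsub>V\<^esub> v) w"
    if "a \<in> carrier K" "v \<in> carrier V" "w \<in> carrier W" for a v w
  proof -
    have "ptensor K V W (a \<odot>\<^bsub>V\<^esub> v) w = a \<odot>\<^bsub>V \<Otimes>\<^bsub>K\<^esub> W\<^esub> ptensor K V W v w"
      using bilinear_ptensor that linear_map_smult[of K V _ "\<lambda>v. ptensor K V W v w"]
      unfolding bilinear_def by blast
    then show ?thesis
      using that by (simp add: ptensor_def tensor_def quot_simps gen_closed del: free_space_simps)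
  qed
  have "P (?c f)" if "f \<in> carrier FF" for f
    using that
  proof (induction rule: free_space_induct)
    case zero
    have "?c (\<lambda>s. \<zero>\<^bsub>K\<^esub>) = ptensor K V W (\<zero>\<^bsub>K\<^esub> \<odot>\<^bsub>V\<^esub> \<zero>\<^bsub>V\<^esub>) \<zero>\<^bsub>W\<^esub>"
    proof -
      have "(\<lambda>s. \<zero>\<^bsub>K\<^esub>) = \<zero>\<^bsub>K\<^esub> \<odot>\<^bsub>FF\<^esub> free_gen K (\<zero>\<^bsub>V\<^esub>, \<zero>\<^bsub>W\<^esub>)"
        by (auto simp: free_gen_def)
      then show ?thesis using gen[of "\<zero>\<^bsub>K\<^esub>" "\<zero>\<^bsub>V\<^esub>" "\<zero>\<^bsub>W\<^esub>"] by simp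
    qed
    then show ?case using assms(2) by simp
  next
    case (add f a v w)
    have "?c (a \<odot>\<^bsub>FF\<^esub> free_gen K (v, w) \<oplus>\<^bsub>FF\<^esub> f)
        = ?c (a \<odot>\<^bsub>FF\<^esub> free_gen K (v, w)) \<oplus>\<^bsub>V \<Otimes>\<^bsub>K\<^esub> W\<^esub> ?c f"
      unfolding tensor_def using add by (intro quot_simps[symmetric] F.smult_closed gen_closed)
    moreover have "?c f \<in> carrier (V \<Otimes>\<^bsub>K\<^esub> W)"
      using add by (auto simp: tensor_def quotient_carrier)
    ultimately show ?case
      using add by (simp only: gen) (intro assms; simp add: ptensor_closed)
  qed
  then show ?thesis
    using assms(1) by (auto simp: tensor_def quotient_carrier)
qed

section \<open>The linear map induced by a bilinear map\<close>

context
  fixes U :: "('k, 'u, 'm3) module_scheme" and b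
  assumes U: "vectorspace K U" and b: "bilinear K V W U b"
begin

interpretation U: vectorspace K U by fact

lemma bilinear_closed: "v \<in> carrier V \<Longrightarrow> w \<in> carrier W \<Longrightarrow> b v w \<in> carrier U"
  using b linear_map_closed[of K W U "b v" w] by (auto simp: bilinear_def)

text \<open>Additivity compares sums over three different supports; extending each by zero terms to
  a common finite set makes them comparable.\<close>

lemma formal_eval_superset:
  assumes "f \<in> carrier FF" "finite A" "{p. f p \<noteq> \<zero>\<^bsub>K\<^esub>} \<subseteq> A" "A \<subseteq> carrier V \<times> carrier W"
  shows "formal_eval K U b f = (\<Oplus>\<^bsub>U\<^esub>p\<in>A. f p \<odot>\<^bsub>U\<^esub> b (fst p) (snd p))"
  unfolding formal_eval_def
  using assms bilinear_closed
  by (intro U.M.add.finprod_mono_neutral_cong_left) (auto simp: free_space_carrier_iff)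

lemma formal_eval_linear: "linear_map K FF U (formal_eval K U b)"
proof (rule linear_mapI[OF F.vectorspace_axioms U])
  fix f assume f: "f \<in> carrier FF"
  show "formal_eval K U b f \<in> carrier U"
    unfolding formal_eval_def using f
    by (intro U.M.finsum_closed) (auto simp: free_space_carrier_iff intro!: bilinear_closed)
next
  fix f g assume *: "f \<in> carrier FF" "g \<in> carrier FF"
  let ?A = "{p. f p \<noteq> \<zero>\<^bsub>K\<^esub>} \<union> {p. g p \<noteq> \<zero>\<^bsub>K\<^esub>}"
  have A: "finite ?A" "?A \<subseteq> carrier V \<times> carrier W"
    using * by (auto simp: free_space_carrier_iff)
  have fg: "f \<oplus>\<^bsub>FF\<^esub> g \<in> carrier FF" using * by (rule F.M.add.m_closed)
  have c: "f p \<in> carrier K" "g p \<in> carrier K" for p using * by (simp_all add: free_space_coeff)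
  have "formal_eval K U b (f \<oplus>\<^bsub>FF\<^esub> g) = (\<Oplus>\<^bsub>U\<^esub>p\<in>?A. (f \<oplus>\<^bsub>FF\<^esub> g) p \<odot>\<^bsub>U\<^esub> b (fst p) (snd p))"
    by (rule formal_eval_superset[OF fg]) (use A in auto)
  also have "\<dots> = (\<Oplus>\<^bsub>U\<^esub>p\<in>?A. f p \<odot>\<^bsub>U\<^esub> b (fst p) (snd p) \<oplus>\<^bsub>U\<^esub> g p \<odot>\<^bsub>U\<^esub> b (fst p) (snd p))"
    using A(2) c bilinear_closed by (intro U.M.finsum_cong') (auto simp: U.smult_l_distr)
  also have "\<dots> = (\<Oplus>\<^bsub>U\<^esub>p\<in>?A. f p \<odot>\<^bsub>U\<^esub> b (fst p) (snd p)) \<oplus>\<^bsub>U\<^esub> (\<Oplus>\<^bsub>U\<^esub>p\<in>?A. g p \<odot>\<^bsub>U\<^esub> b (fst p) (snd p))"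
    using A(2) c bilinear_closed by (intro U.M.finsum_addf) auto
  also have "\<dots> = formal_eval K U b f \<oplus>\<^bsub>U\<^esub> formal_eval K U b g"
    using formal_eval_superset[OF *(1) A(1) _ A(2)] formal_eval_superset[OF *(2) A(1) _ A(2)]
    by simp
  finally show "formal_eval K U b (f \<oplus>\<^bsub>FF\<^esub> g) = formal_eval K U b f \<oplus>\<^bsub>U\<^esub> formal_eval K U b g" .
next
  fix a f assume *: "a \<in> carrier K" "f \<in> carrier FF"
  let ?A = "{p. f p \<noteq> \<zero>\<^bsub>K\<^esub>}"
  have A: "finite ?A" "?A \<subseteq> carrier V \<times> carrier W"
    using * by (auto simp: free_space_carrier_iff)
  have af: "a \<odot>\<^bsub>FF\<^esub> f \<in> carrier FF" using * by (rule F.smult_closed)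
  have c: "f p \<in> carrier K" for p using * by (simp add: free_space_coeff)
  have "formal_eval K U b (a \<odot>\<^bsub>FF\<^esub> f) = (\<Oplus>\<^bsub>U\<^esub>p\<in>?A. (a \<odot>\<^bsub>FF\<^esub> f) p \<odot>\<^bsub>U\<^esub> b (fst p) (snd p))"
    by (rule formal_eval_superset[OF af]) (use A * in auto)
  also have "\<dots> = (\<Oplus>\<^bsub>U\<^esub>p\<in>?A. a \<odot>\<^bsub>U\<^esub> (f p \<odot>\<^bsub>U\<^esub> b (fst p) (snd p)))"
    using A(2) c * bilinear_closed by (intro U.M.finsum_cong') (auto simp: U.smult_assoc1)
  also have "\<dots> = a \<odot>\<^bsub>U\<^esub> formal_eval K U b f"
    unfolding formal_eval_def
    using A * c bilinear_closed by (intro U.finsum_smult_ldistr[symmetric]) auto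
  finally show "formal_eval K U b (a \<odot>\<^bsub>FF\<^esub> f) = a \<odot>\<^bsub>U\<^esub> formal_eval K U b f" .
qed

lemma formal_eval_gen:
  assumes "v \<in> carrier V" "w \<in> carrier W"
  shows "formal_eval K U b (free_gen K (v, w)) = b v w"
proof -
  have "formal_eval K U b (free_gen K (v, w))
      = (\<Oplus>\<^bsub>U\<^esub>p\<in>{(v, w)}. free_gen K (v, w) p \<odot>\<^bsub>U\<^esub> b (fst p) (snd p))"
    using assms gen_closed by (intro formal_eval_superset) (auto simp: free_gen_def)
  then show ?thesis using assms bilinear_closed by (simp add: free_gen_def)
qed

text \<open>The kernel of \<open>formal_eval\<close> is a submodule. Bilinearity puts every
  generating relation into it, and with them their span.\<close>

lemma formal_eval_null:
  assumes "f \<in> tensor_null K V W"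
  shows "formal_eval K U b f = \<zero>\<^bsub>U\<^esub>"
proof -
  interpret E: linear_map K FF U "formal_eval K U b" by (rule formal_eval_linear)
  note b' = b[unfolded bilinear_def]
  have minus: "formal_eval K U b (f \<ominus>\<^bsub>FF\<^esub> g) = \<zero>\<^bsub>U\<^esub>"
    if "f \<in> carrier FF" "g \<in> carrier FF" "formal_eval K U b f = formal_eval K U b g" for f g
  proof -
    have "f \<ominus>\<^bsub>FF\<^esub> g = f \<oplus>\<^bsub>FF\<^esub> (\<ominus>\<^bsub>K\<^esub> \<one>\<^bsub>K\<^esub>) \<odot>\<^bsub>FF\<^esub> g"
      using that F.smult_minus_1 unfolding a_minus_def by metis
    then have "formal_eval K U b (f \<ominus>\<^bsub>FF\<^esub> g)
        = formal_eval K U b f \<oplus>\<^bsub>U\<^esub> (\<ominus>\<^bsub>K\<^esub> \<one>\<^bsub>K\<^esub>) \<odot>\<^bsub>U\<^esub> formal_eval K U b g"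
      using that by (simp add: E.T_add E.T_smult F.smult_closed del: free_space_simps)
    then show ?thesis
      using that E.T_im by (simp add: U.smult_minus_1 U.M.r_neg)
  qed
  have "tensor_rels K V W \<subseteq> E.ker"
  proof -
    have "formal_eval K U b r = \<zero>\<^bsub>U\<^esub>" if "r \<in> tensor_rels K V W" for r
      using that unfolding tensor_rels_def Let_def
    proof (elim UnE; clarify)
      fix v v' w assume "v \<in> carrier V" "v' \<in> carrier V" "w \<in> carrier W"
      then show "formal_eval K U b (free_gen K (v \<oplus>\<^bsub>V\<^esub> v', w) \<ominus>\<^bsub>FF\<^esub>
          (free_gen K (v, w) \<oplus>\<^bsub>FF\<^esub> free_gen K (v', w))) = \<zero>\<^bsub>U\<^esub>"
        using b' linear_map_add[of K V U "\<lambda>v. b v w" v v']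
        by (intro minus) (simp_all add: gen_closed E.T_add formal_eval_gen del: free_space_simps)
    next
      fix v w w' assume "v \<in> carrier V" "w \<in> carrier W" "w' \<in> carrier W"
      then show "formal_eval K U b (free_gen K (v, w \<oplus>\<^bsub>W\<^esub> w') \<ominus>\<^bsub>FF\<^esub>
          (free_gen K (v, w) \<oplus>\<^bsub>FF\<^esub> free_gen K (v, w'))) = \<zero>\<^bsub>U\<^esub>"
        using b' linear_map_add[of K W U "b v" w w']
        by (intro minus) (simp_all add: gen_closed E.T_add formal_eval_gen del: free_space_simps)
    next
      fix a v w assume "a \<in> carrier K" "v \<in> carrier V" "w \<in> carrier W"
      then show "formal_eval K U b (free_gen K (a \<odot>\<^bsub>V\<^esub> v, w) \<ominus>\<^bsub>FF\<^esub>
          a \<odot>\<^bsub>FF\<^esub> free_gen K (v, w)) = \<zero>\<^bsub>U\<^esub>"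
        using b' linear_map_smult[of K V U "\<lambda>v. b v w" a v]
        by (intro minus) (simp_all add: gen_closed E.T_smult formal_eval_gen del: free_space_simps)
    next
      fix a v w assume "a \<in> carrier K" "v \<in> carrier V" "w \<in> carrier W"
      then show "formal_eval K U b (free_gen K (v, a \<odot>\<^bsub>W\<^esub> w) \<ominus>\<^bsub>FF\<^esub>
          a \<odot>\<^bsub>FF\<^esub> free_gen K (v, w)) = \<zero>\<^bsub>U\<^esub>"
        using b' linear_map_smult[of K W U "b v" a w]
        by (intro minus) (simp_all add: gen_closed E.T_smult formal_eval_gen del: free_space_simps)
    qed
    then show ?thesis using tensor_rels_subset by (auto simp: E.ker_def)
  qed
  then have "tensor_null K V W \<subseteq> E.ker"
    unfolding tensor_null_def by (rule F.span_is_subset) (rule E.ker_is_submodule)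
  then show ?thesis using assms by (auto simp: E.ker_def)
qed

text \<open>\<open>formal_eval\<close> is constant on a coset because it vanishes on
  \<open>tensor_null\<close>. Its image over the coset is then a singleton, the situation in which
  \<open>the_elem\<close> is meaningful.\<close>

lemma tensor_lift_coset:
  assumes "f \<in> carrier FF"
  shows "tensor_lift K U b (tensor_null K V W +>\<^bsub>FF\<^esub> f) = formal_eval K U b f"
proof -
  have "formal_eval K U b g = formal_eval K U b f" if "g \<in> tensor_null K V W +>\<^bsub>FF\<^esub> f" for g
  proof -
    obtain n where n: "n \<in> tensor_null K V W" "g = n \<oplus>\<^bsub>FF\<^esub> f"
      using \<open>g \<in> _\<close> unfolding a_r_coset_def' by blast
    then have "formal_eval K U b g = formal_eval K U b n \<oplus>\<^bsub>U\<^esub> formal_eval K U b f"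
      using linear_map_add[OF formal_eval_linear, of n f] assms by auto
    then show ?thesis
      using n formal_eval_null linear_map_closed[OF formal_eval_linear assms] by simp
  qed
  moreover have "f \<in> tensor_null K V W +>\<^bsub>FF\<^esub> f" using assms by (rule N.a_rcos_self)
  ultimately have "formal_eval K U b ` (tensor_null K V W +>\<^bsub>FF\<^esub> f) = {formal_eval K U b f}"
    by blast
  then show ?thesis unfolding tensor_lift_def formal_eval_def by simp
qed

lemma tensor_lift_linear: "linear_map K (V \<Otimes>\<^bsub>K\<^esub> W) U (tensor_lift K U b)"
proof (rule linear_mapI[OF tensor_vectorspace U])
  fix x assume "x \<in> carrier (V \<Otimes>\<^bsub>K\<^esub> W)"
  then show "tensor_lift K U b x \<in> carrier U"
    using linear_map_closed[OF formal_eval_linear]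
    by (auto simp: tensor_def quotient_carrier tensor_lift_coset)
next
  fix x y assume "x \<in> carrier (V \<Otimes>\<^bsub>K\<^esub> W)" "y \<in> carrier (V \<Otimes>\<^bsub>K\<^esub> W)"
  then show "tensor_lift K U b (x \<oplus>\<^bsub>V \<Otimes>\<^bsub>K\<^esub> W\<^esub> y) = tensor_lift K U b x \<oplus>\<^bsub>U\<^esub> tensor_lift K U b y"
    using linear_map_add[OF formal_eval_linear]
    by (auto simp: tensor_def quotient_carrier tensor_lift_coset quot_simps simp del: free_space_simps)
next
  fix a x assume "a \<in> carrier K" "x \<in> carrier (V \<Otimes>\<^bsub>K\<^esub> W)"
  then show "tensor_lift K U b (a \<odot>\<^bsub>V \<Otimes>\<^bsub>K\<^esub> W\<^esub> x) = a \<odot>\<^bsub>U\<^esub> tensor_lift K U b x"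
    using linear_map_smult[OF formal_eval_linear]
    by (auto simp: tensor_def quotient_carrier tensor_lift_coset quot_simps F.smult_closed simp del: free_space_simps)
qed

lemma tensor_lift_pure:
  "v \<in> carrier V \<Longrightarrow> w \<in> carrier W \<Longrightarrow> tensor_lift K U b (ptensor K V W v w) = b v w"
  unfolding ptensor_def by (simp only: tensor_lift_coset gen_closed formal_eval_gen)

end

end

text \<open>The conclusion is quantified over the carrier so that both sides occur as functions of a
  bound variable, from which unification reads off \<open>f\<close> and \<open>g\<close>. Most
  identities below are obtained by stating such a quantified version, applying this rule and
  specializing.\<close>

lemma tensor_ext:
  assumes f: "linear_map K (V \<Otimes>\<^bsub>K\<^esub> W) U f" and g: "linear_map K (V \<Otimes>\<^bsub>K\<^esub> W) U g"
    and "vectorspace K V" "vectorspace K W"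
    and "\<And>v w. v \<in> carrier V \<Longrightarrow> w \<in> carrier W \<Longrightarrow> f (ptensor K V W v w) = g (ptensor K V W v w)"
  shows "\<forall>x\<in>carrier (V \<Otimes>\<^bsub>K\<^esub> W). f x = g x"
proof
  fix x assume "x \<in> carrier (V \<Otimes>\<^bsub>K\<^esub> W)"
  then show "f x = g x"
    by (rule tensor_induct[OF assms(3,4)])
       (use assms(5) in \<open>auto simp: linear_map_add[OF f] linear_map_add[OF g]\<close>)
qed

section \<open>Linear maps between tensor products\<close>

lemma linear_map_id [simp]:
  "vectorspace K V \<Longrightarrow> linear_map K V V (\<lambda>x. x)" "vectorspace K V \<Longrightarrow> linear_map K V V id"
  by (auto intro!: linear_mapI vectorspace.axioms module.smult_closed abelian_group.axioms
    simp: abelian_groupE)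

declare tensor_vectorspace [simp] ptensor_closed [simp]

lemma linear_map_ptensor_left:
  assumes "linear_map K X V h" "vectorspace K W" "w \<in> carrier W"
  shows "linear_map K X (V \<Otimes>\<^bsub>K\<^esub> W) (\<lambda>x. ptensor K V W (h x) w)"
  using linear_map_comp[OF assms(1), of "V \<Otimes>\<^bsub>K\<^esub> W" "\<lambda>v. ptensor K V W v w"]
    bilinear_ptensor[OF linear_map_target[OF assms(1)] assms(2)] assms(3)
  by (auto simp: bilinear_def)

lemma linear_map_ptensor_right:
  assumes "linear_map K X W h" "vectorspace K V" "v \<in> carrier V"
  shows "linear_map K X (V \<Otimes>\<^bsub>K\<^esub> W) (\<lambda>x. ptensor K V W v (h x))"
  using linear_map_comp[OF assms(1), of "V \<Otimes>\<^bsub>K\<^esub> W" "\<lambda>w. ptensor K V W v w"]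
    bilinear_ptensor[OF assms(2) linear_map_target[OF assms(1)]] assms(3)
  by (auto simp: bilinear_def)

lemma bilinear_tmap:
  assumes "linear_map K V V' f" "linear_map K W W' g"
  shows "bilinear K V W (V' \<Otimes>\<^bsub>K\<^esub> W') (\<lambda>v w. ptensor K V' W' (f v) (g w))"
  unfolding bilinear_def
  using assms
  by (intro conjI ballI linear_map_ptensor_left linear_map_ptensor_right)
     (auto intro: linear_map_target linear_map_closed)

lemma tmap_linear [simp]:
  assumes "linear_map K V V' f" "linear_map K W W' g"
  shows "linear_map K (V \<Otimes>\<^bsub>K\<^esub> W) (V' \<Otimes>\<^bsub>K\<^esub> W') (tmap K V' W' f g)"
  unfolding tmap_def
  by (rule tensor_lift_linear[OF _ _ _ bilinear_tmap[OF assms]])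
     (simp_all add: linear_map_source[OF assms(1)] linear_map_source[OF assms(2)]
       linear_map_target[OF assms(1)] linear_map_target[OF assms(2)])

lemma tmap_pure [simp]:
  assumes "linear_map K V V' f" "linear_map K W W' g" "v \<in> carrier V" "w \<in> carrier W"
  shows "tmap K V' W' f g (ptensor K V W v w) = ptensor K V' W' (f v) (g w)"
  unfolding tmap_def
  by (subst tensor_lift_pure[OF _ _ _ bilinear_tmap[OF assms(1,2)]])
     (simp_all add: assms linear_map_source[OF assms(1)] linear_map_source[OF assms(2)]
       linear_map_target[OF assms(1)] linear_map_target[OF assms(2)])

lemma linear_map_tmap:
  assumes "linear_map K X (V \<Otimes>\<^bsub>K\<^esub> W) h" "linear_map K V V' f" "linear_map K W W' g"
  shows "linear_map K X (V' \<Otimes>\<^bsub>K\<^esub> W') (\<lambda>x. tmap K V' W' f g (h x))"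
  using linear_map_comp[OF assms(1) tmap_linear[OF assms(2,3)]] .

section \<open>The associativity isomorphism and its inverse\<close>

context
  fixes K :: "('k, 'm) ring_scheme" and U :: "('k, 'u, 'm1) module_scheme"
    and V :: "('k, 'v, 'm2) module_scheme" and W :: "('k, 'w, 'm3) module_scheme"
  assumes U: "vectorspace K U" and V: "vectorspace K V" and W: "vectorspace K W"
begin

lemma assoc_inner:
  assumes "w \<in> carrier W"
  shows "bilinear K U V (U \<Otimes>\<^bsub>K\<^esub> (V \<Otimes>\<^bsub>K\<^esub> W)) (\<lambda>u v. ptensor K U (V \<Otimes>\<^bsub>K\<^esub> W) u (ptensor K V W v w))"
  using assms U V W by (auto simp: bilinear_def intro!: linear_map_ptensor_left linear_map_ptensor_right)

lemma assoc_inv_inner: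
  assumes "u \<in> carrier U"
  shows "bilinear K V W ((U \<Otimes>\<^bsub>K\<^esub> V) \<Otimes>\<^bsub>K\<^esub> W) (\<lambda>v w. ptensor K (U \<Otimes>\<^bsub>K\<^esub> V) W (ptensor K U V u v) w)"
  using assms U V W by (auto simp: bilinear_def intro!: linear_map_ptensor_left linear_map_ptensor_right)

text \<open>Linearity in \<open>x\<close> comes with the inner lift. Linearity in \<open>w\<close>
  is visible only when \<open>x\<close> is a pure tensor; it spreads to all \<open>x\<close> by
  induction, because a pointwise sum of linear maps is linear.\<close>

lemma assoc_outer:
  "bilinear K (U \<Otimes>\<^bsub>K\<^esub> V) W (U \<Otimes>\<^bsub>K\<^esub> (V \<Otimes>\<^bsub>K\<^esub> W)) (\<lambda>x w.
      tensor_lift K (U \<Otimes>\<^bsub>K\<^esub> (V \<Otimes>\<^bsub>K\<^esub> W)) (\<lambda>u v.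
        ptensor K U (V \<Otimes>\<^bsub>K\<^esub> W) u (ptensor K V W v w)) x)"
  unfolding bilinear_def
proof (intro conjI ballI)
  let ?T = "U \<Otimes>\<^bsub>K\<^esub> (V \<Otimes>\<^bsub>K\<^esub> W)"
  let ?F = "\<lambda>x w. tensor_lift K ?T (\<lambda>u v. ptensor K U (V \<Otimes>\<^bsub>K\<^esub> W) u (ptensor K V W v w)) x"
  interpret T: vectorspace K ?T using U V W by simp
  have T: "vectorspace K ?T" ..
  show lin: "linear_map K (U \<Otimes>\<^bsub>K\<^esub> V) ?T (\<lambda>x. ?F x w)" if "w \<in> carrier W" for w
    using U V W that by (simp add: tensor_lift_linear assoc_inner)
  have pure: "?F (ptensor K U V u v) w = ptensor K U (V \<Otimes>\<^bsub>K\<^esub> W) u (ptensor K V W v w)"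
    if "u \<in> carrier U" "v \<in> carrier V" "w \<in> carrier W" for u v w
    using tensor_lift_pure[OF U V T assoc_inner[OF that(3)] that(1,2)] .
  have lin_w: "linear_map K W ?T (\<lambda>w. ptensor K U (V \<Otimes>\<^bsub>K\<^esub> W) u (ptensor K V W v w))"
    if "u \<in> carrier U" "v \<in> carrier V" for u v
    using U V W that by (intro linear_map_ptensor_right) auto
  fix x assume x: "x \<in> carrier (U \<Otimes>\<^bsub>K\<^esub> V)"
  then show "linear_map K W ?T (?F x)"
  proof (rule tensor_induct[OF U V])
    fix u v assume uv: "u \<in> carrier U" "v \<in> carrier V"
    then show "linear_map K W ?T (?F (ptensor K U V u v))"
      by (intro linear_map_cong[OF lin_w[OF uv]]) (simp add: pure)
  next
    fix x y assume xy: "x \<in> carrier (U \<Otimes>\<^bsub>K\<^esub> V)" "y \<in> carrier (U \<Otimes>\<^bsub>K\<^esub> V)"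
      and *: "linear_map K W ?T (?F x)" "linear_map K W ?T (?F y)"
    note c = linear_map_closed[OF *(1)] linear_map_closed[OF *(2)]
    have "linear_map K W ?T (\<lambda>w. ?F x w \<oplus>\<^bsub>?T\<^esub> ?F y w)"
      by (rule linear_mapI[OF W T])
         (simp_all add: c linear_map_add[OF *(1)] linear_map_add[OF *(2)] linear_map_smult[OF *(1)]
           linear_map_smult[OF *(2)] T.M.a_ac T.smult_r_distr)
    then show "linear_map K W ?T (?F (x \<oplus>\<^bsub>U \<Otimes>\<^bsub>K\<^esub> V\<^esub> y))"
      by (rule linear_map_cong) (use linear_map_add[OF lin] xy in simp)
  qed
qed

text \<open>The same argument with the factors exchanged: here linearity in \<open>u\<close> has to
  be extended from pure \<open>y\<close> to all \<open>y\<close>.\<close>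

lemma assoc_inv_outer:
  "bilinear K U (V \<Otimes>\<^bsub>K\<^esub> W) ((U \<Otimes>\<^bsub>K\<^esub> V) \<Otimes>\<^bsub>K\<^esub> W) (\<lambda>u y.
      tensor_lift K ((U \<Otimes>\<^bsub>K\<^esub> V) \<Otimes>\<^bsub>K\<^esub> W) (\<lambda>v w.
        ptensor K (U \<Otimes>\<^bsub>K\<^esub> V) W (ptensor K U V u v) w) y)"
  unfolding bilinear_def
proof (intro conjI ballI)
  let ?T = "(U \<Otimes>\<^bsub>K\<^esub> V) \<Otimes>\<^bsub>K\<^esub> W"
  let ?F = "\<lambda>u y. tensor_lift K ?T (\<lambda>v w. ptensor K (U \<Otimes>\<^bsub>K\<^esub> V) W (ptensor K U V u v) w) y"
  interpret T: vectorspace K ?T using U V W by simp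
  have T: "vectorspace K ?T" ..
  show lin: "linear_map K (V \<Otimes>\<^bsub>K\<^esub> W) ?T (\<lambda>y. ?F u y)" if "u \<in> carrier U" for u
    using U V W that by (simp add: tensor_lift_linear assoc_inv_inner)
  have pure: "?F u (ptensor K V W v w) = ptensor K (U \<Otimes>\<^bsub>K\<^esub> V) W (ptensor K U V u v) w"
    if "u \<in> carrier U" "v \<in> carrier V" "w \<in> carrier W" for u v w
    using tensor_lift_pure[OF V W T assoc_inv_inner[OF that(1)] that(2,3)] .
  have lin_u: "linear_map K U ?T (\<lambda>u. ptensor K (U \<Otimes>\<^bsub>K\<^esub> V) W (ptensor K U V u v) w)"
    if "v \<in> carrier V" "w \<in> carrier W" for v w
    using U V W that by (intro linear_map_ptensor_left) auto
  fix y assume "y \<in> carrier (V \<Otimes>\<^bsub>K\<^esub> W)"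
  then show "linear_map K U ?T (\<lambda>u. ?F u y)"
  proof (rule tensor_induct[OF V W])
    fix v w assume vw: "v \<in> carrier V" "w \<in> carrier W"
    then show "linear_map K U ?T (\<lambda>u. ?F u (ptensor K V W v w))"
      by (intro linear_map_cong[OF lin_u[OF vw]]) (simp add: pure)
  next
    fix x y assume xy: "x \<in> carrier (V \<Otimes>\<^bsub>K\<^esub> W)" "y \<in> carrier (V \<Otimes>\<^bsub>K\<^esub> W)"
      and *: "linear_map K U ?T (\<lambda>u. ?F u x)" "linear_map K U ?T (\<lambda>u. ?F u y)"
    note c = linear_map_closed[OF *(1)] linear_map_closed[OF *(2)]
    have "linear_map K U ?T (\<lambda>u. ?F u x \<oplus>\<^bsub>?T\<^esub> ?F u y)"
      by (rule linear_mapI[OF U T])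
         (simp_all add: c linear_map_add[OF *(1)] linear_map_add[OF *(2)] linear_map_smult[OF *(1)]
           linear_map_smult[OF *(2)] T.M.a_ac T.smult_r_distr)
    then show "linear_map K U ?T (\<lambda>u. ?F u (x \<oplus>\<^bsub>V \<Otimes>\<^bsub>K\<^esub> W\<^esub> y))"
      by (rule linear_map_cong) (use linear_map_add[OF lin] xy in simp)
  qed
qed

lemma assoc_linear: "linear_map K ((U \<Otimes>\<^bsub>K\<^esub> V) \<Otimes>\<^bsub>K\<^esub> W) (U \<Otimes>\<^bsub>K\<^esub> (V \<Otimes>\<^bsub>K\<^esub> W)) (assoc K U V W)"
  unfolding assoc_def using U V W by (intro tensor_lift_linear assoc_outer) simp_all

lemma assoc_inv_linear: "linear_map K (U \<Otimes>\<^bsub>K\<^esub> (V \<Otimes>\<^bsub>K\<^esub> W)) ((U \<Otimes>\<^bsub>K\<^esub> V) \<Otimes>\<^bsub>K\<^esub> W) (assoc_inv K U V W)"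
  unfolding assoc_inv_def using U V W by (intro tensor_lift_linear assoc_inv_outer) simp_all

lemma assoc_pure:
  assumes "u \<in> carrier U" "v \<in> carrier V" "w \<in> carrier W"
  shows "assoc K U V W (ptensor K (U \<Otimes>\<^bsub>K\<^esub> V) W (ptensor K U V u v) w)
    = ptensor K U (V \<Otimes>\<^bsub>K\<^esub> W) u (ptensor K V W v w)"
  unfolding assoc_def using U V W assms
  by (subst tensor_lift_pure[OF _ _ _ assoc_outer]; simp?)
     (subst tensor_lift_pure[OF _ _ _ assoc_inner]; simp)

lemma assoc_inv_pure:
  assumes "u \<in> carrier U" "v \<in> carrier V" "w \<in> carrier W"
  shows "assoc_inv K U V W (ptensor K U (V \<Otimes>\<^bsub>K\<^esub> W) u (ptensor K V W v w))
    = ptensor K (U \<Otimes>\<^bsub>K\<^esub> V) W (ptensor K U V u v) w"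
  unfolding assoc_inv_def using U V W assms
  by (subst tensor_lift_pure[OF _ _ _ assoc_inv_outer]; simp?)
     (subst tensor_lift_pure[OF _ _ _ assoc_inv_inner]; simp)

lemma linear_map_assoc:
  "linear_map K X ((U \<Otimes>\<^bsub>K\<^esub> V) \<Otimes>\<^bsub>K\<^esub> W) h \<Longrightarrow>
    linear_map K X (U \<Otimes>\<^bsub>K\<^esub> (V \<Otimes>\<^bsub>K\<^esub> W)) (\<lambda>x. assoc K U V W (h x))"
  by (erule linear_map_comp) (rule assoc_linear)

lemma linear_map_assoc_inv:
  "linear_map K X (U \<Otimes>\<^bsub>K\<^esub> (V \<Otimes>\<^bsub>K\<^esub> W)) h \<Longrightarrow>
    linear_map K X ((U \<Otimes>\<^bsub>K\<^esub> V) \<Otimes>\<^bsub>K\<^esub> W) (\<lambda>x. assoc_inv K U V W (h x))"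
  by (erule linear_map_comp) (rule assoc_inv_linear)

end

declare assoc_linear [simp] assoc_inv_linear [simp] assoc_pure [simp] assoc_inv_pure [simp]

context unital_algebra
begin

lemma linear_map_mult_right:
  "linear_map K X A h \<Longrightarrow> a \<in> carrier A \<Longrightarrow> linear_map K X A (\<lambda>x. a \<otimes> h x)"
  by (erule linear_map_comp) (auto intro!: linear_mapI vectorspace_axioms simp: A.r_distr smult_mult_right)

lemma linear_map_mult_left:
  "linear_map K X A h \<Longrightarrow> a \<in> carrier A \<Longrightarrow> linear_map K X A (\<lambda>x. h x \<otimes> a)"
  by (erule linear_map_comp) (auto intro!: linear_mapI vectorspace_axioms simp: A.l_distr smult_mult_left)

lemma bilinear_mult: "bilinear K A A A (\<lambda>a b. a \<otimes> b)"
  unfolding bilinear_def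
  by (intro conjI ballI linear_map_mult_left linear_map_mult_right) (simp_all add: vectorspace_axioms)

lemma mult_map_linear [simp]: "linear_map K (A \<Otimes>\<^bsub>K\<^esub> A) A (mult_map K A)"
  unfolding mult_map_def by (intro tensor_lift_linear bilinear_mult vectorspace_axioms)

lemma mult_map_pure [simp]:
  "a \<in> carrier A \<Longrightarrow> b \<in> carrier A \<Longrightarrow> mult_map K A (ptensor K A A a b) = a \<otimes> b"
  unfolding mult_map_def by (intro tensor_lift_pure bilinear_mult vectorspace_axioms)

end

section \<open>Passing between an algebra and its underlying vector space\<close>

lemma vectorspace_cong:
  assumes "vectorspace K V" "carrier V' = carrier V" "add V' = add V" "zero V' = zero V"
    "smult V' = smult V"
  shows "vectorspace K V'"
proof -
  interpret vectorspace K V by fact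
  have "abelian_group V'"
    by (rule abelian_groupI) (auto simp: assms M.a_ac intro: bexI[of _ "\<ominus>\<^bsub>V\<^esub> _"] M.l_neg)
  then show ?thesis
    by (rule vectorspaceI[OF field_axioms])
       (auto simp: assms smult_l_distr smult_r_distr smult_assoc1)
qed

text \<open>A tensor product reads only carrier, addition and scalar multiplication of its factors.
  Tensoring with a crossed product algebra is thus literally equal to tensoring with the space on
  which it lives, so no identification map is called for.\<close>

lemma tensor_cong:
  assumes "carrier V' = carrier V" "add V' = add V" "smult V' = smult V"
    and "carrier W' = carrier W" "add W' = add W" "smult W' = smult W"
  shows "V' \<Otimes>\<^bsub>K\<^esub> W' = V \<Otimes>\<^bsub>K\<^esub> W" "ptensor K V' W' = ptensor K V W"
  by (simp_all add: fun_eq_iff tensor_def ptensor_def tensor_null_def tensor_rels_def assms)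

text \<open>Backward rules that peel off the outermost map of a composite. Each locale below
  enlarges this list by its own maps; the enlarged lists discharge the linearity premises of the
  extension lemmas.\<close>

lemmas linear_intros = linear_map_tmap linear_map_assoc linear_map_assoc_inv
  linear_map_ptensor_left linear_map_ptensor_right

lemma linear_map_iff:
  "linear_map K V W f \<longleftrightarrow> vectorspace K V \<and> vectorspace K W \<and> f \<in> module_hom K V W"
  by (auto simp: linear_map_def mod_hom_def mod_hom_axioms_def vectorspace_def)

lemma linear_map_space_cong:
  assumes "carrier V' = carrier V" "add V' = add V" "zero V' = zero V" "smult V' = smult V"
  shows "linear_map K X V' f \<longleftrightarrow> linear_map K X V f" "linear_map K V' Y g \<longleftrightarrow> linear_map K V Y g"
proof -
  have "vectorspace K V' \<longleftrightarrow> vectorspace K V"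
    using vectorspace_cong[of K V V'] vectorspace_cong[of K V' V] assms by auto
  then show "linear_map K X V' f \<longleftrightarrow> linear_map K X V f" "linear_map K V' Y g \<longleftrightarrow> linear_map K V Y g"
    by (simp_all add: linear_map_iff module_hom_def assms)
qed

text \<open>\<open>tensor_ext\<close> is used twice: on the outer product, and, with
  \<open>x\<close> fixed, on the inner one.\<close>

lemma tensor3_ext:
  fixes K (structure)
  assumes "linear_map K (X \<Otimes> (Y \<Otimes> Z)) U f" "linear_map K (X \<Otimes> (Y \<Otimes> Z)) U g"
    and vs: "vectorspace K X" "vectorspace K Y" "vectorspace K Z"
    and eq: "\<And>x y z. \<lbrakk>x \<in> carrier X; y \<in> carrier Y; z \<in> carrier Z\<rbrakk> \<Longrightarrow>
      f (ptensor K X (Y \<Otimes> Z) x (ptensor K Y Z y z)) = g (ptensor K X (Y \<Otimes> Z) x (ptensor K Y Z y z))"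
    and "t \<in> carrier (X \<Otimes> (Y \<Otimes> Z))"
  shows "f t = g t"
proof -
  have "\<forall>t\<in>carrier (X \<Otimes> (Y \<Otimes> Z)). f t = g t"
  proof (rule tensor_ext[OF assms(1,2)])
    fix x s assume x: "x \<in> carrier X" and s: "s \<in> carrier (Y \<Otimes> Z)"
    have "\<forall>s\<in>carrier (Y \<Otimes> Z). f (ptensor K X (Y \<Otimes> Z) x s) = g (ptensor K X (Y \<Otimes> Z) x s)"
      by (rule tensor_ext)
         ((rule linear_map_comp[OF _ assms(1)] linear_map_comp[OF _ assms(2)] linear_map_ptensor_right
           linear_map_id vs | simp add: vs x eq)+)
    then show "f (ptensor K X (Y \<Otimes> Z) x s) = g (ptensor K X (Y \<Otimes> Z) x s)" using s by blast
  qed (simp_all add: vs)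
  then show ?thesis using assms by blast
qed

lemma tensor3_ext_left:
  fixes K (structure)
  assumes f: "linear_map K ((X \<Otimes> Y) \<Otimes> Z) U f" and g: "linear_map K ((X \<Otimes> Y) \<Otimes> Z) U g"
    and vs: "vectorspace K X" "vectorspace K Y" "vectorspace K Z"
    and eq: "\<And>x y z. \<lbrakk>x \<in> carrier X; y \<in> carrier Y; z \<in> carrier Z\<rbrakk> \<Longrightarrow>
      f (ptensor K (X \<Otimes> Y) Z (ptensor K X Y x y) z) = g (ptensor K (X \<Otimes> Y) Z (ptensor K X Y x y) z)"
    and "t \<in> carrier ((X \<Otimes> Y) \<Otimes> Z)"
  shows "f t = g t"
proof -
  have "\<forall>t\<in>carrier ((X \<Otimes> Y) \<Otimes> Z). f t = g t"
  proof (rule tensor_ext[OF f g])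
    fix s z assume s: "s \<in> carrier (X \<Otimes> Y)" and z: "z \<in> carrier Z"
    have "\<forall>s\<in>carrier (X \<Otimes> Y). f (ptensor K (X \<Otimes> Y) Z s z) = g (ptensor K (X \<Otimes> Y) Z s z)"
      by (rule tensor_ext)
         ((rule linear_map_comp[OF _ f] linear_map_comp[OF _ g] linear_map_ptensor_left
           linear_map_id vs | simp add: vs z eq)+)
    then show "f (ptensor K (X \<Otimes> Y) Z s z) = g (ptensor K (X \<Otimes> Y) Z s z)" using s by blast
  qed (simp_all add: vs)
  then show ?thesis using assms by blast
qed

lemma assoc_assoc_inv:
  fixes K (structure)
  assumes "vectorspace K U" "vectorspace K V" "vectorspace K W" "x \<in> carrier (U \<Otimes> (V \<Otimes> W))"
  shows "assoc K U V W (assoc_inv K U V W x) = x"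
  by (rule tensor3_ext[OF _ _ assms(1-3) _ assms(4)])
     ((rule linear_intros linear_map_id | simp add: assms)+)

lemma assoc_inv_assoc:
  fixes K (structure)
  assumes "vectorspace K U" "vectorspace K V" "vectorspace K W" "x \<in> carrier ((U \<Otimes> V) \<Otimes> W)"
  shows "assoc_inv K U V W (assoc K U V W x) = x"
  by (rule tensor3_ext_left[OF _ _ assms(1-3) _ assms(4)])
     ((rule linear_intros linear_map_id | simp add: assms)+)

section \<open>Associativity from generators\<close>

text \<open>
  Here \<open>act a\<close> is left multiplication by \<open>a\<close> and \<open>j v = 1 \<otimes> v\<close>; the last four assumptions are the
  instances of associativity that the crossed product axioms provide. No linear structure beyond
  \<open>add\<close> is involved, so that the mirror case is obtained by reversing \<open>m\<close> and \<open>mul\<close>.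
\<close>

locale spanning_product =
  fixes C :: "'c set" and A :: "'a set" and V :: "'v set"
    and add :: "'c \<Rightarrow> 'c \<Rightarrow> 'c" and m :: "'c \<Rightarrow> 'c \<Rightarrow> 'c"
    and act :: "'a \<Rightarrow> 'c \<Rightarrow> 'c" and mul :: "'a \<Rightarrow> 'a \<Rightarrow> 'a" and j :: "'v \<Rightarrow> 'c" and e :: 'v
  assumes m_closed: "\<lbrakk>x \<in> C; y \<in> C\<rbrakk> \<Longrightarrow> m x y \<in> C"
    and act_closed: "\<lbrakk>a \<in> A; x \<in> C\<rbrakk> \<Longrightarrow> act a x \<in> C"
    and mul_closed: "\<lbrakk>a \<in> A; b \<in> A\<rbrakk> \<Longrightarrow> mul a b \<in> A"
    and j_closed: "v \<in> V \<Longrightarrow> j v \<in> C"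
    and e_closed: "e \<in> V"
    and add_closed: "\<lbrakk>x \<in> C; y \<in> C\<rbrakk> \<Longrightarrow> add x y \<in> C"
    and m_add_left: "\<lbrakk>x \<in> C; y \<in> C; z \<in> C\<rbrakk> \<Longrightarrow> m (add x y) z = add (m x z) (m y z)"
    and m_add_right: "\<lbrakk>x \<in> C; y \<in> C; z \<in> C\<rbrakk> \<Longrightarrow> m z (add x y) = add (m z x) (m z y)"
    and act_add: "\<lbrakk>a \<in> A; x \<in> C; y \<in> C\<rbrakk> \<Longrightarrow> act a (add x y) = add (act a x) (act a y)"
    and act_mul: "\<lbrakk>a \<in> A; b \<in> A; x \<in> C\<rbrakk> \<Longrightarrow> act a (act b x) = act (mul a b) x"
    and act_m: "\<lbrakk>a \<in> A; x \<in> C; y \<in> C\<rbrakk> \<Longrightarrow> m (act a x) y = act a (m x y)"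
    and span: "\<lbrakk>x \<in> C; \<And>a v. \<lbrakk>a \<in> A; v \<in> V\<rbrakk> \<Longrightarrow> P (act a (j v));
        \<And>x y. \<lbrakk>x \<in> C; y \<in> C; P x; P y\<rbrakk> \<Longrightarrow> P (add x y)\<rbrakk> \<Longrightarrow> P x"
    and m_j_act: "\<lbrakk>v \<in> V; a \<in> A; u \<in> V\<rbrakk> \<Longrightarrow> m (j v) (act a (j u)) = m (m (j v) (act a (j e))) (j u)"
    and m_j_mul: "\<lbrakk>v \<in> V; a \<in> A; b \<in> A\<rbrakk> \<Longrightarrow>
        m (m (j v) (act a (j e))) (act b (j e)) = m (j v) (act (mul a b) (j e))"
    and m_j_j_j: "\<lbrakk>v \<in> V; v' \<in> V; u \<in> V\<rbrakk> \<Longrightarrow> m (j v) (m (j v') (j u)) = m (m (j v) (j v')) (j u)"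
    and m_j_j_act: "\<lbrakk>v \<in> V; v' \<in> V; a \<in> A\<rbrakk> \<Longrightarrow>
        m (j v) (m (j v') (act a (j e))) = m (m (j v) (j v')) (act a (j e))"
begin

lemmas closed = m_closed act_closed mul_closed j_closed e_closed add_closed

text \<open>A general generator on the right is the product of the two special ones,
  \<open>act b (j e)\<close> and \<open>j u\<close>. For \<open>x = j v\<close> this is
  \<open>m_j_act\<close>; left linearity gives all \<open>x\<close>.\<close>

lemma m_act_right:
  assumes "x \<in> C" "b \<in> A" "u \<in> V"
  shows "m (m x (act b (j e))) (j u) = m x (act b (j u))"
  using assms(1)
proof (rule span)
  fix a v assume "a \<in> A" "v \<in> V"
  then show "m (m (act a (j v)) (act b (j e))) (j u) = m (act a (j v)) (act b (j u))"
    using assms by (simp add: closed act_m flip: m_j_act)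
qed (simp add: assms closed m_add_left)

text \<open>On a generator \<open>z = act b (j u)\<close> the two actions merge into one by
  \<open>mul a b\<close>. The law \<open>m_j_mul\<close> distributes that product over two
  successive right factors, and the trailing \<open>j u\<close> is then absorbed again.\<close>

lemma assoc_act_j:
  assumes "v \<in> V" "a \<in> A" "z \<in> C"
  shows "m (m (j v) (act a (j e))) z = m (j v) (act a z)"
  using assms(3)
proof (rule span)
  fix b u assume *: "b \<in> A" "u \<in> V"
  have "m (j v) (act a (act b (j u))) = m (m (j v) (act (mul a b) (j e))) (j u)"
    using * assms by (simp add: closed act_mul flip: m_j_act)
  also have "\<dots> = m (m (m (j v) (act a (j e))) (act b (j e))) (j u)"
    using * assms by (simp add: m_j_mul)
  also have "\<dots> = m (m (j v) (act a (j e))) (act b (j u))"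
    using * assms by (simp add: closed m_act_right)
  finally show "m (m (j v) (act a (j e))) (act b (j u)) = m (j v) (act a (act b (j u)))" by simp
qed (simp add: assms closed m_add_right act_add)

lemma assoc_act:
  assumes "x \<in> C" "a \<in> A" "z \<in> C"
  shows "m (m x (act a (j e))) z = m x (act a z)"
  using assms(1)
  by (rule span) (simp_all add: assms closed act_m assoc_act_j m_add_left)

lemma assoc_j_j:
  assumes "x \<in> C" "v \<in> V" "u \<in> V"
  shows "m x (m (j v) (j u)) = m (m x (j v)) (j u)"
  using assms(1)
  by (rule span) (simp_all add: assms closed act_m m_j_j_j m_add_left)

text \<open>The middle factor is written as \<open>act a (j w)\<close>. Its part \<open>a\<close> is
  moved to the left of the bracket by \<open>assoc_act_j\<close>, which leaves an instance with
  \<open>j w\<close> and \<open>j u\<close> on the right.\<close>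

lemma assoc_j_left:
  assumes "v \<in> V" "x \<in> C" "u \<in> V"
  shows "m (j v) (m x (j u)) = m (m (j v) x) (j u)"
  using assms(2)
proof (rule span)
  fix a w assume *: "a \<in> A" "w \<in> V"
  have "m (j v) (m (act a (j w)) (j u)) = m (j v) (act a (m (j w) (j u)))"
    using * assms by (simp add: closed act_m)
  also have "\<dots> = m (m (j v) (act a (j e))) (m (j w) (j u))"
    using * assms by (simp add: closed assoc_act_j)
  also have "\<dots> = m (m (m (j v) (act a (j e))) (j w)) (j u)"
    using * assms by (simp add: closed assoc_j_j)
  also have "\<dots> = m (m (j v) (act a (j w))) (j u)"
    using * assms by (simp add: closed m_act_right)
  finally show "m (j v) (m (act a (j w)) (j u)) = m (m (j v) (act a (j w))) (j u)" .
qed (simp add: assms closed m_add_left m_add_right)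

text \<open>Splitting \<open>j w\<close> off the right end of \<open>z\<close> leaves
  \<open>act b (j e)\<close> as third factor, which is the case assumed in
  \<open>m_j_j_act\<close>.\<close>

lemma assoc_j:
  assumes "v \<in> V" "u \<in> V" "z \<in> C"
  shows "m (m (j v) (j u)) z = m (j v) (m (j u) z)"
  using assms(3)
proof (rule span)
  fix b w assume *: "b \<in> A" "w \<in> V"
  have "m (j v) (m (j u) (act b (j w))) = m (j v) (m (m (j u) (act b (j e))) (j w))"
    using * assms by (simp flip: m_j_act)
  also have "\<dots> = m (m (j v) (m (j u) (act b (j e)))) (j w)"
    using * assms by (simp add: closed assoc_j_left)
  also have "\<dots> = m (m (m (j v) (j u)) (act b (j e))) (j w)"
    using * assms by (simp add: m_j_j_act)
  also have "\<dots> = m (m (j v) (j u)) (act b (j w))"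
    using * assms by (simp add: closed m_act_right)
  finally show "m (m (j v) (j u)) (act b (j w)) = m (j v) (m (j u) (act b (j w)))" by simp
qed (simp add: assms closed m_add_right)

lemma assoc_middle_j:
  assumes "x \<in> C" "u \<in> V" "z \<in> C"
  shows "m (m x (j u)) z = m x (m (j u) z)"
  using assms(1)
  by (rule span) (simp_all add: assms closed act_m assoc_j m_add_left)

text \<open>If two elements may each be rebracketed as middle factors, so may their product. Both
  kinds of special generators have this property by \<open>assoc_act\<close> and
  \<open>assoc_middle_j\<close>, and \<open>act a (j v)\<close> is such a product.\<close>

theorem m_assoc:
  assumes "x \<in> C" "y \<in> C" "z \<in> C"
  shows "m (m x y) z = m x (m y z)"
  using assms(2)
proof (rule span)
  fix a v assume *: "a \<in> A" "v \<in> V"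
  have "m (m x (act a (j v))) z = m (m (m x (act a (j e))) (j v)) z"
    using * assms by (simp add: m_act_right)
  also have "\<dots> = m (m x (act a (j e))) (m (j v) z)"
    using * assms by (simp add: closed assoc_middle_j)
  also have "\<dots> = m x (act a (m (j v) z))"
    using * assms by (simp add: closed assoc_act)
  also have "\<dots> = m x (m (act a (j v)) z)"
    using * assms by (simp add: closed act_m)
  finally show "m (m x (act a (j v))) z = m x (m (act a (j v)) z)" .
qed (simp add: assms closed m_add_left m_add_right)

end

section \<open>Crossed products\<close>

lemma unital_algebraI:
  assumes vs: "vectorspace K A"
    and closed: "\<And>x y. \<lbrakk>x \<in> carrier A; y \<in> carrier A\<rbrakk> \<Longrightarrow> x \<otimes>\<^bsub>A\<^esub> y \<in> carrier A"
    and one: "\<one>\<^bsub>A\<^esub> \<in> carrier A"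
    and left: "\<And>x. x \<in> carrier A \<Longrightarrow> linear_map K A A (\<lambda>y. y \<otimes>\<^bsub>A\<^esub> x)"
    and right: "\<And>x. x \<in> carrier A \<Longrightarrow> linear_map K A A (\<lambda>y. x \<otimes>\<^bsub>A\<^esub> y)"
    and assoc: "\<And>x y z. \<lbrakk>x \<in> carrier A; y \<in> carrier A; z \<in> carrier A\<rbrakk> \<Longrightarrow>
      (x \<otimes>\<^bsub>A\<^esub> y) \<otimes>\<^bsub>A\<^esub> z = x \<otimes>\<^bsub>A\<^esub> (y \<otimes>\<^bsub>A\<^esub> z)"
    and units: "\<And>x. x \<in> carrier A \<Longrightarrow> \<one>\<^bsub>A\<^esub> \<otimes>\<^bsub>A\<^esub> x = x" "\<And>x. x \<in> carrier A \<Longrightarrow> x \<otimes>\<^bsub>A\<^esub> \<one>\<^bsub>A\<^esub> = x"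
  shows "unital_algebra K A"
proof -
  interpret vectorspace K A by fact
  have "ring A"
    by (rule ringI[OF M.abelian_group_axioms])
       (auto intro!: monoidI closed one assoc units
         simp: linear_map_add[OF left] linear_map_add[OF right])
  then show ?thesis
    by (intro unital_algebra.intro unital_algebra_axioms.intro vs)
       (simp_all add: linear_map_smult[OF left] linear_map_smult[OF right])
qed

text \<open>
  A crossed product without its three identities: enough to define the multiplication and to
  express the identities in terms of it.
\<close>

locale crossed_data = A: unital_algebra K A + V: vectorspace K V
  for K :: "('k, 'm) ring_scheme" (structure)
    and A :: "('k, 'a, 'm1) module_scheme"
    and V :: "('k, 'v, 'm2) module_scheme" +
  fixes e :: 'v
    and R :: "('v \<times> 'a \<Rightarrow> 'k) set \<Rightarrow> ('a \<times> 'v \<Rightarrow> 'k) set"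
    and \<sigma> :: "('v \<times> 'v \<Rightarrow> 'k) set \<Rightarrow> ('a \<times> 'v \<Rightarrow> 'k) set"
  assumes e_closed [simp]: "e \<in> carrier V"
    and R_linear [simp]: "linear_map K (V \<Otimes> A) (A \<Otimes> V) R"
    and \<sigma>_linear [simp]: "linear_map K (V \<Otimes> V) (A \<Otimes> V) \<sigma>"
    and R_e [simp]: "a \<in> carrier A \<Longrightarrow> R (ptensor K V A e a) = ptensor K A V a e"
    and R_one [simp]: "v \<in> carrier V \<Longrightarrow> R (ptensor K V A v \<one>\<^bsub>A\<^esub>) = ptensor K A V \<one>\<^bsub>A\<^esub> v"
    and \<sigma>_e_left [simp]: "v \<in> carrier V \<Longrightarrow> \<sigma> (ptensor K V V e v) = ptensor K A V \<one>\<^bsub>A\<^esub> v"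
    and \<sigma>_e_right [simp]: "v \<in> carrier V \<Longrightarrow> \<sigma> (ptensor K V V v e) = ptensor K A V \<one>\<^bsub>A\<^esub> v"
begin

section \<open>The multiplication determined by crossed data\<close>

lemma spaces [simp]: "vectorspace K A" "vectorspace K V"
  by (rule A.vectorspace_axioms V.vectorspace_axioms)+

lemmas R_closed [simp] = linear_map_closed[OF R_linear]
lemmas \<sigma>_closed [simp] = linear_map_closed[OF \<sigma>_linear]

definition act where "act a = tmap K A V (\<lambda>b. a \<otimes>\<^bsub>A\<^esub> b) id"

lemma mult_linear [simp]: "a \<in> carrier A \<Longrightarrow> linear_map K A A (\<lambda>b. a \<otimes>\<^bsub>A\<^esub> b)"
  by (rule A.linear_map_mult_right) simp_all

lemma act_linear [simp]: "a \<in> carrier A \<Longrightarrow> linear_map K (A \<Otimes> V) (A \<Otimes> V) (act a)"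
  by (simp add: act_def)

lemmas act_closed [simp] = linear_map_closed[OF act_linear]

lemma act_pure [simp]:
  "a \<in> carrier A \<Longrightarrow> b \<in> carrier A \<Longrightarrow> v \<in> carrier V \<Longrightarrow>
    act a (ptensor K A V b v) = ptensor K A V (a \<otimes>\<^bsub>A\<^esub> b) v"
  by (simp add: act_def)

definition prod where
  "prod x y = crossed_mult_map K A V R \<sigma> (ptensor K (A \<Otimes> V) (A \<Otimes> V) x y)"

text \<open>The tail shared by the composites in the axioms. It turns out to be right multiplication
  by \<open>inc\<^sub>A b\<close> (\<open>prod_incA_right\<close>), as \<open>\<sigma>_ext\<close>
  is right multiplication by \<open>inc\<^sub>V u\<close> (\<open>prod_incV_right\<close>); this is
  how the axioms become statements about \<open>prod\<close>.\<close>

definition R_ext where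
  "R_ext = tmap K A V (mult_map K A) id \<circ> assoc_inv K A A V
        \<circ> tmap K A (A \<Otimes> V) id R \<circ> assoc K A V A"

definition \<sigma>_ext where
  "\<sigma>_ext = tmap K A V (mult_map K A) id \<circ> assoc_inv K A A V
        \<circ> tmap K A (A \<Otimes> V) id \<sigma> \<circ> assoc K A V V"

lemmas lin = linear_intros linear_map_comp[OF _ R_linear] linear_map_comp[OF _ \<sigma>_linear]
  linear_map_comp[OF _ A.mult_map_linear] linear_map_comp[OF _ act_linear] linear_map_id

lemma R_ext_linear [simp]: "linear_map K ((A \<Otimes> V) \<Otimes> A) (A \<Otimes> V) R_ext"
  unfolding R_ext_def comp_def by (rule lin | simp)+

lemma \<sigma>_ext_linear [simp]: "linear_map K ((A \<Otimes> V) \<Otimes> V) (A \<Otimes> V) \<sigma>_ext"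
  unfolding \<sigma>_ext_def comp_def by (rule lin | simp)+

lemma crossed_mult_map_linear [simp]:
  "linear_map K ((A \<Otimes> V) \<Otimes> (A \<Otimes> V)) (A \<Otimes> V) (crossed_mult_map K A V R \<sigma>)"
  unfolding crossed_mult_map_def Let_def comp_def by (rule lin | simp)+

lemma linear_map_prod_left:
  "linear_map K X (A \<Otimes> V) h \<Longrightarrow> y \<in> carrier (A \<Otimes> V) \<Longrightarrow> linear_map K X (A \<Otimes> V) (\<lambda>x. prod (h x) y)"
  unfolding prod_def by (rule linear_map_comp[OF _ crossed_mult_map_linear]) (rule lin | simp)+

lemma linear_map_prod_right:
  "linear_map K X (A \<Otimes> V) h \<Longrightarrow> y \<in> carrier (A \<Otimes> V) \<Longrightarrow> linear_map K X (A \<Otimes> V) (\<lambda>x. prod y (h x))"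
  unfolding prod_def by (rule linear_map_comp[OF _ crossed_mult_map_linear]) (rule lin | simp)+

lemmas lin' = lin linear_map_prod_left linear_map_prod_right
  linear_map_comp[OF _ R_ext_linear] linear_map_comp[OF _ \<sigma>_ext_linear]

lemma prod_closed [simp]:
  "x \<in> carrier (A \<Otimes> V) \<Longrightarrow> y \<in> carrier (A \<Otimes> V) \<Longrightarrow> prod x y \<in> carrier (A \<Otimes> V)"
  unfolding prod_def by (rule linear_map_closed[OF crossed_mult_map_linear]) simp

lemma mult_assoc_inv [simp]:
  assumes "a \<in> carrier A" "s \<in> carrier (A \<Otimes> V)"
  shows "tmap K A V (mult_map K A) id (assoc_inv K A A V (ptensor K A (A \<Otimes> V) a s)) = act a s"
proof -
  have "\<forall>s\<in>carrier (A \<Otimes> V).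
      tmap K A V (mult_map K A) id (assoc_inv K A A V (ptensor K A (A \<Otimes> V) a s)) = act a s"
    by (rule tensor_ext) ((rule lin | simp add: assms)+)
  then show ?thesis using assms by blast
qed

lemma R_ext_pure [simp]:
  "a \<in> carrier A \<Longrightarrow> v \<in> carrier V \<Longrightarrow> b \<in> carrier A \<Longrightarrow>
    R_ext (ptensor K (A \<Otimes> V) A (ptensor K A V a v) b) = act a (R (ptensor K V A v b))"
  by (simp add: R_ext_def)

lemma \<sigma>_ext_pure [simp]:
  "a \<in> carrier A \<Longrightarrow> v \<in> carrier V \<Longrightarrow> u \<in> carrier V \<Longrightarrow>
    \<sigma>_ext (ptensor K (A \<Otimes> V) V (ptensor K A V a v) u) = act a (\<sigma> (ptensor K V V v u))"
  by (simp add: \<sigma>_ext_def)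

lemma act_one [simp]:
  assumes "x \<in> carrier (A \<Otimes> V)"
  shows "act \<one>\<^bsub>A\<^esub> x = x"
proof -
  have "\<forall>x\<in>carrier (A \<Otimes> V). act \<one>\<^bsub>A\<^esub> x = x"
    by (rule tensor_ext) ((rule lin | simp)+)
  then show ?thesis using assms by blast
qed

lemma act_act:
  assumes "a \<in> carrier A" "b \<in> carrier A" "x \<in> carrier (A \<Otimes> V)"
  shows "act a (act b x) = act (a \<otimes>\<^bsub>A\<^esub> b) x"
proof -
  have "\<forall>x\<in>carrier (A \<Otimes> V). act a (act b x) = act (a \<otimes>\<^bsub>A\<^esub> b) x"
    by (rule tensor_ext) ((rule lin | simp add: assms A.A.m_assoc)+)
  then show ?thesis using assms by blast
qed

lemma mult2_linear [simp]:
  "linear_map K (A \<Otimes> (A \<Otimes> A)) A (\<lambda>x. mult_map K A (tmap K A A id (mult_map K A) x))"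
  by (rule lin | simp)+

text \<open>\<open>\<mu>\<^sub>2\<close> multiplies its last two arguments and then the first onto
  the result, so its first argument acts from the left on an ordinary product. The element
  \<open>y\<close> is itself nested, hence the two successive reductions to pure tensors.\<close>

lemma mult2_assoc_inv [simp]:
  assumes "a \<in> carrier A" "y \<in> carrier (A \<Otimes> (A \<Otimes> V))"
  shows "tmap K A V (\<lambda>x. mult_map K A (tmap K A A id (mult_map K A) x)) id
      (assoc_inv K A (A \<Otimes> A) V (ptensor K A ((A \<Otimes> A) \<Otimes> V) a (assoc_inv K A A V y)))
    = act a (tmap K A V (mult_map K A) id (assoc_inv K A A V y))"
proof -
  have "\<forall>y\<in>carrier (A \<Otimes> (A \<Otimes> V)). tmap K A V (\<lambda>x. mult_map K A (tmap K A A id (mult_map K A) x)) id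
      (assoc_inv K A (A \<Otimes> A) V (ptensor K A ((A \<Otimes> A) \<Otimes> V) a (assoc_inv K A A V y)))
    = act a (tmap K A V (mult_map K A) id (assoc_inv K A A V y))"
  proof (rule tensor_ext)
    fix b s assume b: "b \<in> carrier A" and s: "s \<in> carrier (A \<Otimes> V)"
    have "\<forall>s\<in>carrier (A \<Otimes> V). tmap K A V (\<lambda>x. mult_map K A (tmap K A A id (mult_map K A) x)) id
      (assoc_inv K A (A \<Otimes> A) V (ptensor K A ((A \<Otimes> A) \<Otimes> V) a (assoc_inv K A A V (ptensor K A (A \<Otimes> V) b s))))
      = act a (tmap K A V (mult_map K A) id (assoc_inv K A A V (ptensor K A (A \<Otimes> V) b s)))"
      by (rule tensor_ext) ((rule lin | simp add: assms b A.A.m_assoc)+)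
    then show "tmap K A V (\<lambda>x. mult_map K A (tmap K A A id (mult_map K A) x)) id
      (assoc_inv K A (A \<Otimes> A) V (ptensor K A ((A \<Otimes> A) \<Otimes> V) a (assoc_inv K A A V (ptensor K A (A \<Otimes> V) b s))))
      = act a (tmap K A V (mult_map K A) id (assoc_inv K A A V (ptensor K A (A \<Otimes> V) b s)))"
      using s by blast
  qed ((rule lin | simp add: assms)+)
  then show ?thesis using assms by blast
qed

lemma prod_pure:
  assumes "a \<in> carrier A" "v \<in> carrier V" "b \<in> carrier A" "u \<in> carrier V"
  shows "prod (ptensor K A V a v) (ptensor K A V b u)
    = act a (\<sigma>_ext (ptensor K (A \<Otimes> V) V (R (ptensor K V A v b)) u))"
proof -
  \<comment> \<open>This membership is the premise under which \<open>mult2_assoc_inv\<close> can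
    rewrite the tail of the multiplication map.\<close>
  have "tmap K A (A \<Otimes> V) id \<sigma> (assoc K A V V (ptensor K (A \<Otimes> V) V (R (ptensor K V A v b)) u))
      \<in> carrier (A \<Otimes> (A \<Otimes> V))"
    by (rule linear_map_closed[of K "(A \<Otimes> V) \<Otimes> V"], (rule lin | simp add: assms)+)
  then show ?thesis
    using assms
    by (simp add: prod_def crossed_mult_map_def Let_def comp_def \<sigma>_ext_def
      linear_map_closed[OF assoc_linear] linear_map_closed[OF assoc_inv_linear])
qed

abbreviation "inc\<^sub>V v \<equiv> ptensor K A V \<one>\<^bsub>A\<^esub> v"
abbreviation "inc\<^sub>A a \<equiv> ptensor K A V a e"

lemma \<sigma>_ext_e [simp]:
  assumes "t \<in> carrier (A \<Otimes> V)"
  shows "\<sigma>_ext (ptensor K (A \<Otimes> V) V t e) = t"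
proof -
  have "\<forall>t\<in>carrier (A \<Otimes> V). \<sigma>_ext (ptensor K (A \<Otimes> V) V t e) = t"
    by (rule tensor_ext) ((rule lin' | simp)+)
  then show ?thesis using assms by blast
qed

lemma prod_incV_right:
  assumes "t \<in> carrier (A \<Otimes> V)" "u \<in> carrier V"
  shows "prod t (inc\<^sub>V u) = \<sigma>_ext (ptensor K (A \<Otimes> V) V t u)"
proof -
  have "\<forall>t\<in>carrier (A \<Otimes> V). prod t (inc\<^sub>V u) = \<sigma>_ext (ptensor K (A \<Otimes> V) V t u)"
    by (rule tensor_ext) ((rule lin' | simp add: prod_pure assms)+)
  then show ?thesis using assms by blast
qed

lemma prod_incA_right:
  assumes "t \<in> carrier (A \<Otimes> V)" "b \<in> carrier A"
  shows "prod t (inc\<^sub>A b) = R_ext (ptensor K (A \<Otimes> V) A t b)"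
proof -
  have "\<forall>t\<in>carrier (A \<Otimes> V). prod t (inc\<^sub>A b) = R_ext (ptensor K (A \<Otimes> V) A t b)"
    by (rule tensor_ext) ((rule lin' | simp add: prod_pure assms)+)
  then show ?thesis using assms by blast
qed

lemma prod_incV_incA:
  "v \<in> carrier V \<Longrightarrow> a \<in> carrier A \<Longrightarrow> prod (inc\<^sub>V v) (inc\<^sub>A a) = R (ptensor K V A v a)"
  by (simp add: prod_pure)

lemma prod_incV_incV:
  "v \<in> carrier V \<Longrightarrow> u \<in> carrier V \<Longrightarrow> prod (inc\<^sub>V v) (inc\<^sub>V u) = \<sigma> (ptensor K V V v u)"
  by (simp add: prod_pure)

text \<open>Left \<open>A\<close>-linearity is built into the formula, where the first
  \<open>A\<close>-entry is merely multiplied on from the left; only associativity of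
  \<open>A\<close> enters.\<close>

lemma prod_act:
  assumes "a \<in> carrier A" "x \<in> carrier (A \<Otimes> V)" "y \<in> carrier (A \<Otimes> V)"
  shows "prod (act a x) y = act a (prod x y)"
proof -
  have "\<forall>x\<in>carrier (A \<Otimes> V). prod (act a x) y = act a (prod x y)"
  proof (rule tensor_ext)
    fix b v assume bv: "b \<in> carrier A" "v \<in> carrier V"
    have "\<forall>y\<in>carrier (A \<Otimes> V). prod (act a (ptensor K A V b v)) y = act a (prod (ptensor K A V b v) y)"
      by (rule tensor_ext)
        ((rule lin' | simp add: prod_pure assms bv act_act linear_map_closed[OF \<sigma>_ext_linear])+)
    then show "prod (act a (ptensor K A V b v)) y = act a (prod (ptensor K A V b v) y)"
      using assms by blast
  qed ((rule lin' | simp add: assms)+)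
  then show ?thesis using assms by blast
qed

lemma prod_incA_left:
  assumes "a \<in> carrier A" "x \<in> carrier (A \<Otimes> V)"
  shows "prod (inc\<^sub>A a) x = act a x"
proof -
  have "\<forall>x\<in>carrier (A \<Otimes> V). prod (inc\<^sub>A a) x = act a x"
    by (rule tensor_ext) ((rule lin' | simp add: prod_pure assms)+)
  then show ?thesis using assms by blast
qed

lemma prod_one_right: "x \<in> carrier (A \<Otimes> V) \<Longrightarrow> prod x (inc\<^sub>A \<one>\<^bsub>A\<^esub>) = x"
  by (simp add: prod_incV_right)

lemma R_ext_R:
  assumes "v \<in> carrier V" "a \<in> carrier A" "b \<in> carrier A"
  shows "R_ext (ptensor K (A \<Otimes> V) A (R (ptensor K V A v a)) b)
    = prod (prod (inc\<^sub>V v) (inc\<^sub>A a)) (inc\<^sub>A b)"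
  using assms by (simp add: prod_incV_incA prod_incA_right)

text \<open>The left-hand composites of the last two axioms have this form, with \<open>t\<close> a
  value of \<open>\<sigma>\<close> or of \<open>R\<close>. They are thereby recognized as left
  multiplication by \<open>inc\<^sub>V v\<close>.\<close>

lemma prod_incV_left:
  assumes "v \<in> carrier V" "t \<in> carrier (A \<Otimes> V)"
  shows "\<sigma>_ext (tmap K (A \<Otimes> V) V R id (assoc_inv K V A V (ptensor K V (A \<Otimes> V) v t)))
    = prod (inc\<^sub>V v) t"
proof -
  have "\<forall>t\<in>carrier (A \<Otimes> V). \<sigma>_ext (tmap K (A \<Otimes> V) V R id (assoc_inv K V A V (ptensor K V (A \<Otimes> V) v t)))
    = prod (inc\<^sub>V v) t"
    by (rule tensor_ext)
      ((rule lin' | simp add: prod_pure assms linear_map_closed[OF \<sigma>_ext_linear])+)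
  then show ?thesis using assms by blast
qed

lemmas R_ext_closed [simp] = linear_map_closed[OF R_ext_linear]
lemmas \<sigma>_ext_closed [simp] = linear_map_closed[OF \<sigma>_ext_linear]

text \<open>The three axioms at a pure tensor, rewritten as associativity for the triples
  \<open>(v, a, b)\<close>, \<open>(v, v', u)\<close> and \<open>(v, v', a)\<close>. In the first,
  the product of \<open>inc\<^sub>A a\<close> and \<open>inc\<^sub>A b\<close> is already
  evaluated.\<close>

definition "R_mult_at v a b \<longleftrightarrow>
  prod (prod (inc\<^sub>V v) (inc\<^sub>A a)) (inc\<^sub>A b) = prod (inc\<^sub>V v) (inc\<^sub>A (a \<otimes>\<^bsub>A\<^esub> b))"
definition "cocycle_at v v' u \<longleftrightarrow>
  prod (inc\<^sub>V v) (prod (inc\<^sub>V v') (inc\<^sub>V u)) = prod (prod (inc\<^sub>V v) (inc\<^sub>V v')) (inc\<^sub>V u)"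
definition "twisted_at v v' a \<longleftrightarrow>
  prod (inc\<^sub>V v) (prod (inc\<^sub>V v') (inc\<^sub>A a)) = prod (prod (inc\<^sub>V v) (inc\<^sub>V v')) (inc\<^sub>A a)"

lemma R_mult_pure:
  assumes "v \<in> carrier V" "a \<in> carrier A" "b \<in> carrier A"
  shows "(R \<circ> tmap K V A id (mult_map K A)) (ptensor K V (A \<Otimes> A) v (ptensor K A A a b)) =
      (tmap K A V (mult_map K A) id \<circ> assoc_inv K A A V
        \<circ> tmap K A (A \<Otimes> V) id R \<circ> assoc K A V A
        \<circ> tmap K (A \<Otimes> V) A R id \<circ> assoc_inv K V A A) (ptensor K V (A \<Otimes> A) v (ptensor K A A a b))
    \<longleftrightarrow> R_mult_at v a b"
  using assms R_ext_R[OF assms]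
  by (auto simp: R_mult_at_def prod_incV_incA R_ext_def)

lemma cocycle_pure:
  assumes "v \<in> carrier V" "v' \<in> carrier V" "u \<in> carrier V"
  shows "(tmap K A V (mult_map K A) id \<circ> assoc_inv K A A V
        \<circ> tmap K A (A \<Otimes> V) id \<sigma> \<circ> assoc K A V V
        \<circ> tmap K (A \<Otimes> V) V R id \<circ> assoc_inv K V A V
        \<circ> tmap K V (A \<Otimes> V) id \<sigma>) (ptensor K V (V \<Otimes> V) v (ptensor K V V v' u)) =
      (tmap K A V (mult_map K A) id \<circ> assoc_inv K A A V
        \<circ> tmap K A (A \<Otimes> V) id \<sigma> \<circ> assoc K A V V
        \<circ> tmap K (A \<Otimes> V) V \<sigma> id \<circ> assoc_inv K V V V) (ptensor K V (V \<Otimes> V) v (ptensor K V V v' u))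
    \<longleftrightarrow> cocycle_at v v' u"
  using assms prod_incV_left[of v "\<sigma> (ptensor K V V v' u)"] prod_incV_right[of "\<sigma> (ptensor K V V v v')" u]
  by (auto simp: cocycle_at_def prod_incV_incV \<sigma>_ext_def)

lemma twisted_pure:
  assumes "v \<in> carrier V" "v' \<in> carrier V" "a \<in> carrier A"
  shows "(tmap K A V (mult_map K A) id \<circ> assoc_inv K A A V
        \<circ> tmap K A (A \<Otimes> V) id \<sigma> \<circ> assoc K A V V
        \<circ> tmap K (A \<Otimes> V) V R id \<circ> assoc_inv K V A V
        \<circ> tmap K V (A \<Otimes> V) id R) (ptensor K V (V \<Otimes> A) v (ptensor K V A v' a)) =
      (tmap K A V (mult_map K A) id \<circ> assoc_inv K A A V
        \<circ> tmap K A (A \<Otimes> V) id R \<circ> assoc K A V A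
        \<circ> tmap K (A \<Otimes> V) A \<sigma> id \<circ> assoc_inv K V V A) (ptensor K V (V \<Otimes> A) v (ptensor K V A v' a))
    \<longleftrightarrow> twisted_at v v' a"
  using assms prod_incV_left[of v "R (ptensor K V A v' a)"] prod_incA_right[of "\<sigma> (ptensor K V V v v')" a]
  by (auto simp: twisted_at_def prod_incV_incV prod_incV_incA \<sigma>_ext_def R_ext_def)

lemma crossed_product_iff:
  "crossed_product K A V e R \<sigma> \<longleftrightarrow>
    (\<forall>v\<in>carrier V. \<forall>a\<in>carrier A. \<forall>b\<in>carrier A. R_mult_at v a b) \<and>
    (\<forall>v\<in>carrier V. \<forall>v'\<in>carrier V. \<forall>u\<in>carrier V. cocycle_at v v' u) \<and>
    (\<forall>v\<in>carrier V. \<forall>v'\<in>carrier V. \<forall>a\<in>carrier A. twisted_at v v' a)"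
proof
  assume "crossed_product K A V e R \<sigma>"
  then interpret crossed_product K A V e R \<sigma> .
  show "(\<forall>v\<in>carrier V. \<forall>a\<in>carrier A. \<forall>b\<in>carrier A. R_mult_at v a b) \<and>
    (\<forall>v\<in>carrier V. \<forall>v'\<in>carrier V. \<forall>u\<in>carrier V. cocycle_at v v' u) \<and>
    (\<forall>v\<in>carrier V. \<forall>v'\<in>carrier V. \<forall>a\<in>carrier A. twisted_at v v' a)"
    \<comment> \<open>The axioms are stated with \<open>\<circ>\<close>; keeping
      \<open>comp_apply\<close> away preserves that form so that they match.\<close>
    by (auto simp: R_mult_pure[symmetric] cocycle_pure[symmetric] twisted_pure[symmetric]
      simp del: comp_apply intro!: R_mult cocycle twisted_module)
next
  assume *: "(\<forall>v\<in>carrier V. \<forall>a\<in>carrier A. \<forall>b\<in>carrier A. R_mult_at v a b) \<and>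
    (\<forall>v\<in>carrier V. \<forall>v'\<in>carrier V. \<forall>u\<in>carrier V. cocycle_at v v' u) \<and>
    (\<forall>v\<in>carrier V. \<forall>v'\<in>carrier V. \<forall>a\<in>carrier A. twisted_at v v' a)"
  show "crossed_product K A V e R \<sigma>"
  proof (rule crossed_product.intro[OF A.unital_algebra_axioms V.vectorspace_axioms],
      rule crossed_product_axioms.intro, goal_cases)
    case (8 x)
    show ?case
      \<comment> \<open>Subgoal 6 is the agreement on pure tensors. It is resolved before
        \<open>comp_def\<close> is unfolded, because \<open>R_mult_pure\<close> speaks of
        composites; what remains is linearity.\<close>
      by (rule tensor3_ext[OF _ _ _ _ _ _ 8], rule_tac [6] R_mult_pure[THEN iffD2], unfold comp_def)
         ((rule lin | simp add: * )+)
  next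
    case (9 x)
    show ?case
      by (rule tensor3_ext[OF _ _ _ _ _ _ 9], rule_tac [6] cocycle_pure[THEN iffD2], unfold comp_def)
         ((rule lin | simp add: * )+)
  next
    case (10 x)
    show ?case
      by (rule tensor3_ext[OF _ _ _ _ _ _ 10], rule_tac [6] twisted_pure[THEN iffD2], unfold comp_def)
         ((rule lin | simp add: * )+)
  qed simp_all
qed

lemma prod_assoc:
  assumes "crossed_product K A V e R \<sigma>"
    and "x \<in> carrier (A \<Otimes> V)" "y \<in> carrier (A \<Otimes> V)" "z \<in> carrier (A \<Otimes> V)"
  shows "prod (prod x y) z = prod x (prod y z)"
proof -
  interpret T: vectorspace K "A \<Otimes> V" by simp
  interpret spanning_product "carrier (A \<Otimes> V)" "carrier A" "carrier V" "add (A \<Otimes> V)" prod act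
    "mult A" "ptensor K A V \<one>\<^bsub>A\<^esub>" e
  proof (unfold_locales, goal_cases)
    \<comment> \<open>This is the obligation \<open>span\<close>: a pure tensor of \<open>a\<close>
      and \<open>v\<close> is \<open>act a\<close> applied to \<open>inc\<^sub>V v\<close>.\<close>
    case (12 x P)
    show ?case
    proof (rule tensor_induct[OF spaces 12(1)])
      show "P (ptensor K A V a v)" if "a \<in> carrier A" "v \<in> carrier V" for a v
        using 12(2)[OF that] that by simp
    qed (rule 12(3))
  \<comment> \<open>\<open>m_j_act\<close> holds by the form of the product; the three obligations
    after it are the crossed product axioms.\<close>
  qed (use assms(1) in \<open>simp_all add: crossed_product_iff R_mult_at_def cocycle_at_def twisted_at_def
     act_act prod_act prod_incV_right prod_pure
     linear_map_add[OF linear_map_prod_left[OF linear_map_id(1)]]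
     linear_map_add[OF linear_map_prod_right[OF linear_map_id(1)]] linear_map_add[OF act_linear]\<close>)
  show ?thesis using assms(2-4) by (rule m_assoc)
qed

lemma crossed_productI:
  assumes "\<And>x y z. \<lbrakk>x \<in> carrier (A \<Otimes> V); y \<in> carrier (A \<Otimes> V); z \<in> carrier (A \<Otimes> V)\<rbrakk> \<Longrightarrow>
    prod (prod x y) z = prod x (prod y z)"
  shows "crossed_product K A V e R \<sigma>"
  by (simp add: crossed_product_iff R_mult_at_def cocycle_at_def twisted_at_def assms prod_incA_left)

section \<open>The crossed product as an algebra record\<close>

lemma crossed_alg_simps [simp]:
  "carrier (crossed_alg K A V e R \<sigma>) = carrier (A \<Otimes> V)"
  "zero (crossed_alg K A V e R \<sigma>) = zero (A \<Otimes> V)"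
  "add (crossed_alg K A V e R \<sigma>) = add (A \<Otimes> V)"
  "smult (crossed_alg K A V e R \<sigma>) = smult (A \<Otimes> V)"
  "mult (crossed_alg K A V e R \<sigma>) = prod"
  "one (crossed_alg K A V e R \<sigma>) = ptensor K A V \<one>\<^bsub>A\<^esub> e"
  by (simp_all add: crossed_alg_def prod_def fun_eq_iff)

lemma crossed_alg_linear:
  "linear_map K X (crossed_alg K A V e R \<sigma>) f \<longleftrightarrow> linear_map K X (A \<Otimes> V) f"
  "linear_map K (crossed_alg K A V e R \<sigma>) Y g \<longleftrightarrow> linear_map K (A \<Otimes> V) Y g"
  by (rule linear_map_space_cong; simp)+

lemma crossed_alg_algebra:
  assumes "crossed_product K A V e R \<sigma>"
  shows "unital_algebra K (crossed_alg K A V e R \<sigma>)"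
proof (rule unital_algebraI, goal_cases)
  case 1 show ?case by (rule vectorspace_cong[of K "A \<Otimes> V"]) simp_all
next
  case (7 x) then show ?case by (simp add: prod_incA_left)
qed (use assms in \<open>simp_all add: crossed_alg_linear linear_map_prod_left linear_map_prod_right
    prod_assoc prod_one_right\<close>)

end

section \<open>Mirror crossed products\<close>

text \<open>The counterpart of \<open>crossed_data\<close> with all sides exchanged: the algebra
  factor stands on the right, the product is linear for its right action, and the axioms concern
  left multiplications.\<close>

locale mirror_data = W: vectorspace K W + B: unital_algebra K B
  for K :: "('k, 'm) ring_scheme" (structure)
    and W :: "('k, 'w, 'm1) module_scheme"
    and B :: "('k, 'b, 'm2) module_scheme" +
  fixes e :: 'w
    and P :: "('b \<times> 'w \<Rightarrow> 'k) set \<Rightarrow> ('w \<times> 'b \<Rightarrow> 'k) set"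
    and \<nu> :: "('w \<times> 'w \<Rightarrow> 'k) set \<Rightarrow> ('w \<times> 'b \<Rightarrow> 'k) set"
  assumes e_closed [simp]: "e \<in> carrier W"
    and P_linear [simp]: "linear_map K (B \<Otimes> W) (W \<Otimes> B) P"
    and \<nu>_linear [simp]: "linear_map K (W \<Otimes> W) (W \<Otimes> B) \<nu>"
    and P_e [simp]: "b \<in> carrier B \<Longrightarrow> P (ptensor K B W b e) = ptensor K W B e b"
    and P_one [simp]: "w \<in> carrier W \<Longrightarrow> P (ptensor K B W \<one>\<^bsub>B\<^esub> w) = ptensor K W B w \<one>\<^bsub>B\<^esub>"
    and \<nu>_e_right [simp]: "w \<in> carrier W \<Longrightarrow> \<nu> (ptensor K W W w e) = ptensor K W B w \<one>\<^bsub>B\<^esub>"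
    and \<nu>_e_left [simp]: "w \<in> carrier W \<Longrightarrow> \<nu> (ptensor K W W e w) = ptensor K W B w \<one>\<^bsub>B\<^esub>"
begin

lemma spaces [simp]: "vectorspace K W" "vectorspace K B"
  by (rule W.vectorspace_axioms B.vectorspace_axioms)+

lemmas P_closed [simp] = linear_map_closed[OF P_linear]
lemmas \<nu>_closed [simp] = linear_map_closed[OF \<nu>_linear]

definition act where "act b = tmap K W B id (\<lambda>c. c \<otimes>\<^bsub>B\<^esub> b)"

lemma mult_linear [simp]: "b \<in> carrier B \<Longrightarrow> linear_map K B B (\<lambda>c. c \<otimes>\<^bsub>B\<^esub> b)"
  by (rule B.linear_map_mult_left) simp_all

lemma act_linear [simp]: "b \<in> carrier B \<Longrightarrow> linear_map K (W \<Otimes> B) (W \<Otimes> B) (act b)"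
  by (simp add: act_def)

lemmas act_closed [simp] = linear_map_closed[OF act_linear]

lemma act_pure [simp]:
  "w \<in> carrier W \<Longrightarrow> c \<in> carrier B \<Longrightarrow> b \<in> carrier B \<Longrightarrow>
    act b (ptensor K W B w c) = ptensor K W B w (c \<otimes>\<^bsub>B\<^esub> b)"
  by (simp add: act_def)

definition prod where
  "prod x y = mirror_crossed_mult_map K W B P \<nu> (ptensor K (W \<Otimes> B) (W \<Otimes> B) x y)"

text \<open>As in the crossed case, these tails of the axioms are one-sided multiplications:
  \<open>P_ext\<close> is left multiplication by \<open>inc\<^sub>B b\<close>, and
  \<open>\<nu>_ext\<close> by \<open>inc\<^sub>W w\<close>.\<close>

definition P_ext where
  "P_ext = tmap K W B id (mult_map K B) \<circ> assoc K W B B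
        \<circ> tmap K (W \<Otimes> B) B P id \<circ> assoc_inv K B W B"

definition \<nu>_ext where
  "\<nu>_ext = tmap K W B id (mult_map K B) \<circ> assoc K W B B
        \<circ> tmap K (W \<Otimes> B) B \<nu> id \<circ> assoc_inv K W W B"

lemmas lin = linear_intros linear_map_comp[OF _ P_linear] linear_map_comp[OF _ \<nu>_linear]
  linear_map_comp[OF _ B.mult_map_linear] linear_map_comp[OF _ act_linear] linear_map_id

lemma P_ext_linear [simp]: "linear_map K (B \<Otimes> (W \<Otimes> B)) (W \<Otimes> B) P_ext"
  unfolding P_ext_def comp_def by (rule lin | simp)+

lemma \<nu>_ext_linear [simp]: "linear_map K (W \<Otimes> (W \<Otimes> B)) (W \<Otimes> B) \<nu>_ext"
  unfolding \<nu>_ext_def comp_def by (rule lin | simp)+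

lemmas P_ext_closed [simp] = linear_map_closed[OF P_ext_linear]
lemmas \<nu>_ext_closed [simp] = linear_map_closed[OF \<nu>_ext_linear]

lemma mirror_mult_map_linear [simp]:
  "linear_map K ((W \<Otimes> B) \<Otimes> (W \<Otimes> B)) (W \<Otimes> B) (mirror_crossed_mult_map K W B P \<nu>)"
  unfolding mirror_crossed_mult_map_def Let_def comp_def by (rule lin | simp)+

lemma linear_map_prod_left:
  "linear_map K X (W \<Otimes> B) h \<Longrightarrow> y \<in> carrier (W \<Otimes> B) \<Longrightarrow> linear_map K X (W \<Otimes> B) (\<lambda>x. prod (h x) y)"
  unfolding prod_def by (rule linear_map_comp[OF _ mirror_mult_map_linear]) (rule lin | simp)+

lemma linear_map_prod_right:
  "linear_map K X (W \<Otimes> B) h \<Longrightarrow> y \<in> carrier (W \<Otimes> B) \<Longrightarrow> linear_map K X (W \<Otimes> B) (\<lambda>x. prod y (h x))"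
  unfolding prod_def by (rule linear_map_comp[OF _ mirror_mult_map_linear]) (rule lin | simp)+

lemmas lin' = lin linear_map_prod_left linear_map_prod_right
  linear_map_comp[OF _ P_ext_linear] linear_map_comp[OF _ \<nu>_ext_linear]

lemma prod_closed [simp]:
  "x \<in> carrier (W \<Otimes> B) \<Longrightarrow> y \<in> carrier (W \<Otimes> B) \<Longrightarrow> prod x y \<in> carrier (W \<Otimes> B)"
  unfolding prod_def by (rule linear_map_closed[OF mirror_mult_map_linear]) simp

lemma mult_assoc [simp]:
  assumes "b \<in> carrier B" "t \<in> carrier (W \<Otimes> B)"
  shows "tmap K W B id (mult_map K B) (assoc K W B B (ptensor K (W \<Otimes> B) B t b)) = act b t"
proof -
  have "\<forall>t\<in>carrier (W \<Otimes> B).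
      tmap K W B id (mult_map K B) (assoc K W B B (ptensor K (W \<Otimes> B) B t b)) = act b t"
    by (rule tensor_ext) ((rule lin | simp add: assms)+)
  then show ?thesis using assms by blast
qed

lemma P_ext_pure [simp]:
  "w \<in> carrier W \<Longrightarrow> b \<in> carrier B \<Longrightarrow> c \<in> carrier B \<Longrightarrow>
    P_ext (ptensor K B (W \<Otimes> B) c (ptensor K W B w b)) = act b (P (ptensor K B W c w))"
  by (simp add: P_ext_def)

lemma \<nu>_ext_pure [simp]:
  "w \<in> carrier W \<Longrightarrow> b \<in> carrier B \<Longrightarrow> u \<in> carrier W \<Longrightarrow>
    \<nu>_ext (ptensor K W (W \<Otimes> B) u (ptensor K W B w b)) = act b (\<nu> (ptensor K W W u w))"
  by (simp add: \<nu>_ext_def)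

lemma act_one [simp]:
  assumes "x \<in> carrier (W \<Otimes> B)"
  shows "act \<one>\<^bsub>B\<^esub> x = x"
proof -
  have "\<forall>x\<in>carrier (W \<Otimes> B). act \<one>\<^bsub>B\<^esub> x = x"
    by (rule tensor_ext) ((rule lin | simp)+)
  then show ?thesis using assms by blast
qed

text \<open>\<open>act\<close> is a right action, so the element applied last becomes the right
  factor.\<close>

lemma act_act:
  assumes "b \<in> carrier B" "c \<in> carrier B" "x \<in> carrier (W \<Otimes> B)"
  shows "act c (act b x) = act (b \<otimes>\<^bsub>B\<^esub> c) x"
proof -
  have "\<forall>x\<in>carrier (W \<Otimes> B). act c (act b x) = act (b \<otimes>\<^bsub>B\<^esub> c) x"
    by (rule tensor_ext) ((rule lin | simp add: assms B.A.m_assoc)+)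
  then show ?thesis using assms by blast
qed

lemma mult2_linear [simp]:
  "linear_map K (B \<Otimes> (B \<Otimes> B)) B (\<lambda>x. mult_map K B (tmap K B B id (mult_map K B) x))"
  by (rule lin | simp)+

text \<open>\<open>\<mu>\<^sub>2\<close> groups its arguments to the right, while two successive
  right multiplications group them to the left. The two agree by associativity of
  \<open>B\<close>.\<close>

lemma mult2_assoc [simp]:
  assumes "b \<in> carrier B" "c \<in> carrier B" "t \<in> carrier (W \<Otimes> B)"
  shows "tmap K W B id (\<lambda>x. mult_map K B (tmap K B B id (mult_map K B) x))
      (assoc K W B (B \<Otimes> B) (ptensor K (W \<Otimes> B) (B \<Otimes> B) t (ptensor K B B b c)))
    = act c (act b t)"
proof -
  have "\<forall>t\<in>carrier (W \<Otimes> B). tmap K W B id (\<lambda>x. mult_map K B (tmap K B B id (mult_map K B) x))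
      (assoc K W B (B \<Otimes> B) (ptensor K (W \<Otimes> B) (B \<Otimes> B) t (ptensor K B B b c)))
    = act c (act b t)"
    by (rule tensor_ext) ((rule lin | simp add: assms B.A.m_assoc)+)
  then show ?thesis using assms by blast
qed

lemma mult2_\<nu>:
  assumes "w \<in> carrier W" "b \<in> carrier B" "s \<in> carrier (W \<Otimes> B)"
  shows "tmap K W B id (\<lambda>x. mult_map K B (tmap K B B id (mult_map K B) x))
      (assoc K W B (B \<Otimes> B) (tmap K (W \<Otimes> B) (B \<Otimes> B) \<nu> id (assoc_inv K W W (B \<Otimes> B)
        (ptensor K W (W \<Otimes> (B \<Otimes> B)) w (assoc K W B B (ptensor K (W \<Otimes> B) B s b))))))
    = act b (\<nu>_ext (ptensor K W (W \<Otimes> B) w s))"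
proof -
  have "\<forall>s\<in>carrier (W \<Otimes> B). tmap K W B id (\<lambda>x. mult_map K B (tmap K B B id (mult_map K B) x))
      (assoc K W B (B \<Otimes> B) (tmap K (W \<Otimes> B) (B \<Otimes> B) \<nu> id (assoc_inv K W W (B \<Otimes> B)
        (ptensor K W (W \<Otimes> (B \<Otimes> B)) w (assoc K W B B (ptensor K (W \<Otimes> B) B s b))))))
    = act b (\<nu>_ext (ptensor K W (W \<Otimes> B) w s))"
    by (rule tensor_ext) ((rule lin' | simp add: assms)+)
  then show ?thesis using assms by blast
qed

lemma prod_pure:
  assumes "w \<in> carrier W" "b \<in> carrier B" "u \<in> carrier W" "c \<in> carrier B"
  shows "prod (ptensor K W B w b) (ptensor K W B u c)
    = act c (\<nu>_ext (ptensor K W (W \<Otimes> B) w (P (ptensor K B W b u))))"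
  using assms
  by (simp add: prod_def mirror_crossed_mult_map_def Let_def comp_def mult2_\<nu>
      linear_map_closed[OF assoc_linear] linear_map_closed[OF assoc_inv_linear])

abbreviation "inc\<^sub>W w \<equiv> ptensor K W B w \<one>\<^bsub>B\<^esub>"
abbreviation "inc\<^sub>B b \<equiv> ptensor K W B e b"

lemma \<nu>_ext_e [simp]:
  assumes "t \<in> carrier (W \<Otimes> B)"
  shows "\<nu>_ext (ptensor K W (W \<Otimes> B) e t) = t"
proof -
  have "\<forall>t\<in>carrier (W \<Otimes> B). \<nu>_ext (ptensor K W (W \<Otimes> B) e t) = t"
    by (rule tensor_ext) ((rule lin' | simp)+)
  then show ?thesis using assms by blast
qed

lemma prod_incW_left:
  assumes "w \<in> carrier W" "t \<in> carrier (W \<Otimes> B)"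
  shows "prod (inc\<^sub>W w) t = \<nu>_ext (ptensor K W (W \<Otimes> B) w t)"
proof -
  have "\<forall>t\<in>carrier (W \<Otimes> B). prod (inc\<^sub>W w) t = \<nu>_ext (ptensor K W (W \<Otimes> B) w t)"
    by (rule tensor_ext) ((rule lin' | simp add: prod_pure assms)+)
  then show ?thesis using assms by blast
qed

lemma prod_incB_left:
  assumes "b \<in> carrier B" "t \<in> carrier (W \<Otimes> B)"
  shows "prod (inc\<^sub>B b) t = P_ext (ptensor K B (W \<Otimes> B) b t)"
proof -
  have "\<forall>t\<in>carrier (W \<Otimes> B). prod (inc\<^sub>B b) t = P_ext (ptensor K B (W \<Otimes> B) b t)"
    by (rule tensor_ext) ((rule lin' | simp add: prod_pure assms)+)
  then show ?thesis using assms by blast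
qed

lemma prod_incB_incW:
  "b \<in> carrier B \<Longrightarrow> w \<in> carrier W \<Longrightarrow> prod (inc\<^sub>B b) (inc\<^sub>W w) = P (ptensor K B W b w)"
  by (simp add: prod_pure)

lemma prod_incW_incW:
  "w \<in> carrier W \<Longrightarrow> u \<in> carrier W \<Longrightarrow> prod (inc\<^sub>W w) (inc\<^sub>W u) = \<nu> (ptensor K W W w u)"
  by (simp add: prod_pure)

text \<open>Right \<open>B\<close>-linearity, again from the form of the multiplication: the last
  entry of the second factor is only multiplied on from the right.\<close>

lemma prod_act:
  assumes "b \<in> carrier B" "x \<in> carrier (W \<Otimes> B)" "y \<in> carrier (W \<Otimes> B)"
  shows "prod x (act b y) = act b (prod x y)"
proof -
  have "\<forall>y\<in>carrier (W \<Otimes> B). prod x (act b y) = act b (prod x y)"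
  proof (rule tensor_ext)
    fix w c assume wc: "w \<in> carrier W" "c \<in> carrier B"
    have "\<forall>x\<in>carrier (W \<Otimes> B). prod x (act b (ptensor K W B w c)) = act b (prod x (ptensor K W B w c))"
      by (rule tensor_ext) ((rule lin' | simp add: prod_pure assms wc act_act)+)
    then show "prod x (act b (ptensor K W B w c)) = act b (prod x (ptensor K W B w c))"
      using assms by blast
  qed ((rule lin' | simp add: assms)+)
  then show ?thesis using assms by blast
qed

lemma prod_incB_right:
  assumes "b \<in> carrier B" "x \<in> carrier (W \<Otimes> B)"
  shows "prod x (inc\<^sub>B b) = act b x"
proof -
  have "\<forall>x\<in>carrier (W \<Otimes> B). prod x (inc\<^sub>B b) = act b x"
    by (rule tensor_ext) ((rule lin' | simp add: prod_pure assms)+)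
  then show ?thesis using assms by blast
qed

lemma prod_one_left: "x \<in> carrier (W \<Otimes> B) \<Longrightarrow> prod (inc\<^sub>W e) x = x"
  by (simp add: prod_incW_left)

lemma prod_incW_right:
  assumes "w \<in> carrier W" "t \<in> carrier (W \<Otimes> B)"
  shows "\<nu>_ext (tmap K W (W \<Otimes> B) id P (assoc K W B W (ptensor K (W \<Otimes> B) W t w)))
    = prod t (inc\<^sub>W w)"
proof -
  have "\<forall>t\<in>carrier (W \<Otimes> B). \<nu>_ext (tmap K W (W \<Otimes> B) id P (assoc K W B W (ptensor K (W \<Otimes> B) W t w)))
    = prod t (inc\<^sub>W w)"
    by (rule tensor_ext) ((rule lin' | simp add: prod_pure assms)+)
  then show ?thesis using assms by blast
qed

definition "P_mult_at b c w \<longleftrightarrow>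
  prod (inc\<^sub>B b) (prod (inc\<^sub>B c) (inc\<^sub>W w)) = prod (inc\<^sub>B (b \<otimes>\<^bsub>B\<^esub> c)) (inc\<^sub>W w)"
definition "cocycle_at w w' u \<longleftrightarrow>
  prod (prod (inc\<^sub>W w) (inc\<^sub>W w')) (inc\<^sub>W u) = prod (inc\<^sub>W w) (prod (inc\<^sub>W w') (inc\<^sub>W u))"
definition "twisted_at b w w' \<longleftrightarrow>
  prod (prod (inc\<^sub>B b) (inc\<^sub>W w)) (inc\<^sub>W w') = prod (inc\<^sub>B b) (prod (inc\<^sub>W w) (inc\<^sub>W w'))"

lemma P_mult_pure:
  assumes "b \<in> carrier B" "c \<in> carrier B" "w \<in> carrier W"
  shows "(P \<circ> tmap K B W (mult_map K B) id) (ptensor K (B \<Otimes> B) W (ptensor K B B b c) w) =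
      (tmap K W B id (mult_map K B) \<circ> assoc K W B B
        \<circ> tmap K (W \<Otimes> B) B P id \<circ> assoc_inv K B W B
        \<circ> tmap K B (W \<Otimes> B) id P \<circ> assoc K B B W) (ptensor K (B \<Otimes> B) W (ptensor K B B b c) w)
    \<longleftrightarrow> P_mult_at b c w"
  using assms prod_incB_left[of b "P (ptensor K B W c w)"]
  by (auto simp: P_mult_at_def prod_incB_incW P_ext_def)

lemma cocycle_pure:
  assumes "w \<in> carrier W" "w' \<in> carrier W" "u \<in> carrier W"
  shows "(tmap K W B id (mult_map K B) \<circ> assoc K W B B
        \<circ> tmap K (W \<Otimes> B) B \<nu> id \<circ> assoc_inv K W W B
        \<circ> tmap K W (W \<Otimes> B) id P \<circ> assoc K W B W
        \<circ> tmap K (W \<Otimes> B) W \<nu> id) (ptensor K (W \<Otimes> W) W (ptensor K W W w w') u) =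
      (tmap K W B id (mult_map K B) \<circ> assoc K W B B
        \<circ> tmap K (W \<Otimes> B) B \<nu> id \<circ> assoc_inv K W W B
        \<circ> tmap K W (W \<Otimes> B) id \<nu> \<circ> assoc K W W W) (ptensor K (W \<Otimes> W) W (ptensor K W W w w') u)
    \<longleftrightarrow> cocycle_at w w' u"
  using assms prod_incW_right[of u "\<nu> (ptensor K W W w w')"] prod_incW_left[of w "\<nu> (ptensor K W W w' u)"]
  by (auto simp: cocycle_at_def prod_incW_incW \<nu>_ext_def)

lemma twisted_pure:
  assumes "b \<in> carrier B" "w \<in> carrier W" "w' \<in> carrier W"
  shows "(tmap K W B id (mult_map K B) \<circ> assoc K W B B
        \<circ> tmap K (W \<Otimes> B) B \<nu> id \<circ> assoc_inv K W W B
        \<circ> tmap K W (W \<Otimes> B) id P \<circ> assoc K W B W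
        \<circ> tmap K (W \<Otimes> B) W P id) (ptensor K (B \<Otimes> W) W (ptensor K B W b w) w') =
      (tmap K W B id (mult_map K B) \<circ> assoc K W B B
        \<circ> tmap K (W \<Otimes> B) B P id \<circ> assoc_inv K B W B
        \<circ> tmap K B (W \<Otimes> B) id \<nu> \<circ> assoc K B W W) (ptensor K (B \<Otimes> W) W (ptensor K B W b w) w')
    \<longleftrightarrow> twisted_at b w w'"
  using assms prod_incW_right[of w' "P (ptensor K B W b w)"] prod_incB_left[of b "\<nu> (ptensor K W W w w')"]
  by (auto simp: twisted_at_def prod_incW_incW prod_incB_incW \<nu>_ext_def P_ext_def)

lemma mirror_crossed_product_iff:
  "mirror_crossed_product K W B e P \<nu> \<longleftrightarrow>
    (\<forall>b\<in>carrier B. \<forall>c\<in>carrier B. \<forall>w\<in>carrier W. P_mult_at b c w) \<and>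
    (\<forall>w\<in>carrier W. \<forall>w'\<in>carrier W. \<forall>u\<in>carrier W. cocycle_at w w' u) \<and>
    (\<forall>b\<in>carrier B. \<forall>w\<in>carrier W. \<forall>w'\<in>carrier W. twisted_at b w w')"
proof
  assume "mirror_crossed_product K W B e P \<nu>"
  then interpret mirror_crossed_product K W B e P \<nu> .
  show "(\<forall>b\<in>carrier B. \<forall>c\<in>carrier B. \<forall>w\<in>carrier W. P_mult_at b c w) \<and>
    (\<forall>w\<in>carrier W. \<forall>w'\<in>carrier W. \<forall>u\<in>carrier W. cocycle_at w w' u) \<and>
    (\<forall>b\<in>carrier B. \<forall>w\<in>carrier W. \<forall>w'\<in>carrier W. twisted_at b w w')"
    by (auto simp: P_mult_pure[symmetric] cocycle_pure[symmetric] twisted_pure[symmetric]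
      simp del: comp_apply intro!: P_mult cocycle twisted_module)
next
  assume *: "(\<forall>b\<in>carrier B. \<forall>c\<in>carrier B. \<forall>w\<in>carrier W. P_mult_at b c w) \<and>
    (\<forall>w\<in>carrier W. \<forall>w'\<in>carrier W. \<forall>u\<in>carrier W. cocycle_at w w' u) \<and>
    (\<forall>b\<in>carrier B. \<forall>w\<in>carrier W. \<forall>w'\<in>carrier W. twisted_at b w w')"
  show "mirror_crossed_product K W B e P \<nu>"
  proof (rule mirror_crossed_product.intro[OF W.vectorspace_axioms B.unital_algebra_axioms],
      rule mirror_crossed_product_axioms.intro, goal_cases)
    case (8 x)
    show ?case
      by (rule tensor3_ext_left[OF _ _ _ _ _ _ 8], rule_tac [6] P_mult_pure[THEN iffD2], unfold comp_def)
         ((rule lin | simp add: * )+)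
  next
    case (9 x)
    show ?case
      by (rule tensor3_ext_left[OF _ _ _ _ _ _ 9], rule_tac [6] cocycle_pure[THEN iffD2], unfold comp_def)
         ((rule lin | simp add: * )+)
  next
    case (10 x)
    show ?case
      by (rule tensor3_ext_left[OF _ _ _ _ _ _ 10], rule_tac [6] twisted_pure[THEN iffD2], unfold comp_def)
         ((rule lin | simp add: * )+)
  qed simp_all
qed

lemma prod_assoc:
  assumes "mirror_crossed_product K W B e P \<nu>"
    and "x \<in> carrier (W \<Otimes> B)" "y \<in> carrier (W \<Otimes> B)" "z \<in> carrier (W \<Otimes> B)"
  shows "prod (prod x y) z = prod x (prod y z)"
proof -
  interpret T: vectorspace K "W \<Otimes> B" by simp
  \<comment> \<open>Reversing both \<open>prod\<close> and the multiplication of \<open>B\<close>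
    turns right linearity into left linearity, with \<open>W\<close> in the role of
    \<open>V\<close>. The associativity obtained is then read with its three arguments in reverse
    order.\<close>
  interpret spanning_product "carrier (W \<Otimes> B)" "carrier B" "carrier W" "add (W \<Otimes> B)"
    "\<lambda>x y. prod y x" act "\<lambda>b c. c \<otimes>\<^bsub>B\<^esub> b" "\<lambda>w. ptensor K W B w \<one>\<^bsub>B\<^esub>" e
  proof (unfold_locales, goal_cases)
    case (12 x P)
    show ?case
    proof (rule tensor_induct[OF spaces 12(1)])
      show "P (ptensor K W B w b)" if "w \<in> carrier W" "b \<in> carrier B" for w b
        using 12(2)[OF that(2,1)] that by simp
    qed (rule 12(3))
  qed (use assms(1) in \<open>simp_all add: mirror_crossed_product_iff P_mult_at_def cocycle_at_def twisted_at_def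
     act_act prod_act prod_incW_left prod_pure
     linear_map_add[OF linear_map_prod_left[OF linear_map_id(1)]]
     linear_map_add[OF linear_map_prod_right[OF linear_map_id(1)]] linear_map_add[OF act_linear]\<close>)
  show ?thesis using m_assoc[OF assms(4,3,2)] by simp
qed

lemma mirror_alg_simps [simp]:
  "carrier (mirror_crossed_alg K W B e P \<nu>) = carrier (W \<Otimes> B)"
  "zero (mirror_crossed_alg K W B e P \<nu>) = zero (W \<Otimes> B)"
  "add (mirror_crossed_alg K W B e P \<nu>) = add (W \<Otimes> B)"
  "smult (mirror_crossed_alg K W B e P \<nu>) = smult (W \<Otimes> B)"
  "mult (mirror_crossed_alg K W B e P \<nu>) = prod"
  "one (mirror_crossed_alg K W B e P \<nu>) = ptensor K W B e \<one>\<^bsub>B\<^esub>"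
  by (simp_all add: mirror_crossed_alg_def prod_def fun_eq_iff)

lemma mirror_alg_linear:
  "linear_map K X (mirror_crossed_alg K W B e P \<nu>) f \<longleftrightarrow> linear_map K X (W \<Otimes> B) f"
  "linear_map K (mirror_crossed_alg K W B e P \<nu>) Y g \<longleftrightarrow> linear_map K (W \<Otimes> B) Y g"
  by (rule linear_map_space_cong; simp)+

lemma mirror_alg_algebra:
  assumes "mirror_crossed_product K W B e P \<nu>"
  shows "unital_algebra K (mirror_crossed_alg K W B e P \<nu>)"
proof (rule unital_algebraI, goal_cases)
  case 1 show ?case by (rule vectorspace_cong[of K "W \<Otimes> B"]) simp_all
next
  case (8 x) then show ?case by (simp add: prod_incB_right)
qed (use assms in \<open>simp_all add: mirror_alg_linear linear_map_prod_left linear_map_prod_right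
    prod_assoc prod_one_left\<close>)

end

lemma crossed_product_data:
  "crossed_product K A V e R \<sigma> \<Longrightarrow> crossed_data K A V e R \<sigma>"
  by (simp add: crossed_product_def crossed_product_axioms_def crossed_data_def crossed_data_axioms_def)

lemma mirror_crossed_product_data:
  "mirror_crossed_product K W B e P \<nu> \<Longrightarrow> mirror_data K W B e P \<nu>"
  by (simp add: mirror_crossed_product_def mirror_crossed_product_axioms_def mirror_data_def
    mirror_data_axioms_def)

section \<open>Iterated crossed products\<close>

text \<open>The hypotheses other than (a), (b) and (c). They already provide a multiplication on
  \<open>X\<close>, and only with it can those conditions be read as associativity laws.\<close>

locale iterated_data = MD: mirror_data K W D eW P \<nu> + CD: crossed_data K D V eV R \<sigma>
  for K :: "('k, 'm) ring_scheme" (structure)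
    and D :: "('k, 'd, 'm1) module_scheme"
    and W :: "('k, 'w, 'm2) module_scheme"
    and V :: "('k, 'v, 'm3) module_scheme"
    and eW :: 'w and eV :: 'v
    and P :: "('d \<times> 'w \<Rightarrow> 'k) set \<Rightarrow> ('w \<times> 'd \<Rightarrow> 'k) set"
    and \<nu> :: "('w \<times> 'w \<Rightarrow> 'k) set \<Rightarrow> ('w \<times> 'd \<Rightarrow> 'k) set"
    and R :: "('v \<times> 'd \<Rightarrow> 'k) set \<Rightarrow> ('d \<times> 'v \<Rightarrow> 'k) set"
    and \<sigma> :: "('v \<times> 'v \<Rightarrow> 'k) set \<Rightarrow> ('d \<times> 'v \<Rightarrow> 'k) set" +
  fixes Q :: "('v \<times> 'w \<Rightarrow> 'k) set \<Rightarrow> ('w \<times> ('d \<times> 'v \<Rightarrow> 'k) set \<Rightarrow> 'k) set"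
  assumes mirror: "mirror_crossed_product K W D eW P \<nu>"
    and crossed: "crossed_product K D V eV R \<sigma>"
    and Q_linear [simp]: "linear_map K (V \<Otimes> W) (W \<Otimes> (D \<Otimes> V)) Q"
    and Q_eV [simp]: "w \<in> carrier W \<Longrightarrow>
      Q (ptensor K V W eV w) = ptensor K W (D \<Otimes> V) w (ptensor K D V \<one>\<^bsub>D\<^esub> eV)"
    and Q_eW [simp]: "v \<in> carrier V \<Longrightarrow>
      Q (ptensor K V W v eW) = ptensor K W (D \<Otimes> V) eW (ptensor K D V \<one>\<^bsub>D\<^esub> v)"
begin

abbreviation "B \<equiv> crossed_alg K D V eV R \<sigma>"
abbreviation "A \<equiv> mirror_crossed_alg K W D eW P \<nu>"
abbreviation "Pb \<equiv> P_bar K W D V P Q"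
abbreviation "\<nu>b \<equiv> \<nu>_bar K W D V eV \<nu>"
abbreviation "Rb \<equiv> R_bar K W D V R Q"
abbreviation "\<sigma>b \<equiv> \<sigma>_bar K W D V eW \<sigma>"
abbreviation "X \<equiv> W \<Otimes> (D \<Otimes> V)"
abbreviation "jV v \<equiv> ptensor K D V \<one>\<^bsub>D\<^esub> v"
abbreviation "jD d \<equiv> ptensor K D V d eV"
abbreviation "iB b \<equiv> ptensor K W (D \<Otimes> V) eW b"
abbreviation "jW w \<equiv> ptensor K W (D \<Otimes> V) w (ptensor K D V \<one>\<^bsub>D\<^esub> eV)"

text \<open>
  The algebra \<open>B\<close> and the vector space \<open>D \<Otimes> V\<close> are different records, but tensor products ignore the
  multiplication; simplification replaces \<open>B\<close> by \<open>D \<Otimes> V\<close> in them, and \<open>A\<close> by \<open>W \<Otimes> D\<close>.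
\<close>

lemma B_tensor [simp]:
  "W \<Otimes> B = W \<Otimes> (D \<Otimes> V)" "B \<Otimes> W = (D \<Otimes> V) \<Otimes> W"
  "ptensor K W B = ptensor K W (D \<Otimes> V)" "ptensor K B W = ptensor K (D \<Otimes> V) W"
  by (rule tensor_cong; simp)+

lemma A_tensor [simp]:
  "A \<Otimes> V = (W \<Otimes> D) \<Otimes> V" "V \<Otimes> A = V \<Otimes> (W \<Otimes> D)"
  "ptensor K A V = ptensor K (W \<Otimes> D) V" "ptensor K V A = ptensor K V (W \<Otimes> D)"
  by (rule tensor_cong; simp)+

lemmas Q_closed [simp] = linear_map_closed[OF Q_linear]

lemmas lin = linear_intros linear_map_comp[OF _ MD.P_linear] linear_map_comp[OF _ MD.\<nu>_linear]
  linear_map_comp[OF _ CD.R_linear] linear_map_comp[OF _ CD.\<sigma>_linear] linear_map_comp[OF _ Q_linear]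
  linear_map_comp[OF _ MD.B.mult_map_linear] linear_map_comp[OF _ MD.act_linear]
  linear_map_comp[OF _ CD.act_linear] MD.linear_map_prod_left MD.linear_map_prod_right
  CD.linear_map_prod_left CD.linear_map_prod_right linear_map_comp[OF _ CD.R_ext_linear]
  linear_map_comp[OF _ CD.\<sigma>_ext_linear] linear_map_comp[OF _ MD.\<nu>_ext_linear]
  linear_map_comp[OF _ MD.P_ext_linear] linear_map_id

text \<open>The final maps of \<open>P_bar\<close>, multiplying the two middle factors of
  \<open>W \<otimes> D \<otimes> D \<otimes> V\<close>. By \<open>D_act_eq\<close> this is the right
  action of \<open>D \<otimes> V\<close> on the copy of \<open>W \<otimes> D\<close> in
  \<open>X\<close>.\<close>

definition D_act where
  "D_act y = tmap K W (D \<Otimes> V) id (tmap K D V (mult_map K D) id)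
    (tmap K W ((D \<Otimes> D) \<Otimes> V) id (assoc_inv K D D V) (assoc K W D (D \<Otimes> V) y))"

lemma D_act_linear [simp]: "linear_map K ((W \<Otimes> D) \<Otimes> (D \<Otimes> V)) X D_act"
  unfolding D_act_def by (rule lin | simp)+

lemma D_act_pure [simp]:
  "w \<in> carrier W \<Longrightarrow> d \<in> carrier D \<Longrightarrow> b \<in> carrier (D \<Otimes> V) \<Longrightarrow>
    D_act (ptensor K (W \<Otimes> D) (D \<Otimes> V) (ptensor K W D w d) b) = ptensor K W (D \<Otimes> V) w (CD.act d b)"
  by (simp add: D_act_def linear_map_closed[OF assoc_inv_linear])

lemma P_bar_pure:
  "d \<in> carrier D \<Longrightarrow> v \<in> carrier V \<Longrightarrow> w \<in> carrier W \<Longrightarrow>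
    Pb (ptensor K (D \<Otimes> V) W (ptensor K D V d v) w)
    = D_act (tmap K (W \<Otimes> D) (D \<Otimes> V) P id (assoc_inv K D W (D \<Otimes> V)
        (ptensor K D X d (Q (ptensor K V W v w)))))"
  by (simp add: P_bar_def D_act_def)

lemma P_bar_linear [simp]: "linear_map K ((D \<Otimes> V) \<Otimes> W) X Pb"
  unfolding P_bar_def comp_def by (rule lin | simp)+

text \<open>The embedding of the mirror product \<open>W \<otimes> D\<close> into \<open>X\<close>.
  It is multiplicative by \<open>\<kappa>_prod\<close>, which is how associativity in
  \<open>W \<otimes> D\<close> is imported into \<open>X\<close>.\<close>

definition \<kappa> where "\<kappa> s = assoc K W D V (ptensor K (W \<Otimes> D) V s eV)"

lemma \<kappa>_linear [simp]: "linear_map K (W \<Otimes> D) X \<kappa>"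
  unfolding \<kappa>_def by (rule lin | simp)+

lemmas \<kappa>_closed [simp] = linear_map_closed[OF \<kappa>_linear]

lemma \<kappa>_pure [simp]:
  "w \<in> carrier W \<Longrightarrow> d \<in> carrier D \<Longrightarrow> \<kappa> (ptensor K W D w d) = ptensor K W (D \<Otimes> V) w (jD d)"
  by (simp add: \<kappa>_def)

lemma \<nu>_bar_eq: "\<nu>b = (\<lambda>x. \<kappa> (\<nu> x))"
  by (simp add: \<nu>_bar_def \<kappa>_def fun_eq_iff)

lemma \<nu>_bar_app: "\<nu>b x = \<kappa> (\<nu> x)"
  by (simp add: \<nu>_bar_eq)

lemma \<nu>_bar_linear [simp]: "linear_map K (W \<Otimes> W) X \<nu>b"
  unfolding \<nu>_bar_eq by (rule linear_map_comp[OF MD.\<nu>_linear \<kappa>_linear])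

lemma P_bar_e:
  assumes "b \<in> carrier (D \<Otimes> V)"
  shows "Pb (ptensor K (D \<Otimes> V) W b eW) = ptensor K W (D \<Otimes> V) eW b"
proof -
  have "\<forall>b\<in>carrier (D \<Otimes> V). Pb (ptensor K (D \<Otimes> V) W b eW) = ptensor K W (D \<Otimes> V) eW b"
    by (rule tensor_ext)
       ((rule lin linear_map_comp[OF _ P_bar_linear] | simp add: P_bar_pure)+)
  then show ?thesis using assms by blast
qed

text \<open>Only linearity and the unit laws are checked, so \<open>XM.prod\<close> is at this point
  a unital product that may still fail to be associative.\<close>

sublocale XM: mirror_data K W B eW Pb \<nu>b
  by (intro mirror_data.intro mirror_data_axioms.intro MD.W.vectorspace_axioms
        CD.crossed_alg_algebra crossed)
     (simp_all add: CD.crossed_alg_linear P_bar_e P_bar_pure, simp_all add: \<nu>_bar_eq)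

text \<open>These copies replace tensor products with \<open>B\<close> by those with
  \<open>D \<otimes> V\<close>, the normal form in which goals appear.\<close>

lemmas X_act_linear [simp] = XM.act_linear[simplified]
lemmas X_act_closed [simp] = XM.act_closed[simplified]
lemmas X_act_pure [simp] = XM.act_pure[simplified]
lemmas X_act_one = XM.act_one[simplified]
lemmas X_prod_closed [simp] = XM.prod_closed[simplified]
lemmas X_prod_act = XM.prod_act[simplified]
lemmas X_prod_pure = XM.prod_pure[simplified]
lemmas X_\<nu>_ext_linear [simp] = XM.\<nu>_ext_linear[simplified]
lemmas X_\<nu>_ext_pure [simp] = XM.\<nu>_ext_pure[simplified]
lemmas X_prod_incW_left = XM.prod_incW_left[simplified]
lemmas X_prod_incB_incW = XM.prod_incB_incW[simplified]
lemmas X_prod_incB_right = XM.prod_incB_right[simplified]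
lemmas X_prod_left_linear = XM.linear_map_prod_left[simplified]
lemmas X_prod_right_linear = XM.linear_map_prod_right[simplified]
lemmas P_bar_closed [simp] = linear_map_closed[OF P_bar_linear]

lemmas lin' = lin linear_map_comp[OF _ P_bar_linear] linear_map_comp[OF _ \<kappa>_linear]
  linear_map_comp[OF _ D_act_linear] linear_map_comp[OF _ X_act_linear] X_prod_left_linear
  X_prod_right_linear linear_map_comp[OF _ X_\<nu>_ext_linear]

lemma D_act_eq:
  assumes "n \<in> carrier (W \<Otimes> D)" "c \<in> carrier (D \<Otimes> V)"
  shows "D_act (ptensor K (W \<Otimes> D) (D \<Otimes> V) n c) = XM.act c (\<kappa> n)"
proof -
  have "\<forall>n\<in>carrier (W \<Otimes> D). D_act (ptensor K (W \<Otimes> D) (D \<Otimes> V) n c) = XM.act c (\<kappa> n)"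
    by (rule tensor_ext) ((rule lin' | simp add: assms CD.prod_incA_left)+)
  then show ?thesis using assms by blast
qed

lemma X_prod_iB:
  "b \<in> carrier (D \<Otimes> V) \<Longrightarrow> w \<in> carrier W \<Longrightarrow> c \<in> carrier (D \<Otimes> V) \<Longrightarrow>
    XM.prod (iB b) (ptensor K W (D \<Otimes> V) w c) = XM.act c (Pb (ptensor K (D \<Otimes> V) W b w))"
  using XM.prod_incB_left[of b "ptensor K W (D \<Otimes> V) w c"] XM.P_ext_pure[of w c b] by simp

lemma P_bar_jD:
  "d \<in> carrier D \<Longrightarrow> w \<in> carrier W \<Longrightarrow>
    Pb (ptensor K (D \<Otimes> V) W (jD d) w) = \<kappa> (P (ptensor K D W d w))"
  using XM.act_one[of "\<kappa> (P (ptensor K D W d w))"] by (simp add: P_bar_pure D_act_eq)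

text \<open>The defining composite of \<open>P_bar\<close> applies \<open>Q\<close> and multiplies
  the result by \<open>d\<close> from the left. On a pure \<open>q\<close> the latter is
  \<open>P_bar_jD\<close> followed by the right action.\<close>

lemma P_bar_eq:
  assumes "d \<in> carrier D" "v \<in> carrier V" "w \<in> carrier W"
  shows "Pb (ptensor K (D \<Otimes> V) W (ptensor K D V d v) w) = XM.prod (iB (jD d)) (Q (ptensor K V W v w))"
proof -
  have "\<forall>q\<in>carrier X. D_act (tmap K (W \<Otimes> D) (D \<Otimes> V) P id (assoc_inv K D W (D \<Otimes> V) (ptensor K D X d q)))
    = XM.prod (iB (jD d)) q"
    by (rule tensor_ext) ((rule lin' | simp add: assms D_act_eq P_bar_jD X_prod_iB)+)
  then show ?thesis using assms by (simp add: P_bar_pure)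
qed

text \<open>Since \<open>1 \<otimes> v\<close> times \<open>w\<close> is given by
  \<open>P_bar\<close>, the map \<open>Q\<close> is itself the product of \<open>v\<close> and
  \<open>w\<close> in \<open>X\<close>.\<close>

lemma P_bar_jV:
  "v \<in> carrier V \<Longrightarrow> w \<in> carrier W \<Longrightarrow> Pb (ptensor K (D \<Otimes> V) W (jV v) w) = Q (ptensor K V W v w)"
  using XM.prod_one_left[of "Q (ptensor K V W v w)"] by (simp add: P_bar_eq)

lemma \<kappa>_act:
  assumes "d \<in> carrier D" "p \<in> carrier (W \<Otimes> D)"
  shows "\<kappa> (MD.act d p) = XM.act (jD d) (\<kappa> p)"
proof -
  have "\<forall>p\<in>carrier (W \<Otimes> D). \<kappa> (MD.act d p) = XM.act (jD d) (\<kappa> p)"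
    by (rule tensor_ext) ((rule lin' | simp add: assms CD.prod_incA_left)+)
  then show ?thesis using assms by blast
qed

lemma \<kappa>_\<nu>_ext:
  assumes "w \<in> carrier W" "p \<in> carrier (W \<Otimes> D)"
  shows "\<kappa> (MD.\<nu>_ext (ptensor K W (W \<Otimes> D) w p)) = XM.\<nu>_ext (ptensor K W X w (\<kappa> p))"
proof -
  have "\<forall>p\<in>carrier (W \<Otimes> D). \<kappa> (MD.\<nu>_ext (ptensor K W (W \<Otimes> D) w p)) = XM.\<nu>_ext (ptensor K W X w (\<kappa> p))"
    by (rule tensor_ext) ((rule lin' | simp add: assms \<kappa>_act \<nu>_bar_app)+)
  then show ?thesis using assms by blast
qed

text \<open>On the copies of \<open>D\<close> and \<open>W\<close> the structure maps restrict:
  \<open>P_bar\<close> becomes \<open>\<kappa>\<close> after \<open>P\<close>,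
  \<open>\<nu>_bar\<close> is \<open>\<kappa>\<close> after \<open>\<nu>\<close>, and the right
  actions correspond under \<open>jD\<close>.\<close>

lemma \<kappa>_prod:
  assumes "x \<in> carrier (W \<Otimes> D)" "y \<in> carrier (W \<Otimes> D)"
  shows "\<kappa> (MD.prod x y) = XM.prod (\<kappa> x) (\<kappa> y)"
proof -
  have "\<forall>x\<in>carrier (W \<Otimes> D). \<kappa> (MD.prod x y) = XM.prod (\<kappa> x) (\<kappa> y)"
  proof (rule tensor_ext)
    fix w d assume wd: "w \<in> carrier W" "d \<in> carrier D"
    have "\<forall>y\<in>carrier (W \<Otimes> D). \<kappa> (MD.prod (ptensor K W D w d) y) = XM.prod (\<kappa> (ptensor K W D w d)) (\<kappa> y)"
      by (rule tensor_ext)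
         ((rule lin' | simp add: wd MD.prod_pure X_prod_pure \<kappa>_act \<kappa>_\<nu>_ext P_bar_jD)+)
    then show "\<kappa> (MD.prod (ptensor K W D w d) y) = XM.prod (\<kappa> (ptensor K W D w d)) (\<kappa> y)"
      using assms by blast
  qed ((rule lin' | simp add: assms)+)
  then show ?thesis using assms by blast
qed

text \<open>Every pure tensor is a right multiple of some \<open>jW w\<close>. Presenting it in that
  way lets maps commuting with the right action be compared on \<open>W\<close>.\<close>

lemma X_ext:
  assumes "linear_map K X U f" "linear_map K X U g"
    and "\<And>w c. \<lbrakk>w \<in> carrier W; c \<in> carrier (D \<Otimes> V)\<rbrakk> \<Longrightarrow> f (XM.act c (jW w)) = g (XM.act c (jW w))"
  shows "\<forall>x\<in>carrier X. f x = g x"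
proof (rule tensor_ext[OF assms(1,2)])
  fix w c assume "w \<in> carrier W" "c \<in> carrier (D \<Otimes> V)"
  then show "f (ptensor K W (D \<Otimes> V) w c) = g (ptensor K W (D \<Otimes> V) w c)"
    using assms(3)[of w c] by (simp add: CD.prod_incA_left)
qed simp_all

section \<open>Left multiplications by elements of \<open>D \<otimes> V\<close>\<close>

definition \<rho> where "\<rho> b x = XM.prod (iB b) x"

lemma \<rho>_closed [simp]: "b \<in> carrier (D \<Otimes> V) \<Longrightarrow> x \<in> carrier X \<Longrightarrow> \<rho> b x \<in> carrier X"
  by (simp add: \<rho>_def)

lemma \<rho>_linear_left: "linear_map K Y (D \<Otimes> V) h \<Longrightarrow> x \<in> carrier X \<Longrightarrow> linear_map K Y X (\<lambda>b. \<rho> (h b) x)"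
  unfolding \<rho>_def by (rule lin' | simp)+

lemma \<rho>_linear_right: "linear_map K Y X h \<Longrightarrow> b \<in> carrier (D \<Otimes> V) \<Longrightarrow> linear_map K Y X (\<lambda>x. \<rho> b (h x))"
  unfolding \<rho>_def by (rule lin' | simp)+

lemmas lin'' = lin' \<rho>_linear_left \<rho>_linear_right

lemma \<rho>_act: "b \<in> carrier (D \<Otimes> V) \<Longrightarrow> c \<in> carrier (D \<Otimes> V) \<Longrightarrow> x \<in> carrier X \<Longrightarrow>
    \<rho> b (XM.act c x) = XM.act c (\<rho> b x)"
  by (simp add: \<rho>_def X_prod_act)

lemma \<rho>_jW: "b \<in> carrier (D \<Otimes> V) \<Longrightarrow> w \<in> carrier W \<Longrightarrow> \<rho> b (jW w) = Pb (ptensor K (D \<Otimes> V) W b w)"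
  using X_prod_incB_incW[of b w] by (simp add: \<rho>_def)

lemma \<rho>_\<rho>_ext:
  assumes "\<And>w. w \<in> carrier W \<Longrightarrow> \<rho> b (\<rho> b' (jW w)) = \<rho> b'' (jW w)"
    and "b \<in> carrier (D \<Otimes> V)" "b' \<in> carrier (D \<Otimes> V)" "b'' \<in> carrier (D \<Otimes> V)"
    and "x \<in> carrier X"
  shows "\<rho> b (\<rho> b' x) = \<rho> b'' x"
proof -
  have "\<forall>x\<in>carrier X. \<rho> b (\<rho> b' x) = \<rho> b'' x"
  proof (rule X_ext)
    fix w c assume "w \<in> carrier W" "c \<in> carrier (D \<Otimes> V)"
    then show "\<rho> b (\<rho> b' (XM.act c (jW w))) = \<rho> b'' (XM.act c (jW w))"
      \<comment> \<open>\<open>X_act_pure\<close> would evaluate the right action on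
        \<open>jW w\<close> before \<open>\<rho>_act\<close> could move it outside.\<close>
      using assms by (simp add: \<rho>_act del: X_act_pure)
  qed ((rule lin'' | simp add: assms(2-4))+)
  then show ?thesis using assms by blast
qed

lemma jW_\<kappa>: "w \<in> carrier W \<Longrightarrow> jW w = \<kappa> (ptensor K W D w \<one>\<^bsub>D\<^esub>)"
  by simp

lemma \<rho>_jD_\<kappa>: "d \<in> carrier D \<Longrightarrow> s \<in> carrier (W \<Otimes> D) \<Longrightarrow>
    \<rho> (jD d) (\<kappa> s) = \<kappa> (MD.prod (ptensor K W D eW d) s)"
  by (simp add: \<rho>_def \<kappa>_prod)

text \<open>On \<open>W\<close> this takes place inside the image of \<open>\<kappa>\<close>, where
  it is associativity of the given mirror product.\<close>

lemma \<rho>_jD_jD: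
  assumes "d \<in> carrier D" "d' \<in> carrier D" "x \<in> carrier X"
  shows "\<rho> (jD d) (\<rho> (jD d') x) = \<rho> (jD (d \<otimes>\<^bsub>D\<^esub> d')) x"
proof (rule \<rho>_\<rho>_ext)
  fix w assume w: "w \<in> carrier W"
  have "MD.prod (ptensor K W D eW d) (MD.prod (ptensor K W D eW d') (ptensor K W D w \<one>\<^bsub>D\<^esub>))
      = MD.prod (MD.prod (ptensor K W D eW d) (ptensor K W D eW d')) (ptensor K W D w \<one>\<^bsub>D\<^esub>)"
    using assms w MD.prod_assoc[OF mirror] by simp
  also have "\<dots> = MD.prod (ptensor K W D eW (d \<otimes>\<^bsub>D\<^esub> d')) (ptensor K W D w \<one>\<^bsub>D\<^esub>)"
    using assms w by (simp add: MD.prod_incB_right)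
  finally show "\<rho> (jD d) (\<rho> (jD d') (jW w)) = \<rho> (jD (d \<otimes>\<^bsub>D\<^esub> d')) (jW w)"
    \<comment> \<open>\<open>jW_\<kappa>\<close> rewrites against \<open>\<kappa>_pure\<close>,
      which is therefore switched off.\<close>
    using assms w by (simp add: jW_\<kappa> \<rho>_jD_\<kappa> del: \<kappa>_pure)
qed (use assms in simp_all)

lemma \<rho>_jD_jV:
  assumes "d \<in> carrier D" "v \<in> carrier V" "x \<in> carrier X"
  shows "\<rho> (jD d) (\<rho> (jV v) x) = \<rho> (ptensor K D V d v) x"
  by (rule \<rho>_\<rho>_ext) (simp_all add: assms \<rho>_jW P_bar_jV P_bar_eq[of d v], simp add: \<rho>_def)

lemma \<rho>_jD:
  assumes "d \<in> carrier D" "b \<in> carrier (D \<Otimes> V)" "x \<in> carrier X"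
  shows "\<rho> (jD d) (\<rho> b x) = \<rho> (CD.act d b) x"
proof -
  have "\<forall>b\<in>carrier (D \<Otimes> V). \<rho> (jD d) (\<rho> b x) = \<rho> (CD.act d b) x"
  proof (rule tensor_ext)
    fix d' v assume *: "d' \<in> carrier D" "v \<in> carrier V"
    have "\<rho> (jD d) (\<rho> (jD d') (\<rho> (jV v) x)) = \<rho> (jD (d \<otimes>\<^bsub>D\<^esub> d')) (\<rho> (jV v) x)"
      using * assms by (simp add: \<rho>_jD_jD)
    then show "\<rho> (jD d) (\<rho> (ptensor K D V d' v) x) = \<rho> (CD.act d (ptensor K D V d' v)) x"
      using * assms by (simp add: \<rho>_jD_jV)
  qed ((rule lin'' | simp add: assms)+)
  then show ?thesis using assms by blast
qed

section \<open>Conditions (a), (b), (c) as associativity laws in \<open>X\<close>\<close>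

definition R_right where
  "R_right y = tmap K W (D \<Otimes> V) id (tmap K D V (mult_map K D) id)
    (tmap K W ((D \<Otimes> D) \<Otimes> V) id (assoc_inv K D D V)
    (tmap K W (D \<Otimes> (D \<Otimes> V)) id (tmap K D (D \<Otimes> V) id R)
    (tmap K W (D \<Otimes> (V \<Otimes> D)) id (assoc K D V D)
    (assoc K W (D \<Otimes> V) D y))))"

lemma R_right_linear [simp]: "linear_map K (X \<Otimes> D) X R_right"
  unfolding R_right_def by (rule lin | simp)+

text \<open>The common tail of \<open>R_bar\<close> and of the left sides of (a) and (b) changes
  only the factor \<open>D \<otimes> V\<close>, where it is \<open>CD.R_ext\<close>, that is, right
  multiplication by \<open>jD d\<close>.\<close>

lemma R_right_eq:
  assumes "x \<in> carrier X" "d \<in> carrier D"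
  shows "R_right (ptensor K X D x d) = XM.act (jD d) x"
proof -
  have "\<forall>x\<in>carrier X. R_right (ptensor K X D x d) = XM.act (jD d) x"
  proof (rule tensor_ext)
    fix w b assume *: "w \<in> carrier W" "b \<in> carrier (D \<Otimes> V)"
    have "tmap K D (D \<Otimes> V) id R (assoc K D V D (ptensor K (D \<Otimes> V) D b d)) \<in> carrier (D \<Otimes> (D \<Otimes> V))"
      by (rule linear_map_closed[of K "(D \<Otimes> V) \<Otimes> D"], (rule lin | simp add: * assms)+)
    then have "R_right (ptensor K X D (ptensor K W (D \<Otimes> V) w b) d)
        = ptensor K W (D \<Otimes> V) w (CD.R_ext (ptensor K (D \<Otimes> V) D b d))"
      using * assms
      by (simp add: R_right_def CD.R_ext_def linear_map_closed[OF assoc_linear]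
        linear_map_closed[OF assoc_inv_linear])
    then show "R_right (ptensor K X D (ptensor K W (D \<Otimes> V) w b) d)
        = XM.act (jD d) (ptensor K W (D \<Otimes> V) w b)"
      using * assms by (simp add: CD.prod_incA_right)
  qed ((rule lin'' linear_map_comp[OF _ R_right_linear] | simp add: assms)+)
  then show ?thesis using assms by blast
qed

definition R_bar' where
  "R_bar' y = R_right (tmap K X D Q id (assoc_inv K V W D y))"

lemma R_bar'_linear [simp]: "linear_map K (V \<Otimes> (W \<Otimes> D)) X R_bar'"
  unfolding R_bar'_def by (rule lin linear_map_comp[OF _ R_right_linear] | simp)+

text \<open>\<open>R_bar'\<close> is \<open>R_bar\<close> before the final rebracketing. On
  \<open>s = w \<otimes> d\<close> it forms \<open>Q (v \<otimes> w)\<close> and multiplies by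
  \<open>d\<close> on the right, which is left multiplication of \<open>\<kappa> s\<close> by
  \<open>v\<close>.\<close>

lemma R_bar'_eq:
  assumes "v \<in> carrier V" "s \<in> carrier (W \<Otimes> D)"
  shows "R_bar' (ptensor K V (W \<Otimes> D) v s) = \<rho> (jV v) (\<kappa> s)"
proof -
  have "\<forall>s\<in>carrier (W \<Otimes> D). R_bar' (ptensor K V (W \<Otimes> D) v s) = \<rho> (jV v) (\<kappa> s)"
  proof (rule tensor_ext)
    fix w d assume *: "w \<in> carrier W" "d \<in> carrier D"
    then show "R_bar' (ptensor K V (W \<Otimes> D) v (ptensor K W D w d)) = \<rho> (jV v) (\<kappa> (ptensor K W D w d))"
      using assms by (simp add: R_bar'_def R_right_eq \<rho>_def X_prod_iB P_bar_jV)
  qed ((rule lin'' linear_map_comp[OF _ R_bar'_linear] | simp add: assms)+)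
  then show ?thesis using assms by blast
qed

text \<open>In \<open>X\<close> the condition says \<open>v (d w) = (v d) w\<close>: its left side
  is \<open>R_bar'\<close> applied after \<open>P\<close>, its right side \<open>P_bar\<close>
  applied after \<open>R\<close>.\<close>

lemma condition_a:
  assumes vdw: "v \<in> carrier V" "d \<in> carrier D" "w \<in> carrier W"
    and a: "(tmap K W (D \<Otimes> V) id (tmap K D V (mult_map K D) id)
        \<circ> tmap K W ((D \<Otimes> D) \<Otimes> V) id (assoc_inv K D D V)
        \<circ> tmap K W (D \<Otimes> (D \<Otimes> V)) id (tmap K D (D \<Otimes> V) id R)
        \<circ> tmap K W (D \<Otimes> (V \<Otimes> D)) id (assoc K D V D)
        \<circ> assoc K W (D \<Otimes> V) D
        \<circ> tmap K (W \<Otimes> (D \<Otimes> V)) D Q id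
        \<circ> assoc_inv K V W D
        \<circ> tmap K V (W \<Otimes> D) id P) (ptensor K V (D \<Otimes> W) v (ptensor K D W d w)) =
      (tmap K W (D \<Otimes> V) id (tmap K D V (mult_map K D) id)
        \<circ> tmap K W ((D \<Otimes> D) \<Otimes> V) id (assoc_inv K D D V)
        \<circ> assoc K W D (D \<Otimes> V)
        \<circ> tmap K (W \<Otimes> D) (D \<Otimes> V) P id
        \<circ> assoc_inv K D W (D \<Otimes> V)
        \<circ> tmap K D (W \<Otimes> (D \<Otimes> V)) id Q
        \<circ> assoc K D V W
        \<circ> tmap K (D \<Otimes> V) W R id
        \<circ> assoc_inv K V D W) (ptensor K V (D \<Otimes> W) v (ptensor K D W d w))"
  shows "\<rho> (jV v) (\<kappa> (P (ptensor K D W d w))) = \<rho> (R (ptensor K V D v d)) (jW w)"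
proof -
  have "R_bar' (ptensor K V (W \<Otimes> D) v (P (ptensor K D W d w)))
      = Pb (ptensor K (D \<Otimes> V) W (R (ptensor K V D v d)) w)"
    using a vdw by (simp add: R_bar'_def R_right_def P_bar_def)
  then show ?thesis
    using vdw by (simp add: R_bar'_eq \<rho>_jW)
qed

text \<open>The end of the right side of (b), starting where \<open>P\<close> has been applied. It
  sends \<open>w \<otimes> u \<otimes> d \<otimes> c\<close> to the product of
  \<open>\<nu> (w \<otimes> u)\<close> with \<open>d c\<close>.\<close>

definition b_tail where
  "b_tail y = tmap K W (D \<Otimes> V) id (tmap K D V (mult_map K D) id)
      (tmap K W ((D \<Otimes> D) \<Otimes> V) id (assoc_inv K D D V)
      (assoc K W D (D \<Otimes> V)
      (tmap K (W \<Otimes> D) (D \<Otimes> V) \<nu> (tmap K D V (mult_map K D) id)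
      (tmap K (W \<Otimes> W) ((D \<Otimes> D) \<Otimes> V) id (assoc_inv K D D V)
      (assoc_inv K W W (D \<Otimes> (D \<Otimes> V)) y)))))"

lemma b_tail_linear [simp]: "linear_map K (W \<Otimes> (W \<Otimes> (D \<Otimes> (D \<Otimes> V)))) X b_tail"
  unfolding b_tail_def by (rule lin | simp)+

lemma b_tail_assoc:
  assumes "w \<in> carrier W" "p \<in> carrier (W \<Otimes> D)" "c \<in> carrier (D \<Otimes> V)"
  shows "b_tail (ptensor K W (W \<Otimes> (D \<Otimes> (D \<Otimes> V))) w
      (assoc K W D (D \<Otimes> V) (ptensor K (W \<Otimes> D) (D \<Otimes> V) p c)))
    = XM.\<nu>_ext (ptensor K W X w (XM.act c (\<kappa> p)))"
proof -
  have "\<forall>p\<in>carrier (W \<Otimes> D). b_tail (ptensor K W (W \<Otimes> (D \<Otimes> (D \<Otimes> V))) w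
      (assoc K W D (D \<Otimes> V) (ptensor K (W \<Otimes> D) (D \<Otimes> V) p c)))
    = XM.\<nu>_ext (ptensor K W X w (XM.act c (\<kappa> p)))"
  proof (rule tensor_ext)
    fix u d assume *: "u \<in> carrier W" "d \<in> carrier D"
    have "b_tail (ptensor K W (W \<Otimes> (D \<Otimes> (D \<Otimes> V))) w
      (assoc K W D (D \<Otimes> V) (ptensor K (W \<Otimes> D) (D \<Otimes> V) (ptensor K W D u d) c)))
      = D_act (ptensor K (W \<Otimes> D) (D \<Otimes> V) (\<nu> (ptensor K W W w u)) (CD.act d c))"
      using * assms by (simp add: b_tail_def D_act_def linear_map_closed[OF assoc_inv_linear])
    then show "b_tail (ptensor K W (W \<Otimes> (D \<Otimes> (D \<Otimes> V))) w
      (assoc K W D (D \<Otimes> V) (ptensor K (W \<Otimes> D) (D \<Otimes> V) (ptensor K W D u d) c)))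
      = XM.\<nu>_ext (ptensor K W X w (XM.act c (\<kappa> (ptensor K W D u d))))"
      using * assms by (simp add: D_act_eq CD.prod_incA_left \<nu>_bar_app)
  qed ((rule lin'' linear_map_comp[OF _ b_tail_linear] | simp add: assms)+)
  then show ?thesis using assms by blast
qed

text \<open>Together with the preceding use of \<open>P\<close>, the tail computes
  \<open>w (d q)\<close>; linearity in \<open>q\<close> reduces this to
  \<open>b_tail_assoc\<close>.\<close>

lemma b_tail_P:
  assumes "w \<in> carrier W" "d \<in> carrier D" "q \<in> carrier X"
  shows "b_tail (ptensor K W (W \<Otimes> (D \<Otimes> (D \<Otimes> V))) w (assoc K W D (D \<Otimes> V)
      (tmap K (W \<Otimes> D) (D \<Otimes> V) P id (assoc_inv K D W (D \<Otimes> V) (ptensor K D X d q)))))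
    = XM.\<nu>_ext (ptensor K W X w (\<rho> (jD d) q))"
proof -
  have "\<forall>q\<in>carrier X. b_tail (ptensor K W (W \<Otimes> (D \<Otimes> (D \<Otimes> V))) w (assoc K W D (D \<Otimes> V)
      (tmap K (W \<Otimes> D) (D \<Otimes> V) P id (assoc_inv K D W (D \<Otimes> V) (ptensor K D X d q)))))
    = XM.\<nu>_ext (ptensor K W X w (\<rho> (jD d) q))"
    by (rule tensor_ext)
       ((rule lin'' linear_map_comp[OF _ b_tail_linear]
         | simp add: assms b_tail_assoc \<rho>_def X_prod_iB P_bar_jD)+)
  then show ?thesis using assms by blast
qed

definition b_right where
  "b_right y = b_tail
      (tmap K W (W \<Otimes> (D \<Otimes> (D \<Otimes> V))) id (assoc K W D (D \<Otimes> V))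
      (tmap K W ((W \<Otimes> D) \<Otimes> (D \<Otimes> V)) id (tmap K (W \<Otimes> D) (D \<Otimes> V) P id)
      (tmap K W ((D \<Otimes> W) \<Otimes> (D \<Otimes> V)) id (assoc_inv K D W (D \<Otimes> V))
      (tmap K W (D \<Otimes> (W \<Otimes> (D \<Otimes> V))) id (tmap K D (W \<Otimes> (D \<Otimes> V)) id Q)
      (tmap K W (D \<Otimes> (V \<Otimes> W)) id (assoc K D V W)
      (assoc K W (D \<Otimes> V) W y))))))"

lemma b_right_linear [simp]: "linear_map K (X \<Otimes> W) X b_right"
  unfolding b_right_def by (rule lin linear_map_comp[OF _ b_tail_linear] | simp)+

text \<open>For \<open>s = w \<otimes> d \<otimes> v\<close> the mirror product unfolds to
  \<open>w (d Q(v \<otimes> u))\<close>, which is what the composite computes step by step.\<close>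

lemma b_right_eq:
  assumes "s \<in> carrier X" "u \<in> carrier W"
  shows "b_right (ptensor K X W s u) = XM.prod s (jW u)"
proof (rule tensor3_ext[where f = "\<lambda>s. b_right (ptensor K X W s u)" and g = "\<lambda>s. XM.prod s (jW u)"
    and X = W and Y = D and Z = V and t = s and U = X])
  fix w d v assume *: "w \<in> carrier W" "d \<in> carrier D" "v \<in> carrier V"
  have c1: "assoc_inv K D W (D \<Otimes> V) (ptensor K D X d (Q (ptensor K V W v u))) \<in> carrier ((D \<Otimes> W) \<Otimes> (D \<Otimes> V))"
    using * assms by (simp add: linear_map_closed[OF assoc_inv_linear])
  have "tmap K (W \<Otimes> D) (D \<Otimes> V) P id (assoc_inv K D W (D \<Otimes> V) (ptensor K D X d (Q (ptensor K V W v u))))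
      \<in> carrier ((W \<Otimes> D) \<Otimes> (D \<Otimes> V))"
    by (rule linear_map_closed[OF tmap_linear c1]) simp_all
  then show "b_right (ptensor K X W (ptensor K W (D \<Otimes> V) w (ptensor K D V d v)) u)
      = XM.prod (ptensor K W (D \<Otimes> V) w (ptensor K D V d v)) (jW u)"
    using * assms c1
    by (simp add: b_right_def b_tail_P X_prod_pure P_bar_eq X_act_one
      linear_map_closed[OF X_\<nu>_ext_linear] \<rho>_def)
qed ((rule lin'' linear_map_comp[OF _ b_right_linear] | simp add: assms)+)

text \<open>In \<open>X\<close> the condition says \<open>v (w w') = (v w) w'\<close>; the right
  side is \<open>b_right\<close> after \<open>Q\<close>.\<close>

lemma condition_b:
  assumes vww: "v \<in> carrier V" "w \<in> carrier W" "w' \<in> carrier W"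
    and b: "(tmap K W (D \<Otimes> V) id (tmap K D V (mult_map K D) id)
        \<circ> tmap K W ((D \<Otimes> D) \<Otimes> V) id (assoc_inv K D D V)
        \<circ> tmap K W (D \<Otimes> (D \<Otimes> V)) id (tmap K D (D \<Otimes> V) id R)
        \<circ> tmap K W (D \<Otimes> (V \<Otimes> D)) id (assoc K D V D)
        \<circ> assoc K W (D \<Otimes> V) D
        \<circ> tmap K (W \<Otimes> (D \<Otimes> V)) D Q id
        \<circ> assoc_inv K V W D
        \<circ> tmap K V (W \<Otimes> D) id \<nu>) (ptensor K V (W \<Otimes> W) v (ptensor K W W w w')) =
      (tmap K W (D \<Otimes> V) id (tmap K D V (mult_map K D) id)
        \<circ> tmap K W ((D \<Otimes> D) \<Otimes> V) id (assoc_inv K D D V)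
        \<circ> assoc K W D (D \<Otimes> V)
        \<circ> tmap K (W \<Otimes> D) (D \<Otimes> V) \<nu> (tmap K D V (mult_map K D) id)
        \<circ> tmap K (W \<Otimes> W) ((D \<Otimes> D) \<Otimes> V) id (assoc_inv K D D V)
        \<circ> assoc_inv K W W (D \<Otimes> (D \<Otimes> V))
        \<circ> tmap K W (W \<Otimes> (D \<Otimes> (D \<Otimes> V))) id (assoc K W D (D \<Otimes> V))
        \<circ> tmap K W ((W \<Otimes> D) \<Otimes> (D \<Otimes> V)) id (tmap K (W \<Otimes> D) (D \<Otimes> V) P id)
        \<circ> tmap K W ((D \<Otimes> W) \<Otimes> (D \<Otimes> V)) id (assoc_inv K D W (D \<Otimes> V))
        \<circ> tmap K W (D \<Otimes> (W \<Otimes> (D \<Otimes> V))) id (tmap K D (W \<Otimes> (D \<Otimes> V)) id Q)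
        \<circ> tmap K W (D \<Otimes> (V \<Otimes> W)) id (assoc K D V W)
        \<circ> assoc K W (D \<Otimes> V) W
        \<circ> tmap K (W \<Otimes> (D \<Otimes> V)) W Q id
        \<circ> assoc_inv K V W W) (ptensor K V (W \<Otimes> W) v (ptensor K W W w w'))"
  shows "\<rho> (jV v) (\<kappa> (\<nu> (ptensor K W W w w'))) = XM.prod (Q (ptensor K V W v w)) (jW w')"
proof -
  have "R_bar' (ptensor K V (W \<Otimes> D) v (\<nu> (ptensor K W W w w')))
      = b_right (ptensor K X W (Q (ptensor K V W v w)) w')"
    using b vww by (simp add: R_bar'_def R_right_def b_right_def b_tail_def)
  then show ?thesis
    using vww by (simp add: R_bar'_eq b_right_eq)
qed

text \<open>The right side of (c) multiplies two \<open>D\<close>-entries while applying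
  \<open>\<sigma>\<close>, and then multiplies again. Associativity of \<open>D\<close> turns this
  into successive left actions, as in the product of \<open>D \<otimes> V\<close>.\<close>

lemma c_inner:
  assumes "d \<in> carrier D" "r \<in> carrier (D \<Otimes> V)" "u \<in> carrier V"
  shows "tmap K D V (mult_map K D) id (assoc_inv K D D V (tmap K D (D \<Otimes> V) (mult_map K D) \<sigma>
      (assoc_inv K D D (V \<Otimes> V) (ptensor K D (D \<Otimes> (V \<Otimes> V)) d
        (assoc K D V V (ptensor K (D \<Otimes> V) V r u))))))
    = CD.act d (CD.\<sigma>_ext (ptensor K (D \<Otimes> V) V r u))"
proof -
  have "\<forall>r\<in>carrier (D \<Otimes> V). tmap K D V (mult_map K D) id (assoc_inv K D D V (tmap K D (D \<Otimes> V) (mult_map K D) \<sigma>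
      (assoc_inv K D D (V \<Otimes> V) (ptensor K D (D \<Otimes> (V \<Otimes> V)) d
        (assoc K D V V (ptensor K (D \<Otimes> V) V r u))))))
    = CD.act d (CD.\<sigma>_ext (ptensor K (D \<Otimes> V) V r u))"
    by (rule tensor_ext) ((rule lin'' | simp add: assms CD.act_act)+)
  then show ?thesis using assms by blast
qed

text \<open>The long tail of the right side of (c) leaves \<open>W\<close> alone and multiplies two
  elements of \<open>D \<otimes> V\<close>. By \<open>c_right_eq\<close> it is the right action of
  \<open>D \<otimes> V\<close> on \<open>X\<close>.\<close>

definition c_right where
  "c_right y = tmap K W (D \<Otimes> V) id (tmap K D V (mult_map K D) id)
        (tmap K W ((D \<Otimes> D) \<Otimes> V) id (assoc_inv K D D V)
        (tmap K W (D \<Otimes> (D \<Otimes> V)) id (tmap K D (D \<Otimes> V) (mult_map K D) \<sigma>)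
        (tmap K W ((D \<Otimes> D) \<Otimes> (V \<Otimes> V)) id (assoc_inv K D D (V \<Otimes> V))
        (tmap K W (D \<Otimes> (D \<Otimes> (V \<Otimes> V))) id (tmap K D (D \<Otimes> (V \<Otimes> V)) id (assoc K D V V))
        (tmap K W (D \<Otimes> ((D \<Otimes> V) \<Otimes> V)) id (tmap K D ((D \<Otimes> V) \<Otimes> V) id (tmap K (D \<Otimes> V) V R id))
        (tmap K W (D \<Otimes> ((V \<Otimes> D) \<Otimes> V)) id (tmap K D ((V \<Otimes> D) \<Otimes> V) id (assoc_inv K V D V))
        (tmap K W (D \<Otimes> (V \<Otimes> (D \<Otimes> V))) id (assoc K D V (D \<Otimes> V))
        (assoc K W (D \<Otimes> V) (D \<Otimes> V) y))))))))"

lemma c_right_linear [simp]: "linear_map K (X \<Otimes> (D \<Otimes> V)) X c_right"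
  unfolding c_right_def by (rule lin | simp)+

lemma c_right_pure:
  assumes "w \<in> carrier W" "d \<in> carrier D" "v \<in> carrier V" "d' \<in> carrier D" "u \<in> carrier V"
  shows "c_right (ptensor K X (D \<Otimes> V) (ptensor K W (D \<Otimes> V) w (ptensor K D V d v)) (ptensor K D V d' u))
    = ptensor K W (D \<Otimes> V) w (CD.prod (ptensor K D V d v) (ptensor K D V d' u))"
proof -
  let ?Z = "assoc_inv K D D (V \<Otimes> V) (ptensor K D (D \<Otimes> (V \<Otimes> V)) d
        (assoc K D V V (ptensor K (D \<Otimes> V) V (R (ptensor K V D v d')) u)))"
  have Z: "?Z \<in> carrier ((D \<Otimes> D) \<Otimes> (V \<Otimes> V))"
    using assms by (simp add: linear_map_closed[OF assoc_inv_linear] linear_map_closed[OF assoc_linear])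
  have "tmap K D (D \<Otimes> V) (mult_map K D) \<sigma> ?Z \<in> carrier (D \<Otimes> (D \<Otimes> V))"
    by (rule linear_map_closed[OF tmap_linear Z]) simp_all
  then show ?thesis
    using assms Z
    by (simp add: c_right_def c_inner CD.prod_pure linear_map_closed[OF assoc_inv_linear]
      linear_map_closed[OF assoc_linear])
qed

lemma c_right_eq:
  assumes "s \<in> carrier X" "c \<in> carrier (D \<Otimes> V)"
  shows "c_right (ptensor K X (D \<Otimes> V) s c) = XM.act c s"
proof (rule tensor3_ext[where f = "\<lambda>s. c_right (ptensor K X (D \<Otimes> V) s c)" and g = "\<lambda>s. XM.act c s"
    and X = W and Y = D and Z = V and t = s and U = X])
  fix w d v assume *: "w \<in> carrier W" "d \<in> carrier D" "v \<in> carrier V"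
  have "\<forall>c\<in>carrier (D \<Otimes> V). c_right (ptensor K X (D \<Otimes> V) (ptensor K W (D \<Otimes> V) w (ptensor K D V d v)) c)
      = ptensor K W (D \<Otimes> V) w (CD.prod (ptensor K D V d v) c)"
    by (rule tensor_ext) ((rule lin'' linear_map_comp[OF _ c_right_linear] | simp add: * c_right_pure)+)
  then show "c_right (ptensor K X (D \<Otimes> V) (ptensor K W (D \<Otimes> V) w (ptensor K D V d v)) c)
      = XM.act c (ptensor K W (D \<Otimes> V) w (ptensor K D V d v))"
    using * assms by simp
qed ((rule lin'' linear_map_comp[OF _ c_right_linear] | simp add: assms)+)

lemma c_right_Q:
  assumes "v \<in> carrier V" "t \<in> carrier X"
  shows "c_right (tmap K X (D \<Otimes> V) Q id (assoc_inv K V W (D \<Otimes> V) (ptensor K V X v t))) = \<rho> (jV v) t"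
proof -
  have "\<forall>t\<in>carrier X.
      c_right (tmap K X (D \<Otimes> V) Q id (assoc_inv K V W (D \<Otimes> V) (ptensor K V X v t))) = \<rho> (jV v) t"
    by (rule tensor_ext)
       ((rule lin'' linear_map_comp[OF _ c_right_linear]
         | simp add: assms c_right_eq \<rho>_def X_prod_iB P_bar_jV)+)
  then show ?thesis using assms by blast
qed

text \<open>In \<open>X\<close> the condition says \<open>(v v') w = v (v' w)\<close>.\<close>

lemma condition_c:
  assumes vvw: "v \<in> carrier V" "v' \<in> carrier V" "w \<in> carrier W"
    and c: "(tmap K W (D \<Otimes> V) id (tmap K D V (mult_map K D) id)
        \<circ> tmap K W ((D \<Otimes> D) \<Otimes> V) id (assoc_inv K D D V)
        \<circ> assoc K W D (D \<Otimes> V)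
        \<circ> tmap K (W \<Otimes> D) (D \<Otimes> V) P id
        \<circ> assoc_inv K D W (D \<Otimes> V)
        \<circ> tmap K D (W \<Otimes> (D \<Otimes> V)) id Q
        \<circ> assoc K D V W
        \<circ> tmap K (D \<Otimes> V) W \<sigma> id
        \<circ> assoc_inv K V V W) (ptensor K V (V \<Otimes> W) v (ptensor K V W v' w)) =
      (tmap K W (D \<Otimes> V) id (tmap K D V (mult_map K D) id)
        \<circ> tmap K W ((D \<Otimes> D) \<Otimes> V) id (assoc_inv K D D V)
        \<circ> tmap K W (D \<Otimes> (D \<Otimes> V)) id (tmap K D (D \<Otimes> V) (mult_map K D) \<sigma>)
        \<circ> tmap K W ((D \<Otimes> D) \<Otimes> (V \<Otimes> V)) id (assoc_inv K D D (V \<Otimes> V))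
        \<circ> tmap K W (D \<Otimes> (D \<Otimes> (V \<Otimes> V))) id (tmap K D (D \<Otimes> (V \<Otimes> V)) id (assoc K D V V))
        \<circ> tmap K W (D \<Otimes> ((D \<Otimes> V) \<Otimes> V)) id (tmap K D ((D \<Otimes> V) \<Otimes> V) id (tmap K (D \<Otimes> V) V R id))
        \<circ> tmap K W (D \<Otimes> ((V \<Otimes> D) \<Otimes> V)) id (tmap K D ((V \<Otimes> D) \<Otimes> V) id (assoc_inv K V D V))
        \<circ> tmap K W (D \<Otimes> (V \<Otimes> (D \<Otimes> V))) id (assoc K D V (D \<Otimes> V))
        \<circ> assoc K W (D \<Otimes> V) (D \<Otimes> V)
        \<circ> tmap K (W \<Otimes> (D \<Otimes> V)) (D \<Otimes> V) Q id
        \<circ> assoc_inv K V W (D \<Otimes> V)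
        \<circ> tmap K V (W \<Otimes> (D \<Otimes> V)) id Q) (ptensor K V (V \<Otimes> W) v (ptensor K V W v' w))"
  shows "\<rho> (\<sigma> (ptensor K V V v v')) (jW w) = \<rho> (jV v) (Q (ptensor K V W v' w))"
proof -
  have "Pb (ptensor K (D \<Otimes> V) W (\<sigma> (ptensor K V V v v')) w)
      = c_right (tmap K X (D \<Otimes> V) Q id (assoc_inv K V W (D \<Otimes> V) (ptensor K V X v (Q (ptensor K V W v' w)))))"
    using c vvw by (simp add: c_right_def P_bar_def)
  then show ?thesis
    using vvw by (simp add: \<rho>_jW c_right_Q)
qed

end

text \<open>From here on the three conditions enter only in this form, free of composites and
  rebracketings.\<close>

locale iterated = iterated_data +
  assumes cond_a: "\<lbrakk>v \<in> carrier V; d \<in> carrier D; w \<in> carrier W\<rbrakk> \<Longrightarrow>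
      \<rho> (jV v) (\<kappa> (P (ptensor K D W d w))) = \<rho> (R (ptensor K V D v d)) (jW w)"
    and cond_b: "\<lbrakk>v \<in> carrier V; w \<in> carrier W; w' \<in> carrier W\<rbrakk> \<Longrightarrow>
      \<rho> (jV v) (\<kappa> (\<nu> (ptensor K W W w w'))) = XM.prod (Q (ptensor K V W v w)) (jW w')"
    and cond_c: "\<lbrakk>v \<in> carrier V; v' \<in> carrier V; w \<in> carrier W\<rbrakk> \<Longrightarrow>
      \<rho> (\<sigma> (ptensor K V V v v')) (jW w) = \<rho> (jV v) (Q (ptensor K V W v' w))"
begin

section \<open>\<open>\<rho>\<close> as a representation of the algebra
  \<open>D \<otimes> V\<close>\<close>

lemma \<rho>_jV_jD:
  assumes "v \<in> carrier V" "d \<in> carrier D" "x \<in> carrier X"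
  shows "\<rho> (jV v) (\<rho> (jD d) x) = \<rho> (R (ptensor K V D v d)) x"
  by (rule \<rho>_\<rho>_ext)
     (use assms in \<open>simp_all add: \<rho>_jW[of "jD d"] P_bar_jD cond_a\<close>)

lemma \<rho>_jV_jV:
  assumes "v \<in> carrier V" "u \<in> carrier V" "x \<in> carrier X"
  shows "\<rho> (jV v) (\<rho> (jV u) x) = \<rho> (\<sigma> (ptensor K V V v u)) x"
  by (rule \<rho>_\<rho>_ext)
     (use assms in \<open>simp_all add: \<rho>_jW[of "jV u"] P_bar_jV cond_c\<close>)

lemma \<rho>_right_jV:
  assumes "r \<in> carrier (D \<Otimes> V)" "u \<in> carrier V" "x \<in> carrier X"
  shows "\<rho> r (\<rho> (jV u) x) = \<rho> (CD.\<sigma>_ext (ptensor K (D \<Otimes> V) V r u)) x"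
proof -
  have "\<forall>r\<in>carrier (D \<Otimes> V). \<rho> r (\<rho> (jV u) x) = \<rho> (CD.\<sigma>_ext (ptensor K (D \<Otimes> V) V r u)) x"
  proof (rule tensor_ext)
    fix d v assume *: "d \<in> carrier D" "v \<in> carrier V"
    have "\<rho> (ptensor K D V d v) (\<rho> (jV u) x) = \<rho> (jD d) (\<rho> (jV v) (\<rho> (jV u) x))"
      using * assms by (simp add: \<rho>_jD_jV)
    also have "\<dots> = \<rho> (CD.act d (\<sigma> (ptensor K V V v u))) x"
      using * assms by (simp add: \<rho>_jV_jV \<rho>_jD)
    finally show "\<rho> (ptensor K D V d v) (\<rho> (jV u) x)
        = \<rho> (CD.\<sigma>_ext (ptensor K (D \<Otimes> V) V (ptensor K D V d v) u)) x"
      using * assms by simp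
  qed ((rule lin'' | simp add: assms)+)
  then show ?thesis using assms by blast
qed

text \<open>Both operators factor into parts from \<open>D\<close> and from \<open>V\<close>, giving
  \<open>d v d' u\<close>. The inner pair \<open>v d'\<close> is exchanged through \<open>R\<close>,
  then \<open>u\<close> is absorbed by \<open>\<rho>_right_jV\<close> and \<open>d\<close> by
  \<open>\<rho>_jD\<close>, which reproduces the formula for the product of
  \<open>D \<otimes> V\<close>.\<close>

lemma \<rho>_\<rho>:
  assumes "b \<in> carrier (D \<Otimes> V)" "b' \<in> carrier (D \<Otimes> V)" "x \<in> carrier X"
  shows "\<rho> b (\<rho> b' x) = \<rho> (CD.prod b b') x"
proof -
  have "\<forall>b\<in>carrier (D \<Otimes> V). \<rho> b (\<rho> b' x) = \<rho> (CD.prod b b') x"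
  proof (rule tensor_ext)
    fix d v assume dv: "d \<in> carrier D" "v \<in> carrier V"
    have "\<forall>b'\<in>carrier (D \<Otimes> V). \<rho> (ptensor K D V d v) (\<rho> b' x) = \<rho> (CD.prod (ptensor K D V d v) b') x"
    proof (rule tensor_ext)
      fix d' u assume du: "d' \<in> carrier D" "u \<in> carrier V"
      have "\<rho> (ptensor K D V d v) (\<rho> (ptensor K D V d' u) x)
          = \<rho> (jD d) (\<rho> (jV v) (\<rho> (jD d') (\<rho> (jV u) x)))"
        using dv du assms by (simp add: \<rho>_jD_jV)
      also have "\<dots> = \<rho> (jD d) (\<rho> (CD.\<sigma>_ext (ptensor K (D \<Otimes> V) V (R (ptensor K V D v d')) u)) x)"
        using dv du assms by (subst \<rho>_jV_jD) (simp_all add: \<rho>_right_jV)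
      also have "\<dots> = \<rho> (CD.prod (ptensor K D V d v) (ptensor K D V d' u)) x"
        using dv du assms by (simp add: \<rho>_jD CD.prod_pure)
      finally show "\<rho> (ptensor K D V d v) (\<rho> (ptensor K D V d' u) x)
          = \<rho> (CD.prod (ptensor K D V d v) (ptensor K D V d' u)) x" .
    qed ((rule lin'' | simp add: assms dv)+)
    then show "\<rho> (ptensor K D V d v) (\<rho> b' x) = \<rho> (CD.prod (ptensor K D V d v) b') x"
      using assms by blast
  qed ((rule lin'' | simp add: assms)+)
  then show ?thesis using assms by blast
qed

section \<open>Mixed associativity in \<open>X\<close> and the mirror crossed product\<close>

lemma \<rho>_pure: "b \<in> carrier (D \<Otimes> V) \<Longrightarrow> w \<in> carrier W \<Longrightarrow> c \<in> carrier (D \<Otimes> V) \<Longrightarrow>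
    \<rho> b (ptensor K W (D \<Otimes> V) w c) = XM.act c (Pb (ptensor K (D \<Otimes> V) W b w))"
  by (simp add: \<rho>_def X_prod_iB)

text \<open>This is the mirror multiplication read from the inside: \<open>c\<close> meets the
  second factor through \<open>P_bar\<close> before \<open>w\<close> is multiplied on.\<close>

lemma prod_pure_\<rho>:
  assumes "w \<in> carrier W" "c \<in> carrier (D \<Otimes> V)" "z \<in> carrier X"
  shows "XM.prod (ptensor K W (D \<Otimes> V) w c) z = XM.prod (jW w) (\<rho> c z)"
proof -
  have "\<forall>z\<in>carrier X. XM.prod (ptensor K W (D \<Otimes> V) w c) z = XM.prod (jW w) (\<rho> c z)"
  proof (rule tensor_ext)
    fix u b assume *: "u \<in> carrier W" "b \<in> carrier (D \<Otimes> V)"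
    then show "XM.prod (ptensor K W (D \<Otimes> V) w c) (ptensor K W (D \<Otimes> V) u b)
        = XM.prod (jW w) (\<rho> c (ptensor K W (D \<Otimes> V) u b))"
      using assms by (simp add: \<rho>_pure X_prod_act X_prod_incW_left X_prod_pure)
  qed ((rule lin'' | simp add: assms)+)
  then show ?thesis using assms by blast
qed

text \<open>For pure \<open>y = u \<otimes> b\<close> both sides become \<open>u\<close> times a
  left multiplication, by \<open>b c\<close> on one side and by \<open>b\<close> after
  \<open>c\<close> on the other; \<open>\<rho>_\<rho>\<close> identifies them.\<close>

lemma act_prod:
  assumes "y \<in> carrier X" "c \<in> carrier (D \<Otimes> V)" "w \<in> carrier W"
  shows "XM.prod (XM.act c y) (jW w) = XM.prod y (\<rho> c (jW w))"
proof -
  have "\<forall>y\<in>carrier X. XM.prod (XM.act c y) (jW w) = XM.prod y (\<rho> c (jW w))"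
  proof (rule tensor_ext)
    fix u b assume "u \<in> carrier W" "b \<in> carrier (D \<Otimes> V)"
    then show "XM.prod (XM.act c (ptensor K W (D \<Otimes> V) u b)) (jW w)
        = XM.prod (ptensor K W (D \<Otimes> V) u b) (\<rho> c (jW w))"
      using assms prod_pure_\<rho>[of u "CD.prod b c" "jW w"] prod_pure_\<rho>[of u b "\<rho> c (jW w)"]
      by (simp add: \<rho>_\<rho>)
  qed ((rule lin'' | simp add: assms)+)
  then show ?thesis using assms by blast
qed

text \<open>Right linearity reduces \<open>z\<close> to an element of \<open>W\<close>, where the
  claim is associativity of \<open>W \<otimes> D\<close> under \<open>\<kappa>\<close>. A general
  \<open>z\<close> is allowed because \<open>\<rho>_jD_prod\<close> uses
  \<open>z = \<rho> c (jW u)\<close>.\<close>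

lemma \<kappa>_P_prod:
  assumes "d \<in> carrier D" "w \<in> carrier W" "z \<in> carrier X"
  shows "XM.prod (\<kappa> (P (ptensor K D W d w))) z = \<rho> (jD d) (XM.prod (jW w) z)"
proof -
  have "\<forall>z\<in>carrier X. XM.prod (\<kappa> (P (ptensor K D W d w))) z = \<rho> (jD d) (XM.prod (jW w) z)"
  proof (rule X_ext)
    fix u c assume *: "u \<in> carrier W" "c \<in> carrier (D \<Otimes> V)"
    have "XM.prod (\<kappa> (P (ptensor K D W d w))) (jW u)
        = \<kappa> (MD.prod (MD.prod (ptensor K W D eW d) (ptensor K W D w \<one>\<^bsub>D\<^esub>)) (ptensor K W D u \<one>\<^bsub>D\<^esub>))"
      using * assms by (simp add: \<kappa>_prod MD.prod_incB_incW)
    also have "\<dots> = \<kappa> (MD.prod (ptensor K W D eW d) (MD.prod (ptensor K W D w \<one>\<^bsub>D\<^esub>) (ptensor K W D u \<one>\<^bsub>D\<^esub>)))"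
      using * assms MD.prod_assoc[OF mirror] by simp
    also have "\<dots> = \<rho> (jD d) (XM.prod (jW w) (jW u))"
      using * assms by (simp add: \<kappa>_prod \<rho>_def)
    finally show "XM.prod (\<kappa> (P (ptensor K D W d w))) (XM.act c (jW u))
        = \<rho> (jD d) (XM.prod (jW w) (XM.act c (jW u)))"
      using * assms by (simp add: X_prod_act \<rho>_act del: X_act_pure)
  qed ((rule lin'' | simp add: assms)+)
  then show ?thesis using assms by blast
qed

lemma \<rho>_jD_prod:
  assumes "d \<in> carrier D" "x \<in> carrier X" "u \<in> carrier W"
  shows "XM.prod (\<rho> (jD d) x) (jW u) = \<rho> (jD d) (XM.prod x (jW u))"
proof -
  have "\<forall>x\<in>carrier X. XM.prod (\<rho> (jD d) x) (jW u) = \<rho> (jD d) (XM.prod x (jW u))"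
  proof (rule X_ext)
    fix w c assume *: "w \<in> carrier W" "c \<in> carrier (D \<Otimes> V)"
    then show "XM.prod (\<rho> (jD d) (XM.act c (jW w))) (jW u) = \<rho> (jD d) (XM.prod (XM.act c (jW w)) (jW u))"
      using assms by (simp add: \<rho>_act act_prod \<rho>_jW[of _ w] P_bar_jD \<kappa>_P_prod del: X_act_pure)
  qed ((rule lin'' | simp add: assms)+)
  then show ?thesis using assms by blast
qed

text \<open>An element \<open>d \<otimes> v\<close> acts as \<open>d\<close> after \<open>v\<close>:
  \<open>cond_b\<close> handles \<open>v\<close>, and \<open>\<rho>_jD_prod\<close> handles
  \<open>d\<close> even though the product with \<open>v\<close> has left \<open>W\<close>.\<close>

lemma \<rho>_prod:
  assumes "b \<in> carrier (D \<Otimes> V)" "w \<in> carrier W" "u \<in> carrier W"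
  shows "XM.prod (\<rho> b (jW w)) (jW u) = \<rho> b (XM.prod (jW w) (jW u))"
proof -
  have *: "XM.prod (jW w) (jW u) = \<kappa> (\<nu> (ptensor K W W w u))"
    using assms MD.prod_incW_incW[of w u] \<kappa>_prod[of "ptensor K W D w \<one>\<^bsub>D\<^esub>" "ptensor K W D u \<one>\<^bsub>D\<^esub>"]
    by simp
  have "\<forall>b\<in>carrier (D \<Otimes> V). XM.prod (\<rho> b (jW w)) (jW u) = \<rho> b (XM.prod (jW w) (jW u))"
  proof (rule tensor_ext)
    fix d v assume dv: "d \<in> carrier D" "v \<in> carrier V"
    have "XM.prod (\<rho> (ptensor K D V d v) (jW w)) (jW u) = XM.prod (\<rho> (jD d) (\<rho> (jV v) (jW w))) (jW u)"
      using dv assms by (simp add: \<rho>_jD_jV)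
    also have "\<dots> = \<rho> (jD d) (XM.prod (\<rho> (jV v) (jW w)) (jW u))"
      using dv assms by (simp add: \<rho>_jD_prod)
    also have "\<dots> = \<rho> (jD d) (\<rho> (jV v) (XM.prod (jW w) (jW u)))"
      using dv assms by (simp add: * cond_b \<rho>_jW P_bar_jV)
    finally show "XM.prod (\<rho> (ptensor K D V d v) (jW w)) (jW u) = \<rho> (ptensor K D V d v) (XM.prod (jW w) (jW u))"
      using dv assms by (simp add: \<rho>_jD_jV)
  qed ((rule lin'' | simp add: assms)+)
  then show ?thesis using assms by blast
qed

lemma mirror_bar: "mirror_crossed_product K W B eW Pb \<nu>b"
  unfolding XM.mirror_crossed_product_iff XM.P_mult_at_def XM.cocycle_at_def XM.twisted_at_def
proof (intro conjI ballI)
  fix b c w assume "b \<in> carrier B" "c \<in> carrier B" "w \<in> carrier W"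
  then show "XM.prod (XM.inc\<^sub>B b) (XM.prod (XM.inc\<^sub>B c) (XM.inc\<^sub>W w))
      = XM.prod (XM.inc\<^sub>B (b \<otimes>\<^bsub>B\<^esub> c)) (XM.inc\<^sub>W w)"
    using \<rho>_\<rho>[of b c "jW w"] by (simp add: \<rho>_def)
next
  fix w w' u assume *: "w \<in> carrier W" "w' \<in> carrier W" "u \<in> carrier W"
  let ?i = "\<lambda>w. ptensor K W D w \<one>\<^bsub>D\<^esub>"
  have "\<kappa> (MD.prod (MD.prod (?i w) (?i w')) (?i u)) = \<kappa> (MD.prod (?i w) (MD.prod (?i w') (?i u)))"
    using * MD.prod_assoc[OF mirror] by simp
  then show "XM.prod (XM.prod (XM.inc\<^sub>W w) (XM.inc\<^sub>W w')) (XM.inc\<^sub>W u)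
      = XM.prod (XM.inc\<^sub>W w) (XM.prod (XM.inc\<^sub>W w') (XM.inc\<^sub>W u))"
    using * by (simp add: \<kappa>_prod)
next
  fix b w w' assume "b \<in> carrier B" "w \<in> carrier W" "w' \<in> carrier W"
  then show "XM.prod (XM.prod (XM.inc\<^sub>B b) (XM.inc\<^sub>W w)) (XM.inc\<^sub>W w')
      = XM.prod (XM.inc\<^sub>B b) (XM.prod (XM.inc\<^sub>W w) (XM.inc\<^sub>W w'))"
    using \<rho>_prod[of b w w'] by (simp add: \<rho>_def)
qed

lemmas X_assoc = XM.prod_assoc[OF mirror_bar, simplified]

section \<open>Transport along the rebracketing\<close>

abbreviation "\<phi> \<equiv> assoc K W D V"

lemma R_bar_eq: "Rb y = assoc_inv K W D V (R_bar' y)"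
  by (simp add: R_bar_def R_bar'_def R_right_def)

lemma R_bar_linear: "linear_map K (V \<Otimes> (W \<Otimes> D)) ((W \<Otimes> D) \<Otimes> V) Rb"
  unfolding R_bar_eq by (rule lin linear_map_comp[OF _ R_bar'_linear] | simp)+

lemma \<sigma>_bar_linear: "linear_map K (V \<Otimes> V) ((W \<Otimes> D) \<Otimes> V) \<sigma>b"
  unfolding \<sigma>_bar_def by (rule lin | simp)+

lemma R_bar_pure:
  "v \<in> carrier V \<Longrightarrow> s \<in> carrier (W \<Otimes> D) \<Longrightarrow>
    Rb (ptensor K V (W \<Otimes> D) v s) = assoc_inv K W D V (\<rho> (jV v) (\<kappa> s))"
  by (simp add: R_bar_eq R_bar'_eq)

lemma R_bar_e:
  assumes "s \<in> carrier (W \<Otimes> D)"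
  shows "Rb (ptensor K V (W \<Otimes> D) eV s) = ptensor K (W \<Otimes> D) V s eV"
proof -
  have "\<rho> (jV eV) (\<kappa> s) = \<kappa> s"
    using assms XM.prod_one_left[of "\<kappa> s"] by (simp add: \<rho>_def)
  then show ?thesis
    \<comment> \<open>\<open>\<kappa>\<close> is unfolded only once the product has disappeared, so
      that \<open>assoc_inv\<close> meets \<open>assoc\<close>.\<close>
    using assms by (simp add: R_bar_pure) (simp add: \<kappa>_def assoc_inv_assoc)
qed

lemma R_bar_one:
  "v \<in> carrier V \<Longrightarrow> Rb (ptensor K V (W \<Otimes> D) v (ptensor K W D eW \<one>\<^bsub>D\<^esub>))
    = ptensor K (W \<Otimes> D) V (ptensor K W D eW \<one>\<^bsub>D\<^esub>) v"
  by (simp add: R_bar_pure \<rho>_jW P_bar_jV)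

text \<open>Again only linearity and unit laws: this makes \<open>XC.prod\<close> available for
  comparison with \<open>XM.prod\<close> while its associativity is still open.\<close>

sublocale XC: crossed_data K A V eV Rb \<sigma>b
  by (intro crossed_data.intro crossed_data_axioms.intro CD.V.vectorspace_axioms
        MD.mirror_alg_algebra mirror)
     (simp_all add: R_bar_linear \<sigma>_bar_linear R_bar_e R_bar_one,
      simp_all add: \<sigma>_bar_def)

lemmas C_act_linear [simp] = XC.act_linear[simplified]
lemmas C_act_closed [simp] = XC.act_closed[simplified]
lemmas C_act_pure [simp] = XC.act_pure[simplified]
lemmas C_prod_closed [simp] = XC.prod_closed[simplified]
lemmas C_prod_pure = XC.prod_pure[simplified]
lemmas C_\<sigma>_ext_linear [simp] = XC.\<sigma>_ext_linear[simplified]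
lemmas C_\<sigma>_ext_closed [simp] = linear_map_closed[OF C_\<sigma>_ext_linear]
lemmas C_\<sigma>_ext_pure [simp] = XC.\<sigma>_ext_pure[simplified]
lemmas C_prod_left_linear = XC.linear_map_prod_left[simplified]
lemmas C_prod_right_linear = XC.linear_map_prod_right[simplified]
lemmas R_bar_closed [simp] = linear_map_closed[OF R_bar_linear]
lemmas \<sigma>_bar_closed [simp] = linear_map_closed[OF \<sigma>_bar_linear]

lemmas lin''' = lin'' linear_map_comp[OF _ C_act_linear] linear_map_comp[OF _ C_\<sigma>_ext_linear]
  C_prod_left_linear C_prod_right_linear

lemma \<phi>_closed [simp]: "x \<in> carrier ((W \<Otimes> D) \<Otimes> V) \<Longrightarrow> \<phi> x \<in> carrier X"
  by (rule linear_map_closed[OF assoc_linear]) simp_all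

text \<open>A pure tensor corresponds to the product of its two entries in \<open>X\<close>. With
  the corresponding descriptions of \<open>Rb\<close> and \<open>\<sigma>b\<close> in
  \<open>\<phi>_R\<close> and \<open>\<phi>_\<sigma>\<close>, every map in the crossed
  multiplication becomes a product.\<close>

lemma \<phi>_pure:
  assumes "s \<in> carrier (W \<Otimes> D)" "v \<in> carrier V"
  shows "\<phi> (ptensor K (W \<Otimes> D) V s v) = XM.prod (\<kappa> s) (iB (jV v))"
proof -
  have "\<forall>s\<in>carrier (W \<Otimes> D). \<phi> (ptensor K (W \<Otimes> D) V s v) = XM.prod (\<kappa> s) (iB (jV v))"
    by (rule tensor_ext) ((rule lin''' | simp add: assms X_prod_incB_right CD.prod_incA_left)+)
  then show ?thesis using assms by blast
qed

lemma \<phi>_R: "v \<in> carrier V \<Longrightarrow> s \<in> carrier (W \<Otimes> D) \<Longrightarrow>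
    \<phi> (Rb (ptensor K V (W \<Otimes> D) v s)) = XM.prod (iB (jV v)) (\<kappa> s)"
  by (simp add: R_bar_pure assoc_assoc_inv) (simp add: \<rho>_def)

lemma iB_prod: "b \<in> carrier (D \<Otimes> V) \<Longrightarrow> c \<in> carrier (D \<Otimes> V) \<Longrightarrow>
    XM.prod (iB b) (iB c) = iB (CD.prod b c)"
  by (simp add: X_prod_incB_right)

lemma \<phi>_\<sigma>: "v \<in> carrier V \<Longrightarrow> u \<in> carrier V \<Longrightarrow>
    \<phi> (\<sigma>b (ptensor K V V v u)) = XM.prod (iB (jV v)) (iB (jV u))"
  by (simp add: iB_prod CD.prod_incV_incV) (simp add: \<sigma>_bar_def assoc_assoc_inv)

lemma \<phi>_act:
  assumes "s \<in> carrier (W \<Otimes> D)" "x \<in> carrier ((W \<Otimes> D) \<Otimes> V)"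
  shows "\<phi> (XC.act s x) = XM.prod (\<kappa> s) (\<phi> x)"
proof -
  have "\<forall>x\<in>carrier ((W \<Otimes> D) \<Otimes> V). \<phi> (XC.act s x) = XM.prod (\<kappa> s) (\<phi> x)"
    by (rule tensor_ext) ((rule lin''' | simp add: assms \<phi>_pure \<kappa>_prod X_assoc)+)
  then show ?thesis using assms by blast
qed

lemma \<phi>_\<sigma>_ext:
  assumes "t \<in> carrier ((W \<Otimes> D) \<Otimes> V)" "u \<in> carrier V"
  shows "\<phi> (XC.\<sigma>_ext (ptensor K ((W \<Otimes> D) \<Otimes> V) V t u)) = XM.prod (\<phi> t) (iB (jV u))"
proof -
  have "\<forall>t\<in>carrier ((W \<Otimes> D) \<Otimes> V).
      \<phi> (XC.\<sigma>_ext (ptensor K ((W \<Otimes> D) \<Otimes> V) V t u)) = XM.prod (\<phi> t) (iB (jV u))"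
    by (rule tensor_ext) ((rule lin''' | simp add: assms \<phi>_pure \<phi>_act \<phi>_\<sigma> X_assoc)+)
  then show ?thesis using assms by blast
qed

text \<open>For \<open>s \<otimes> v\<close> and \<open>s' \<otimes> v'\<close> the crossed
  multiplication forms \<open>s ((v s') v')\<close> in \<open>X\<close>, and \<open>X_assoc\<close>
  rebrackets this to \<open>(s v) (s' v')\<close>.\<close>

lemma \<phi>_prod:
  assumes "x \<in> carrier ((W \<Otimes> D) \<Otimes> V)" "y \<in> carrier ((W \<Otimes> D) \<Otimes> V)"
  shows "\<phi> (XC.prod x y) = XM.prod (\<phi> x) (\<phi> y)"
proof -
  have "\<forall>x\<in>carrier ((W \<Otimes> D) \<Otimes> V). \<phi> (XC.prod x y) = XM.prod (\<phi> x) (\<phi> y)"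
  proof (rule tensor_ext)
    fix s v assume sv: "s \<in> carrier (W \<Otimes> D)" "v \<in> carrier V"
    have "\<forall>y\<in>carrier ((W \<Otimes> D) \<Otimes> V).
        \<phi> (XC.prod (ptensor K (W \<Otimes> D) V s v) y) = XM.prod (\<phi> (ptensor K (W \<Otimes> D) V s v)) (\<phi> y)"
      by (rule tensor_ext)
         ((rule lin''' | simp add: sv C_prod_pure \<phi>_act \<phi>_\<sigma>_ext \<phi>_R \<phi>_pure X_assoc)+)
    then show "\<phi> (XC.prod (ptensor K (W \<Otimes> D) V s v) y) = XM.prod (\<phi> (ptensor K (W \<Otimes> D) V s v)) (\<phi> y)"
      using assms by blast
  qed ((rule lin''' | simp add: assms)+)
  then show ?thesis using assms by blast
qed

lemma \<phi>_inv: "x \<in> carrier ((W \<Otimes> D) \<Otimes> V) \<Longrightarrow> assoc_inv K W D V (\<phi> x) = x"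
  by (simp add: assoc_inv_assoc)

lemma crossed_bar: "crossed_product K A V eV Rb \<sigma>b"
proof (rule XC.crossed_productI)
  fix x y z assume "x \<in> carrier (A \<Otimes> V)" "y \<in> carrier (A \<Otimes> V)" "z \<in> carrier (A \<Otimes> V)"
  then have "\<phi> (XC.prod (XC.prod x y) z) = \<phi> (XC.prod x (XC.prod y z))"
    and "XC.prod (XC.prod x y) z \<in> carrier ((W \<Otimes> D) \<Otimes> V)"
    and "XC.prod x (XC.prod y z) \<in> carrier ((W \<Otimes> D) \<Otimes> V)"
    by (simp_all add: \<phi>_prod X_assoc)
  \<comment> \<open>Both sides have the same image under \<open>\<phi>\<close>, which is injective
    on the carrier because \<open>assoc_inv\<close> undoes it.\<close>
  then show "XC.prod (XC.prod x y) z = XC.prod x (XC.prod y z)"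
    using \<phi>_inv by metis
qed

lemma algebra_iso_\<phi>:
  "algebra_iso K (crossed_alg K A V eV Rb \<sigma>b) (mirror_crossed_alg K W B eW Pb \<nu>b) \<phi>"
  unfolding algebra_iso_def ring_iso_def ring_hom_def
proof (intro conjI CollectI ballI funcsetI)
  show "unital_algebra K (crossed_alg K A V eV Rb \<sigma>b)"
    by (rule XC.crossed_alg_algebra[OF crossed_bar])
  show "unital_algebra K (mirror_crossed_alg K W B eW Pb \<nu>b)"
    by (rule XM.mirror_alg_algebra[OF mirror_bar])
  show "linear_map K (crossed_alg K A V eV Rb \<sigma>b) (mirror_crossed_alg K W B eW Pb \<nu>b) \<phi>"
    by (simp add: XC.crossed_alg_linear XM.mirror_alg_linear)
  show "bij_betw \<phi> (carrier (crossed_alg K A V eV Rb \<sigma>b)) (carrier (mirror_crossed_alg K W B eW Pb \<nu>b))"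
    by (rule bij_betwI[where g = "assoc_inv K W D V"])
       (simp_all add: assoc_inv_assoc assoc_assoc_inv linear_map_closed[OF assoc_inv_linear])
qed (simp_all add: \<phi>_prod linear_map_add[OF assoc_linear])

end

theorem theorem2p3:
  fixes K :: "('k, 'm) ring_scheme" (structure)
    and D :: "('k, 'd, 'm1) module_scheme"
    and W :: "('k, 'w, 'm2) module_scheme"
    and V :: "('k, 'v, 'm3) module_scheme"
    and eW :: 'w and eV :: 'v
    and P :: "('d \<times> 'w \<Rightarrow> 'k) set \<Rightarrow> ('w \<times> 'd \<Rightarrow> 'k) set"
    and \<nu> :: "('w \<times> 'w \<Rightarrow> 'k) set \<Rightarrow> ('w \<times> 'd \<Rightarrow> 'k) set"
    and R :: "('v \<times> 'd \<Rightarrow> 'k) set \<Rightarrow> ('d \<times> 'v \<Rightarrow> 'k) set"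
    and \<sigma> :: "('v \<times> 'v \<Rightarrow> 'k) set \<Rightarrow> ('d \<times> 'v \<Rightarrow> 'k) set"
    and Q :: "('v \<times> 'w \<Rightarrow> 'k) set \<Rightarrow> ('w \<times> ('d \<times> 'v \<Rightarrow> 'k) set \<Rightarrow> 'k) set"
  assumes mirror: "mirror_crossed_product K W D eW P \<nu>"
    and crossed: "crossed_product K D V eV R \<sigma>"
    and Q_linear: "linear_map K (V \<Otimes> W) (W \<Otimes> (D \<Otimes> V)) Q"
    and Q_eV: "\<And>w. w \<in> carrier W \<Longrightarrow>
      Q (ptensor K V W eV w) = ptensor K W (D \<Otimes> V) w (ptensor K D V \<one>\<^bsub>D\<^esub> eV)"
    and Q_eW: "\<And>v. v \<in> carrier V \<Longrightarrow>
      Q (ptensor K V W v eW) = ptensor K W (D \<Otimes> V) eW (ptensor K D V \<one>\<^bsub>D\<^esub> v)"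
    and a: "\<And>x. x \<in> carrier (V \<Otimes> (D \<Otimes> W)) \<Longrightarrow>
      (tmap K W (D \<Otimes> V) id (tmap K D V (mult_map K D) id)
        \<circ> tmap K W ((D \<Otimes> D) \<Otimes> V) id (assoc_inv K D D V)
        \<circ> tmap K W (D \<Otimes> (D \<Otimes> V)) id (tmap K D (D \<Otimes> V) id R)
        \<circ> tmap K W (D \<Otimes> (V \<Otimes> D)) id (assoc K D V D)
        \<circ> assoc K W (D \<Otimes> V) D
        \<circ> tmap K (W \<Otimes> (D \<Otimes> V)) D Q id
        \<circ> assoc_inv K V W D
        \<circ> tmap K V (W \<Otimes> D) id P) x =
      (tmap K W (D \<Otimes> V) id (tmap K D V (mult_map K D) id)
        \<circ> tmap K W ((D \<Otimes> D) \<Otimes> V) id (assoc_inv K D D V)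
        \<circ> assoc K W D (D \<Otimes> V)
        \<circ> tmap K (W \<Otimes> D) (D \<Otimes> V) P id
        \<circ> assoc_inv K D W (D \<Otimes> V)
        \<circ> tmap K D (W \<Otimes> (D \<Otimes> V)) id Q
        \<circ> assoc K D V W
        \<circ> tmap K (D \<Otimes> V) W R id
        \<circ> assoc_inv K V D W) x"
    and b: "\<And>x. x \<in> carrier (V \<Otimes> (W \<Otimes> W)) \<Longrightarrow>
      (tmap K W (D \<Otimes> V) id (tmap K D V (mult_map K D) id)
        \<circ> tmap K W ((D \<Otimes> D) \<Otimes> V) id (assoc_inv K D D V)
        \<circ> tmap K W (D \<Otimes> (D \<Otimes> V)) id (tmap K D (D \<Otimes> V) id R)
        \<circ> tmap K W (D \<Otimes> (V \<Otimes> D)) id (assoc K D V D)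
        \<circ> assoc K W (D \<Otimes> V) D
        \<circ> tmap K (W \<Otimes> (D \<Otimes> V)) D Q id
        \<circ> assoc_inv K V W D
        \<circ> tmap K V (W \<Otimes> D) id \<nu>) x =
      (tmap K W (D \<Otimes> V) id (tmap K D V (mult_map K D) id)
        \<circ> tmap K W ((D \<Otimes> D) \<Otimes> V) id (assoc_inv K D D V)
        \<circ> assoc K W D (D \<Otimes> V)
        \<circ> tmap K (W \<Otimes> D) (D \<Otimes> V) \<nu> (tmap K D V (mult_map K D) id)
        \<circ> tmap K (W \<Otimes> W) ((D \<Otimes> D) \<Otimes> V) id (assoc_inv K D D V)
        \<circ> assoc_inv K W W (D \<Otimes> (D \<Otimes> V))
        \<circ> tmap K W (W \<Otimes> (D \<Otimes> (D \<Otimes> V))) id (assoc K W D (D \<Otimes> V))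
        \<circ> tmap K W ((W \<Otimes> D) \<Otimes> (D \<Otimes> V)) id (tmap K (W \<Otimes> D) (D \<Otimes> V) P id)
        \<circ> tmap K W ((D \<Otimes> W) \<Otimes> (D \<Otimes> V)) id (assoc_inv K D W (D \<Otimes> V))
        \<circ> tmap K W (D \<Otimes> (W \<Otimes> (D \<Otimes> V))) id (tmap K D (W \<Otimes> (D \<Otimes> V)) id Q)
        \<circ> tmap K W (D \<Otimes> (V \<Otimes> W)) id (assoc K D V W)
        \<circ> assoc K W (D \<Otimes> V) W
        \<circ> tmap K (W \<Otimes> (D \<Otimes> V)) W Q id
        \<circ> assoc_inv K V W W) x"
    and c: "\<And>x. x \<in> carrier (V \<Otimes> (V \<Otimes> W)) \<Longrightarrow>
      (tmap K W (D \<Otimes> V) id (tmap K D V (mult_map K D) id)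
        \<circ> tmap K W ((D \<Otimes> D) \<Otimes> V) id (assoc_inv K D D V)
        \<circ> assoc K W D (D \<Otimes> V)
        \<circ> tmap K (W \<Otimes> D) (D \<Otimes> V) P id
        \<circ> assoc_inv K D W (D \<Otimes> V)
        \<circ> tmap K D (W \<Otimes> (D \<Otimes> V)) id Q
        \<circ> assoc K D V W
        \<circ> tmap K (D \<Otimes> V) W \<sigma> id
        \<circ> assoc_inv K V V W) x =
      (tmap K W (D \<Otimes> V) id (tmap K D V (mult_map K D) id)
        \<circ> tmap K W ((D \<Otimes> D) \<Otimes> V) id (assoc_inv K D D V)
        \<circ> tmap K W (D \<Otimes> (D \<Otimes> V)) id (tmap K D (D \<Otimes> V) (mult_map K D) \<sigma>)
        \<circ> tmap K W ((D \<Otimes> D) \<Otimes> (V \<Otimes> V)) id (assoc_inv K D D (V \<Otimes> V))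
        \<circ> tmap K W (D \<Otimes> (D \<Otimes> (V \<Otimes> V))) id (tmap K D (D \<Otimes> (V \<Otimes> V)) id (assoc K D V V))
        \<circ> tmap K W (D \<Otimes> ((D \<Otimes> V) \<Otimes> V)) id (tmap K D ((D \<Otimes> V) \<Otimes> V) id (tmap K (D \<Otimes> V) V R id))
        \<circ> tmap K W (D \<Otimes> ((V \<Otimes> D) \<Otimes> V)) id (tmap K D ((V \<Otimes> D) \<Otimes> V) id (assoc_inv K V D V))
        \<circ> tmap K W (D \<Otimes> (V \<Otimes> (D \<Otimes> V))) id (assoc K D V (D \<Otimes> V))
        \<circ> assoc K W (D \<Otimes> V) (D \<Otimes> V)
        \<circ> tmap K (W \<Otimes> (D \<Otimes> V)) (D \<Otimes> V) Q id
        \<circ> assoc_inv K V W (D \<Otimes> V)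
        \<circ> tmap K V (W \<Otimes> (D \<Otimes> V)) id Q) x"
  shows
    "crossed_product K (mirror_crossed_alg K W D eW P \<nu>) V eV
        (R_bar K W D V R Q) (\<sigma>_bar K W D V eW \<sigma>) \<and>
     mirror_crossed_product K W (crossed_alg K D V eV R \<sigma>) eW
        (P_bar K W D V P Q) (\<nu>_bar K W D V eV \<nu>) \<and>
     (\<exists>h. algebra_iso K
            (crossed_alg K (mirror_crossed_alg K W D eW P \<nu>) V eV
              (R_bar K W D V R Q) (\<sigma>_bar K W D V eW \<sigma>))
            (mirror_crossed_alg K W (crossed_alg K D V eV R \<sigma>) eW
              (P_bar K W D V P Q) (\<nu>_bar K W D V eV \<nu>)) h \<and>
          (\<forall>w\<in>carrier W. \<forall>d\<in>carrier D. \<forall>v\<in>carrier V.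
             h (ptensor K (W \<Otimes> D) V (ptensor K W D w d) v) =
             ptensor K W (D \<Otimes> V) w (ptensor K D V d v)))"
proof -
  interpret iterated_data K D W V eW eV P \<nu> R \<sigma> Q
    by (intro iterated_data.intro iterated_data_axioms.intro mirror_crossed_product_data
        crossed_product_data mirror crossed Q_linear Q_eV Q_eW)
  interpret iterated K D W V eW eV P \<nu> R \<sigma> Q
    \<comment> \<open>The three remaining locale assumptions are the conditions evaluated at pure
      tensors and translated into products.\<close>
    by unfold_locales
       (intro condition_a condition_b condition_c a b c ptensor_closed tensor_vectorspace
         MD.spaces CD.spaces; assumption)+
  show ?thesis
    using crossed_bar mirror_bar algebra_iso_\<phi> assoc_pure[OF MD.spaces CD.spaces(2)] by blast
qed

end
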